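(* Let $\mathcal{G}$ be a finite group, let $\Bbbk$ be a commutative ring, and let $L$ be a $\mathcal{G}$-lattice. If $\Bbbk[L]^{\mathcal{G}}$ is Cohen-Macaulay, then so is $\Bbbk[L']^{\mathcal{G}}$ for any $\mathcal{G}$-lattice $L'$ that is rationally isomorphic to $L$.
   Context: A $\mathcal{G}$-lattice is a free abelian group of finite rank on which $\mathcal{G}$ acts by automorphisms. The action on $L$ extends uniquely to an action by $\Bbbk$-algebra automorphisms on the group algebra $\Bbbk[L]$, and $\Bbbk[L]^{\mathcal{G}}$ denotes the subalgebra of $\mathcal{G}$-invariants. Two $\mathcal{G}$-lattices $L$ and $L'$ are rationally isomorphic if $L \otimes_{\mathbb{Z}} \mathbb{Q} \cong L' \otimes_{\mathbb{Z}} \mathbb{Q}$ as $\mathbb{Q}[\mathcal{G}]$-modules. Cohen-Macaulay rings are understood to be noetherian. *)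

theory Defs
  imports "HOL-Algebra.Algebra" "HOL-Library.Extended_Nat" Complex_Main
begin

text \<open>
  The localization of \<^term>\<open>R\<close> at the complement of \<^term>\<open>P\<close>. The pair \<open>(a, s)\<close> stands for the
  fraction \<open>a/s\<close>. The factor \<^term>\<open>u\<close> is needed because \<^term>\<open>R\<close> may have zero divisors.
\<close>

definition loc_rel :: "('a, 'm) ring_scheme \<Rightarrow> 'a set \<Rightarrow> (('a \<times> 'a) \<times> ('a \<times> 'a)) set" where
  "loc_rel R P = {((a, s), (b, t)) | a s b t.
     a \<in> carrier R \<and> b \<in> carrier R \<and> s \<in> carrier R - P \<and> t \<in> carrier R - P \<and>
     (\<exists>u \<in> carrier R - P. u \<otimes> (a \<otimes> t \<ominus> b \<otimes> s) = \<zero>)}"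
  for R (structure)

text \<open>
  Sums and products of classes are formed from all representatives; they are classes again
  because the operations respect \<^const>\<open>loc_rel\<close>.
\<close>

definition localization :: "('a, 'm) ring_scheme \<Rightarrow> 'a set \<Rightarrow> ('a \<times> 'a) set ring" where
  "localization R P =
     \<lparr>carrier = (carrier R \<times> (carrier R - P)) // loc_rel R P,
      monoid.mult = (\<lambda>A B. loc_rel R P ``
        {(a \<otimes> b, s \<otimes> t) | a s b t. (a, s) \<in> A \<and> (b, t) \<in> B}),
      monoid.one = loc_rel R P `` {(\<one>, \<one>)},
      ring.zero = loc_rel R P `` {(\<zero>, \<one>)},
      ring.add = (\<lambda>A B. loc_rel R P ``
        {(a \<otimes> t \<oplus> b \<otimes> s, s \<otimes> t) | a s b t. (a, s) \<in> A \<and> (b, t) \<in> B})\<rparr>"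
  for R (structure)

definition krull_dim :: "('a, 'm) ring_scheme \<Rightarrow> enat" where
  "krull_dim R = Sup {enat n | n.
     \<exists>p :: nat \<Rightarrow> 'a set. (\<forall>i\<le>n. primeideal (p i) R) \<and> (\<forall>i<n. p i \<subset> p (Suc i))}"

text \<open>
  The second conjunct says that \<open>xs ! i\<close> is not a zero divisor on the
  quotient of \<^term>\<open>R\<close> by the ideal generated by the preceding entries.
\<close>

definition regular_seq :: "('a, 'm) ring_scheme \<Rightarrow> 'a list \<Rightarrow> bool" where
  "regular_seq R xs \<longleftrightarrow>
     set xs \<subseteq> carrier R \<and>
     (\<forall>i < length xs. \<forall>a \<in> carrier R.
        xs ! i \<otimes> a \<in> Idl (set (take i xs)) \<longrightarrow> a \<in> Idl (set (take i xs))) \<and>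
     Idl (set xs) \<noteq> carrier R"
  for R (structure)

definition depth :: "('a, 'm) ring_scheme \<Rightarrow> 'a set \<Rightarrow> enat" where
  "depth R I = Sup {enat (length xs) | xs. regular_seq R xs \<and> set xs \<subseteq> I}"

definition cohen_macaulay_local :: "('a, 'm) ring_scheme \<Rightarrow> bool" where
  "cohen_macaulay_local R \<longleftrightarrow>
     cring R \<and> noetherian_ring R \<and>
     (\<exists>\<mm>. {I. maximalideal I R} = {\<mm>} \<and> depth R \<mm> = krull_dim R)"

definition cohen_macaulay :: "('a, 'm) ring_scheme \<Rightarrow> bool" where
  "cohen_macaulay R \<longleftrightarrow>
     cring R \<and> noetherian_ring R \<and>
     (\<forall>\<mm>. maximalideal \<mm> R \<longrightarrow> cohen_macaulay_local (localization R \<mm>))"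

text \<open>
  The lattice \<^term>\<open>L\<close> is written multiplicatively. An action by automorphisms is a homomorphism
  into \<^term>\<open>AutoGroup L\<close>, whose elements are extensional on \<^term>\<open>carrier L\<close>.
\<close>

locale G_lattice = G: group G + L: comm_group L
  for G :: "('g, 'n) monoid_scheme" and L :: "('l, 'm) monoid_scheme"
    and \<phi> :: "'g \<Rightarrow> 'l \<Rightarrow> 'l" +
  assumes free_of_finite_rank: "\<exists>n::nat. L \<cong> free_Abelian_group {..<n}"
    and action: "\<phi> \<in> hom G (AutoGroup L)"

text \<open>
  Elements are finitely supported coefficient functions on \<^term>\<open>carrier L\<close>, set to
  \<^const>\<open>undefined\<close> elsewhere; multiplication is convolution.
\<close>

definition group_algebra ::
    "('k, 'r) ring_scheme \<Rightarrow> ('l, 'm) monoid_scheme \<Rightarrow> ('l \<Rightarrow> 'k) ring" where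
  "group_algebra K L =
     \<lparr>carrier = {f \<in> carrier L \<rightarrow>\<^sub>E carrier K. finite {x \<in> carrier L. f x \<noteq> \<zero>\<^bsub>K\<^esub>}},
      monoid.mult = (\<lambda>f h. \<lambda>x\<in>carrier L.
        \<Oplus>\<^bsub>K\<^esub>y \<in> {y \<in> carrier L. f y \<noteq> \<zero>\<^bsub>K\<^esub>}. f y \<otimes>\<^bsub>K\<^esub> h (inv\<^bsub>L\<^esub> y \<otimes>\<^bsub>L\<^esub> x)),
      monoid.one = (\<lambda>x\<in>carrier L. if x = \<one>\<^bsub>L\<^esub> then \<one>\<^bsub>K\<^esub> else \<zero>\<^bsub>K\<^esub>),
      ring.zero = (\<lambda>x\<in>carrier L. \<zero>\<^bsub>K\<^esub>),
      ring.add = (\<lambda>f h. \<lambda>x\<in>carrier L. f x \<oplus>\<^bsub>K\<^esub> h x)\<rparr>"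

text \<open>
  The \<open>K\<close>-linear extension of the action maps the basis element at \<open>x\<close> to the one at \<open>\<phi> g x\<close>,
  so the new coefficient at \<open>x\<close> is the old coefficient at the preimage \<open>\<phi> (inv g) x\<close>.
\<close>

definition group_algebra_act ::
    "('g, 'n) monoid_scheme \<Rightarrow> ('l, 'm) monoid_scheme \<Rightarrow> ('g \<Rightarrow> 'l \<Rightarrow> 'l)
      \<Rightarrow> 'g \<Rightarrow> ('l \<Rightarrow> 'k) \<Rightarrow> 'l \<Rightarrow> 'k" where
  "group_algebra_act G L \<phi> g f = (\<lambda>x\<in>carrier L. f (\<phi> (inv\<^bsub>G\<^esub> g) x))"

definition invariant_algebra ::
    "('k, 'r) ring_scheme \<Rightarrow> ('g, 'n) monoid_scheme \<Rightarrow> ('l, 'm) monoid_scheme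
      \<Rightarrow> ('g \<Rightarrow> 'l \<Rightarrow> 'l) \<Rightarrow> ('l \<Rightarrow> 'k) ring" where
  "invariant_algebra K G L \<phi> = (group_algebra K L)
     \<lparr>carrier := {f \<in> carrier (group_algebra K L).
        \<forall>g \<in> carrier G. group_algebra_act G L \<phi> g f = f}\<rparr>"

text \<open>
  The tensor product of \<^term>\<open>L\<close> with the rationals over the integers is the free abelian group on
  pairs \<open>(x, q)\<close> modulo the relations of additivity in each argument.
\<close>

definition tensor_rels :: "('l, 'm) monoid_scheme \<Rightarrow> (('l \<times> rat) \<Rightarrow>\<^sub>0 int) set" where
  "tensor_rels L = generate (free_Abelian_group (carrier L \<times> (UNIV :: rat set)))
     ({frag_of (x \<otimes>\<^bsub>L\<^esub> y, q) - frag_of (x, q) - frag_of (y, q) | x y q.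
         x \<in> carrier L \<and> y \<in> carrier L} \<union>
      {frag_of (x, q + r) - frag_of (x, q) - frag_of (x, r) | x q r.
         x \<in> carrier L})"

definition rat_tensor :: "('l, 'm) monoid_scheme \<Rightarrow> (('l \<times> rat) \<Rightarrow>\<^sub>0 int) set monoid" where
  "rat_tensor L = free_Abelian_group (carrier L \<times> (UNIV :: rat set)) Mod tensor_rels L"

text \<open>
  A map of pure tensors extends additively to the free abelian group. The image of a coset need
  only be contained in a coset (for instance under scaling by \<open>0\<close>), so \<^const>\<open>tensor_rels\<close> is
  added again.
\<close>

definition tensor_lift ::
    "('l, 'm) monoid_scheme \<Rightarrow> ('l \<times> rat \<Rightarrow> 'l \<times> rat)
      \<Rightarrow> (('l \<times> rat) \<Rightarrow>\<^sub>0 int) set \<Rightarrow> (('l \<times> rat) \<Rightarrow>\<^sub>0 int) set" where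
  "tensor_lift L f A =
     tensor_rels L <#>\<^bsub>free_Abelian_group (carrier L \<times> (UNIV :: rat set))\<^esub>
       (frag_extend (\<lambda>z. frag_of (f z)) ` A)"

definition tensor_scale ::
    "('l, 'm) monoid_scheme \<Rightarrow> rat
      \<Rightarrow> (('l \<times> rat) \<Rightarrow>\<^sub>0 int) set \<Rightarrow> (('l \<times> rat) \<Rightarrow>\<^sub>0 int) set" where
  "tensor_scale L q = tensor_lift L (\<lambda>(x, r). (x, q * r))"

definition tensor_act ::
    "('l, 'm) monoid_scheme \<Rightarrow> ('g \<Rightarrow> 'l \<Rightarrow> 'l) \<Rightarrow> 'g
      \<Rightarrow> (('l \<times> rat) \<Rightarrow>\<^sub>0 int) set \<Rightarrow> (('l \<times> rat) \<Rightarrow>\<^sub>0 int) set" where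
  "tensor_act L \<phi> g = tensor_lift L (\<lambda>(x, r). (\<phi> g x, r))"

text \<open>
  An isomorphism of modules over the rational group algebra of \<^term>\<open>G\<close> is an additive bijection
  commuting with rational scalars and with the elements of \<^term>\<open>G\<close>.
\<close>

definition rationally_isomorphic ::
    "('g, 'n) monoid_scheme \<Rightarrow> ('l, 'm) monoid_scheme \<Rightarrow> ('g \<Rightarrow> 'l \<Rightarrow> 'l)
      \<Rightarrow> ('l2, 'm2) monoid_scheme \<Rightarrow> ('g \<Rightarrow> 'l2 \<Rightarrow> 'l2) \<Rightarrow> bool" where
  "rationally_isomorphic G L \<phi> L' \<phi>' \<longleftrightarrow>
     (\<exists>h \<in> Group.iso (rat_tensor L) (rat_tensor L').
        (\<forall>q. \<forall>A \<in> carrier (rat_tensor L).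
           h (tensor_scale L q A) = tensor_scale L' q (h A)) \<and>
        (\<forall>g \<in> carrier G. \<forall>A \<in> carrier (rat_tensor L).
           h (tensor_act L \<phi> g A) = tensor_act L' \<phi>' g (h A)))"

end

theory Submission
  imports Defs
begin

text \<open>
  A rational isomorphism, cleared of denominators, embeds \<open>L'\<close> equivariantly into \<open>L\<close> with
  torsion cokernel. Restriction of coefficients to \<open>L'\<close> is then a Reynolds operator from
  \<open>B = K[L]^G\<close> to \<open>A = K[L']^G\<close>, and \<open>B\<close> is integral over \<open>A\<close>, so the
  Hochster--Eagon theorem applies.

  For the latter, let \<open>\<rho>\<close> be the Reynolds operator and \<open>n\<close> a maximal ideal of \<open>A\<close>. The elements
  \<open>d\<close> of \<open>B\<close> with \<open>\<rho> (d B) \<subseteq> n\<close> form a proper ideal. If \<open>P\<close> is a maximal ideal of \<open>B\<close> containing it, then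
  for \<open>s \<notin> P\<close> some \<open>\<rho> (s b)\<close> lies outside \<open>n\<close>, whence every ideal of \<open>A\<close> localized at \<open>n\<close> is
  contracted from \<open>B\<close> localized at \<open>P\<close>. Consequently sequences in \<open>n\<close> that are regular on
  the localization of \<open>B\<close> are regular on that of \<open>A\<close>. By prime avoidance, incomparability and Rees' theorem such
  sequences exist up to the depth of the localization of \<open>B\<close>; a maximal one generates an ideal
  primary to the maximal ideal of the localization of \<open>A\<close>, whose dimension is then bounded by Krull's height theorem.
\<close>

subsection \<open>Ideals of noetherian rings\<close>

text \<open>Restriction of coefficients works because \<open>K[L]\<close> is graded by the quotient
  of \<open>L\<close> by the image of \<open>L'\<close>, and restriction is the projection onto the
  component of degree zero; the image is stable under \<open>G\<close>, so invariants go to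
  invariants. Nor is \<open>K\<close> assumed noetherian: all finiteness starts from
  \<open>B\<close> and passes to \<open>A\<close> through the Reynolds operator.

  Several maximal ideals of \<open>B\<close> may lie over \<open>n\<close>, and for a general
  Reynolds operator the localized map need not be pure at each of them. For \<open>A = k[x]\<close>,
  \<open>B\<close> the product of \<open>k[x]\<close> and \<open>k\<close>, and
  \<open>\<rho>\<close> the first projection, it fails at the point of the second factor. The proper
  ideal of the elements \<open>d\<close> singles out the good ones: at a maximal ideal containing
  it, every denominator over \<open>B\<close> can be turned by \<open>\<rho>\<close> into a
  denominator over \<open>A\<close>.

  Quotient rings are never formed. Statements about \<open>R/I\<close> are phrased with ideals of
  \<open>R\<close>, which lets the ideal vary in inductions.\<close>

locale noetherian_cring = cring + noetherian_ring

context cring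
begin

text \<open>The ideal \<open>I + Ra\<close>, which stands for killing \<open>a\<close> in
  \<open>R/I\<close>.\<close>

definition adjoin :: "'a set \<Rightarrow> 'a \<Rightarrow> 'a set" where
  "adjoin I a = {i \<oplus> r \<otimes> a | i r. i \<in> I \<and> r \<in> carrier R}"

lemma mem_adjoin:
  "x \<in> adjoin I a \<longleftrightarrow> (\<exists>i\<in>I. \<exists>r\<in>carrier R. x = i \<oplus> r \<otimes> a)"
  by (auto simp: adjoin_def)

lemma adjoin_ideal:
  assumes "ideal I R" "a \<in> carrier R"
  shows "ideal (adjoin I a) R" "I \<subseteq> adjoin I a" "a \<in> adjoin I a"
proof -
  interpret I: ideal I R by fact
  have "adjoin I a = I <+>\<^bsub>R\<^esub> PIdl a"
    by (auto simp: adjoin_def set_add_def' cgenideal_def)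
  then show "ideal (adjoin I a) R" using assms add_ideals cgenideal_ideal by simp
  show "I \<subseteq> adjoin I a"
  proof
    fix x assume x: "x \<in> I"
    have "x = x \<oplus> \<zero> \<otimes> a" using x assms I.Icarr by simp
    then show "x \<in> adjoin I a" using x mem_adjoin zero_closed by blast
  qed
  have "a = \<zero> \<oplus> \<one> \<otimes> a" using assms by simp
  then show "a \<in> adjoin I a"
    using mem_adjoin I.zero_closed one_closed by blast
qed

lemma Idl_insert:
  assumes "S \<subseteq> carrier R" "a \<in> carrier R"
  shows "Idl (insert a S) = adjoin (Idl S) a"
proof
  have "insert a S \<subseteq> adjoin (Idl S) a"
    using adjoin_ideal[OF genideal_ideal[OF assms(1)] assms(2)] genideal_self[OF assms(1)] by blast
  then show "Idl (insert a S) \<subseteq> adjoin (Idl S) a"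
    by (intro genideal_minimal adjoin_ideal genideal_ideal assms)
  interpret J: ideal "Idl (insert a S)" R
    using assms by (intro genideal_ideal) auto
  have 1: "Idl S \<subseteq> Idl (insert a S)"
    using genideal_self[of "insert a S"] assms by (intro genideal_minimal J.ideal_axioms) auto
  have 2: "a \<in> Idl (insert a S)"
    using genideal_self[of "insert a S"] assms by auto
  show "adjoin (Idl S) a \<subseteq> Idl (insert a S)"
    using 1 2 by (auto simp: mem_adjoin intro!: J.a_closed J.I_l_closed)
qed

lemma ideal_of_closed:
  assumes "I \<subseteq> carrier R" "\<zero> \<in> I" "\<And>x y. x \<in> I \<Longrightarrow> y \<in> I \<Longrightarrow> x \<oplus> y \<in> I"
    and mult: "\<And>r x. r \<in> carrier R \<Longrightarrow> x \<in> I \<Longrightarrow> r \<otimes> x \<in> I"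
  shows "ideal I R"
proof (rule idealI[OF ring_axioms])
  show "subgroup I (add_monoid R)"
  proof (rule add.subgroupI)
    fix x assume x: "x \<in> I"
    then have "\<ominus> x = (\<ominus> \<one>) \<otimes> x" using assms(1) by (auto simp: l_minus)
    then show "\<ominus> x \<in> I" using mult[OF _ x, of "\<ominus> \<one>"] by simp
  qed (use assms in auto)
  show "x \<otimes> a \<in> I" if "a \<in> I" "x \<in> carrier R" for a x using mult that by simp
  show "a \<otimes> x \<in> I" if "a \<in> I" "x \<in> carrier R" for a x
    using mult that assms(1) m_comm[of a x] by auto
qed

text \<open>The annihilator of the class of \<open>a\<close> in \<open>R/I\<close>; the prime ones
  among these are the associated primes of \<open>R/I\<close>.\<close>

definition colon :: "'a set \<Rightarrow> 'a \<Rightarrow> 'a set" where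
  "colon I a = {r \<in> carrier R. r \<otimes> a \<in> I}"

lemma colon_ideal:
  assumes "ideal I R" "a \<in> carrier R"
  shows "ideal (colon I a) R"
proof -
  interpret I: ideal I R by fact
  show ?thesis
  proof (rule ideal_of_closed)
    show "colon I a \<subseteq> carrier R" by (auto simp: colon_def)
    show "\<zero> \<in> colon I a" using assms I.zero_closed by (simp add: colon_def)
    show "x \<oplus> y \<in> colon I a" if "x \<in> colon I a" "y \<in> colon I a" for x y
      using that assms by (simp add: colon_def l_distr I.a_closed)
    show "r \<otimes> x \<in> colon I a" if "r \<in> carrier R" "x \<in> colon I a" for r x
      using that assms by (simp add: colon_def m_assoc I.I_l_closed)
  qed
qed

lemma prime_one_notin: "primeideal P R \<Longrightarrow> \<one> \<notin> P"
  by (metis ideal.one_imp_carrier primeideal.I_notcarr primeideal.axioms(1))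

lemma ideal_sub_carrier: "ideal I R \<Longrightarrow> I \<subseteq> carrier R"
  by (rule subsetI) (rule ideal.Icarr)

lemma prime_ideal: "primeideal P R \<Longrightarrow> ideal P R"
  by (rule primeideal.axioms(1))

lemma prime_mult_notin:
  "\<lbrakk>primeideal P R; a \<in> carrier R; b \<in> carrier R; a \<notin> P; b \<notin> P\<rbrakk> \<Longrightarrow> a \<otimes> b \<notin> P"
  using primeideal.I_prime by metis

lemma prime_pow:
  assumes "primeideal P R" "a \<in> carrier R" "a [^] (n::nat) \<in> P" shows "a \<in> P"
  using assms(3)
proof (induction n)
  case 0 then show ?case using prime_one_notin[OF assms(1)] by simp
next
  case (Suc n) then show ?case
    using primeideal.I_prime[OF assms(1), of "a [^] n" a] assms(2) by auto
qed

lemma maximal_prime: "maximalideal P R \<Longrightarrow> primeideal P R"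
  using maximalideal_prime .

end

context noetherian_cring
begin

lemma maximal_in_ideals:
  assumes "C \<noteq> {}" "\<And>I. I \<in> C \<Longrightarrow> ideal I R"
  obtains M where "M \<in> C" "\<And>I. I \<in> C \<Longrightarrow> M \<subseteq> I \<Longrightarrow> I = M"
proof -
  have "\<exists>M\<in>C. \<forall>J\<in>C. M \<subseteq> J \<longrightarrow> J = M"
  proof (rule subset_Zorn_nonempty[OF assms(1)])
    fix D assume D: "D \<noteq> {}" "subset.chain C D"
    then have "subset.chain {I. ideal I R} D"
      using assms(2) by (auto simp: pred_on.chain_def)
    then show "\<Union>D \<in> C" using ideal_chain_is_trivial[OF D(1)] D
      by (auto simp: pred_on.chain_def)
  qed
  then show ?thesis using that by blast
qed

text \<open>An ideal \<open>Q\<close> maximal among those over \<open>J\<close> that miss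
  \<open>M\<close> is prime: for \<open>a\<close> and \<open>b\<close> outside \<open>Q\<close>,
  both \<open>Q + Ra\<close> and \<open>Q + Rb\<close> meet \<open>M\<close>, and the product of the
  two elements found would lie in \<open>Q\<close> if \<open>a \<otimes> b\<close> did. This
  supplies primes that would otherwise be read off from a ring of fractions.\<close>

lemma prime_disjoint_mult_set:
  assumes J: "ideal J R" and M: "M \<subseteq> carrier R" "\<one> \<in> M"
    and Mm: "\<And>a b. a \<in> M \<Longrightarrow> b \<in> M \<Longrightarrow> a \<otimes> b \<in> M" and dis: "J \<inter> M = {}"
  obtains Q where "primeideal Q R" "J \<subseteq> Q" "Q \<inter> M = {}"
proof -
  obtain Q where Q: "Q \<in> {I. ideal I R \<and> J \<subseteq> I \<and> I \<inter> M = {}}"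
    and max: "\<And>I. I \<in> {I. ideal I R \<and> J \<subseteq> I \<and> I \<inter> M = {}} \<Longrightarrow> Q \<subseteq> I \<Longrightarrow> I = Q"
    by (rule maximal_in_ideals[of "{I. ideal I R \<and> J \<subseteq> I \<and> I \<inter> M = {}}"]) (use J dis in auto)
  interpret Q: ideal Q R using Q by simp
  have hit: "\<exists>i\<in>Q. \<exists>r\<in>carrier R. i \<oplus> r \<otimes> a \<in> M" if a: "a \<in> carrier R" "a \<notin> Q" for a
  proof (rule ccontr)
    assume "\<not> ?thesis"
    then have "(adjoin Q a) \<inter> M = {}" by (auto simp: mem_adjoin)
    then have "adjoin Q a = Q"
      using adjoin_ideal[OF Q.ideal_axioms a(1)] Q by (intro max) auto
    then show False using adjoin_ideal[OF Q.ideal_axioms a(1)] a by auto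
  qed
  have "primeideal Q R"
  proof (rule primeidealI[OF Q.ideal_axioms is_cring])
    show "carrier R \<noteq> Q" using M Q by auto
    fix a b assume ab: "a \<in> carrier R" "b \<in> carrier R" "a \<otimes> b \<in> Q"
    show "a \<in> Q \<or> b \<in> Q"
    proof (rule ccontr)
      assume "\<not> ?thesis"
      then have "a \<notin> Q" "b \<notin> Q" by auto
      then obtain i r j t where h: "i \<in> Q" "r \<in> carrier R" "i \<oplus> r \<otimes> a \<in> M"
        "j \<in> Q" "t \<in> carrier R" "j \<oplus> t \<otimes> b \<in> M" using hit[of a] hit[of b] ab by blast
      have c: "i \<in> carrier R" "j \<in> carrier R" using h Q.Icarr by auto
      have "(i \<oplus> r \<otimes> a) \<otimes> (j \<oplus> t \<otimes> b) =
          i \<otimes> (j \<oplus> t \<otimes> b) \<oplus> ((r \<otimes> a) \<otimes> j \<oplus> (r \<otimes> t) \<otimes> (a \<otimes> b))"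
        using h(2,5) ab c by algebra
      also have "\<dots> \<in> Q"
        using h ab c by (intro Q.a_closed Q.I_r_closed[OF h(1)] Q.I_l_closed[OF h(4)] Q.I_l_closed[OF ab(3)]) auto
      finally show False using Mm[OF h(3,6)] Q by auto
    qed
  qed
  then show ?thesis using that Q by auto
qed

lemma maximal_containing:
  assumes J: "ideal J R" "\<one> \<notin> J"
  obtains Q where "maximalideal Q R" "J \<subseteq> Q"
proof -
  obtain Q where Q: "Q \<in> {I. ideal I R \<and> J \<subseteq> I \<and> \<one> \<notin> I}"
    and max: "\<And>I. I \<in> {I. ideal I R \<and> J \<subseteq> I \<and> \<one> \<notin> I} \<Longrightarrow> Q \<subseteq> I \<Longrightarrow> I = Q"
    by (rule maximal_in_ideals[of "{I. ideal I R \<and> J \<subseteq> I \<and> \<one> \<notin> I}"]) (use J in auto)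
  have "maximalideal Q R"
  proof (rule maximalidealI)
    fix K assume K: "ideal K R" "Q \<subseteq> K" "K \<subseteq> carrier R"
    show "K = Q \<or> K = carrier R"
    proof (cases "\<one> \<in> K")
      case True then show ?thesis using K ideal.one_imp_carrier by blast
    next
      case False then show ?thesis using K Q max[of K] by auto
    qed
  qed (use Q in auto)
  then show ?thesis using that Q by auto
qed

text \<open>If \<open>c\<close> does not kill \<open>a\<close> modulo \<open>I\<close>, then
  \<open>c \<otimes> a\<close> has at least the annihilator of \<open>a\<close>, hence by maximality
  the same one; so any \<open>b\<close> that kills \<open>c \<otimes> a\<close> kills
  \<open>a\<close>.\<close>

lemma colon_maximal_prime:
  assumes I: "ideal I R" and a: "a \<in> carrier R" "a \<notin> I"
    and max: "\<And>b. b \<in> carrier R \<Longrightarrow> b \<notin> I \<Longrightarrow> colon I a \<subseteq> colon I b \<Longrightarrow> colon I b = colon I a"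
  shows "primeideal (colon I a) R"
proof (rule primeidealI[OF colon_ideal[OF I a(1)] is_cring])
  interpret I: ideal I R by fact
  show "carrier R \<noteq> colon I a"
    using a one_closed by (metis (no_types, lifting) colon_def l_one mem_Collect_eq)
  fix b c assume bc: "b \<in> carrier R" "c \<in> carrier R" "b \<otimes> c \<in> colon I a"
  show "b \<in> colon I a \<or> c \<in> colon I a"
  proof (rule disjCI)
    assume c: "c \<notin> colon I a"
    have "colon I (c \<otimes> a) = colon I a"
    proof (rule max)
      show "c \<otimes> a \<notin> I" using c bc by (auto simp: colon_def)
      show "colon I a \<subseteq> colon I (c \<otimes> a)"
        using bc a by (auto simp: colon_def) (metis I.I_l_closed m_lcomm)
    qed (use a bc in auto)
    moreover have "b \<in> colon I (c \<otimes> a)"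
      using bc a by (auto simp: colon_def m_assoc)
    ultimately show "b \<in> colon I a" by simp
  qed
qed

text \<open>Maximality is recorded along with primality, because in
  \<open>finite_zerodivisor_primes\<close> it turns an inclusion between two such annihilators into
  an equality.\<close>

lemma assoc_prime_exists:
  assumes I: "ideal I R" and a: "a \<in> carrier R" "a \<notin> I"
  obtains b where "b \<in> carrier R" "b \<notin> I" "colon I a \<subseteq> colon I b" "primeideal (colon I b) R"
    "\<And>c. c \<in> carrier R \<Longrightarrow> c \<notin> I \<Longrightarrow> colon I b \<subseteq> colon I c \<Longrightarrow> colon I c = colon I b"
proof -
  let ?C = "{colon I b | b. b \<in> carrier R \<and> b \<notin> I \<and> colon I a \<subseteq> colon I b}"
  obtain M where M: "M \<in> ?C" and max: "\<And>J. J \<in> ?C \<Longrightarrow> M \<subseteq> J \<Longrightarrow> J = M"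
    by (rule maximal_in_ideals[of ?C]) (use a colon_ideal[OF I] in auto)
  from M obtain b where b: "b \<in> carrier R" "b \<notin> I" "colon I a \<subseteq> colon I b" "M = colon I b" by auto
  have mx: "colon I c = colon I b" if "c \<in> carrier R" "c \<notin> I" "colon I b \<subseteq> colon I c" for c
    using max[of "colon I c"] that b by auto
  show ?thesis using that[OF b(1-3) colon_maximal_prime[OF I b(1,2) mx] mx] by blast
qed

end

subsection \<open>Krull's height theorem\<close>

context cring
begin

section \<open>Saturated ideals, the contractions of ideals of a localization\<close>

definition saturated :: "'a set \<Rightarrow> 'a set \<Rightarrow> bool" where
  "saturated P I \<longleftrightarrow> ideal I R \<and> (\<forall>s\<in>carrier R - P. \<forall>a\<in>carrier R. s \<otimes> a \<in> I \<longrightarrow> a \<in> I)"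

definition saturation :: "'a set \<Rightarrow> 'a set \<Rightarrow> 'a set" where
  "saturation P I = {a \<in> carrier R. \<exists>s\<in>carrier R - P. s \<otimes> a \<in> I}"

lemma saturatedD:
  "\<lbrakk>saturated P I; s \<in> carrier R; s \<notin> P; a \<in> carrier R; s \<otimes> a \<in> I\<rbrakk> \<Longrightarrow> a \<in> I"
  by (auto simp: saturated_def)

lemma saturated_ideal: "saturated P I \<Longrightarrow> ideal I R"
  by (simp add: saturated_def)

text \<open>Localization at \<open>Q\<close> factors through localization at \<open>P\<close>. In
  the principal ideal theorem this lets ideals saturated at the smaller prime be compared at the
  larger one.\<close>

lemma saturated_antimono: "saturated Q I \<Longrightarrow> Q \<subseteq> P \<Longrightarrow> saturated P I"
  unfolding saturated_def by blast

lemma saturation_saturated: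
  assumes P: "primeideal P R" and I: "ideal I R"
  shows "saturated P (saturation P I)"
proof -
  interpret I: ideal I R by fact
  have "ideal (saturation P I) R"
  proof (rule ideal_of_closed)
    show "\<zero> \<in> saturation P I"
      using prime_one_notin[OF P] I.zero_closed by (auto simp: saturation_def intro!: bexI[of _ \<one>])
    fix x y assume "x \<in> saturation P I" "y \<in> saturation P I"
    then obtain s t where h: "x \<in> carrier R" "y \<in> carrier R" "s \<in> carrier R" "s \<notin> P"
      "t \<in> carrier R" "t \<notin> P" "s \<otimes> x \<in> I" "t \<otimes> y \<in> I" by (auto simp: saturation_def)
    have "(s \<otimes> t) \<otimes> (x \<oplus> y) = t \<otimes> (s \<otimes> x) \<oplus> s \<otimes> (t \<otimes> y)"
      using h(1,2,3,5) by algebra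
    also have "\<dots> \<in> I" using h(3,5) by (intro I.a_closed I.I_l_closed[OF h(7)] I.I_l_closed[OF h(8)]) auto
    finally show "x \<oplus> y \<in> saturation P I"
      using prime_mult_notin[OF P h(3,5,4,6)] h by (auto simp: saturation_def intro!: bexI[of _ "s \<otimes> t"])
  next
    fix r x assume "r \<in> carrier R" "x \<in> saturation P I"
    then obtain s where s: "r \<in> carrier R" "x \<in> carrier R" "s \<in> carrier R" "s \<notin> P" "s \<otimes> x \<in> I"
      by (auto simp: saturation_def)
    then have "s \<otimes> (r \<otimes> x) \<in> I" using I.I_l_closed[of "s \<otimes> x" r] by (simp add: m_lcomm[of s r])
    then show "r \<otimes> x \<in> saturation P I" using s by (auto simp: saturation_def)
  qed (auto simp: saturation_def)
  moreover have "a \<in> saturation P I"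
    if sa: "s \<in> carrier R - P" "a \<in> carrier R" "s \<otimes> a \<in> saturation P I" for s a
  proof -
    obtain t where "t \<in> carrier R" "t \<notin> P" "t \<otimes> (s \<otimes> a) \<in> I"
      using sa(3) unfolding saturation_def by blast
    then show ?thesis using sa(1,2) prime_mult_notin[OF P, of t s]
      by (auto simp: saturation_def m_assoc intro!: bexI[of _ "t \<otimes> s"])
  qed
  ultimately show ?thesis by (auto simp: saturated_def)
qed

lemma subset_saturation:
  assumes "primeideal P R" "ideal I R" shows "I \<subseteq> saturation P I"
  using prime_one_notin[OF assms(1)] ideal_sub_carrier[OF assms(2)]
  by (auto simp: saturation_def intro!: bexI[of _ \<one>])

lemma saturation_least: "saturated P J \<Longrightarrow> I \<subseteq> J \<Longrightarrow> saturation P I \<subseteq> J"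
  by (auto simp: saturation_def intro: saturatedD)

lemma saturation_mono: "I \<subseteq> J \<Longrightarrow> saturation P I \<subseteq> saturation P J"
  by (auto simp: saturation_def)

lemma adjoin_mono: "I \<subseteq> J \<Longrightarrow> adjoin I a \<subseteq> adjoin J a"
  unfolding mem_adjoin subset_iff by blast

lemma adjoin_least:
  assumes "ideal J R" "I \<subseteq> J" "a \<in> J" shows "adjoin I a \<subseteq> J"
proof
  interpret J: ideal J R by fact
  fix z assume "z \<in> adjoin I a"
  then obtain i r where "i \<in> I" "r \<in> carrier R" "z = i \<oplus> r \<otimes> a" by (auto simp: mem_adjoin)
  then show "z \<in> J" using assms by (auto intro!: J.a_closed J.I_l_closed)
qed

text \<open>Chains are peeled from the top, since the principal ideal theorem exchanges the prime
  just below the top and leaves the rest alone. The index counts strict inclusions, so a single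
  prime is a chain of length 0.\<close>

primrec prime_chain :: "nat \<Rightarrow> 'a set \<Rightarrow> 'a set \<Rightarrow> bool" where
  "prime_chain 0 p q \<longleftrightarrow> primeideal p R \<and> q = p"
| "prime_chain (Suc n) p q \<longleftrightarrow> primeideal q R \<and> (\<exists>q'. prime_chain n p q' \<and> q' \<subset> q)"

lemma prime_chain_prime: "prime_chain n p q \<Longrightarrow> primeideal q R"
  by (cases n) auto

lemma prime_chain_subset: "prime_chain n p q \<Longrightarrow> p \<subseteq> q"
  by (induction n arbitrary: q) auto

lemma prime_chain_enum:
  "prime_chain n p q \<Longrightarrow> \<exists>f. (\<forall>i\<le>n. primeideal (f i) R) \<and> (\<forall>i<n. f i \<subset> f (Suc i)) \<and> f n = q"
proof (induction n arbitrary: q)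
  case 0 then show ?case by (auto intro!: exI[of _ "\<lambda>_. p"])
next
  case (Suc n)
  then obtain q' f where "primeideal q R" "q' \<subset> q" "\<forall>i\<le>n. primeideal (f i) R"
    "\<forall>i<n. f i \<subset> f (Suc i)" "f n = q'" by (metis prime_chain.simps(2))
  then show ?case
    by (intro exI[of _ "f(Suc n := q)"]) (auto simp: less_Suc_eq le_Suc_eq)
qed

lemma enum_prime_chain:
  "(\<And>i. i \<le> n \<Longrightarrow> primeideal (f i) R) \<Longrightarrow> (\<And>i. i < n \<Longrightarrow> f i \<subset> f (Suc i)) \<Longrightarrow> prime_chain n (f 0) (f n)"
proof (induction n)
  case (Suc n)
  then have "prime_chain n (f 0) (f n)" by simp
  moreover have "primeideal (f (Suc n)) R" "f n \<subset> f (Suc n)" using Suc.prems by blast+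
  ultimately show ?case unfolding prime_chain.simps by blast
qed auto

lemma krull_dim_ge: "prime_chain n p q \<Longrightarrow> enat n \<le> krull_dim R"
  unfolding krull_dim_def by (rule Sup_upper) (use prime_chain_enum in blast)

lemma krull_dim_le:
  assumes "\<And>n p q. prime_chain n p q \<Longrightarrow> enat n \<le> d"
  shows "krull_dim R \<le> d"
  unfolding krull_dim_def using assms enum_prime_chain by (intro Sup_least) blast

end

context noetherian_cring
begin

text \<open>As \<open>P\<close> is minimal over \<open>Y\<close>, the localization at
  \<open>P\<close> modulo \<open>Y\<close> is artinian; this is its descending chain condition, by
  noetherian induction on the ideal below the chain. A maximal counterexample \<open>I\<close> has
  an associated prime between \<open>Y\<close> and \<open>P\<close>, hence equal to
  \<open>P\<close>, so \<open>colon I b = P\<close> for some \<open>b\<close> outside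
  \<open>I\<close>. Chains above \<open>I + Rb\<close> stabilize, and a chain that eventually omits
  \<open>b\<close> is controlled by the ideals \<open>J n + Rb\<close>.\<close>

lemma saturated_dcc:
  assumes P: "primeideal P R"
    and min: "\<And>p. primeideal p R \<Longrightarrow> Y \<subseteq> p \<Longrightarrow> p \<subseteq> P \<Longrightarrow> p = P"
    and J: "\<And>n. saturated P (J n)" "\<And>n. Y \<subseteq> J n" "\<And>n. J (Suc n) \<subseteq> J n" and Y: "ideal Y R"
  shows "\<exists>N. \<forall>n\<ge>N. J n = (J N :: 'a set)"
proof -
  define good where "good I \<longleftrightarrow> (\<forall>J. (\<forall>n. saturated P (J n) \<and> I \<subseteq> J n \<and> J (Suc n) \<subseteq> J n)
     \<longrightarrow> (\<exists>N. \<forall>n\<ge>N. J n = J N))" for I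
  have "good (saturation P Y)"
  proof (rule ccontr)
    assume bad: "\<not> good (saturation P Y)"
    let ?C = "{I. saturated P I \<and> Y \<subseteq> I \<and> \<not> good I}"
    obtain I where I: "I \<in> ?C" and max: "\<And>I'. I' \<in> ?C \<Longrightarrow> I \<subseteq> I' \<Longrightarrow> I' = I"
      by (rule maximal_in_ideals[of ?C])
        (use bad saturation_saturated[OF P Y] subset_saturation[OF P Y] saturated_ideal in auto)
    then have satI: "saturated P I" and YI: "Y \<subseteq> I" and "\<not> good I" by auto
    then obtain J where J: "\<And>n. saturated P (J n)" "\<And>n. I \<subseteq> J n" "\<And>n. J (Suc n) \<subseteq> J n"
      and nst: "\<And>N. \<exists>n\<ge>N. J n \<noteq> J N" unfolding good_def by blast
    interpret I: ideal I R by (rule saturated_ideal[OF satI])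
    note Jid = saturated_ideal[OF J(1)]
    have "\<one> \<notin> I"
    proof
      assume "\<one> \<in> I"
      then have "J n = carrier R" for n using J(2)[of n] ideal.one_imp_carrier[OF Jid] by blast
      then show False using nst by auto
    qed
    then obtain b where b: "b \<in> carrier R" "b \<notin> I" "colon I \<one> \<subseteq> colon I b" "primeideal (colon I b) R"
      using assoc_prime_exists[OF I.ideal_axioms one_closed] by metis
    have "I \<subseteq> colon I b" using b(1) by (auto simp: colon_def intro: I.I_r_closed)
    moreover have "colon I b \<subseteq> P"
      using saturatedD[OF satI] b(1,2) by (auto simp: colon_def)
    ultimately have colP: "colon I b = P" using min[OF b(4)] YI by auto
    let ?I' = "saturation P (adjoin I b)"
    have I'sat: "saturated P ?I'" by (intro saturation_saturated P adjoin_ideal I.ideal_axioms b)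
    have I': "I \<subseteq> ?I'" "b \<in> ?I'"
      using subset_saturation[OF P adjoin_ideal(1)[OF I.ideal_axioms b(1)]] adjoin_ideal(2,3)[OF I.ideal_axioms b(1)]
      by auto
    have goodI': "good ?I'"
    proof (rule ccontr)
      assume "\<not> good ?I'"
      then have "?I' \<in> ?C" using I'(1) I'sat YI by simp
      then show False using max[OF _ I'(1)] I'(2) b(2) by simp
    qed
    show False
    proof (cases "\<forall>n. b \<in> J n")
      case True
      then have "?I' \<subseteq> J n" for n
        by (intro saturation_least J adjoin_least Jid) auto
      then have "\<exists>N. \<forall>n\<ge>N. J n = J N"
        using goodI'[unfolded good_def, rule_format, of J] J by simp
      then show False using nst by metis
    next
      case False
      then obtain n1 where n1: "b \<notin> J n1" by auto
      have anti: "m \<le> n \<Longrightarrow> J n \<subseteq> J m" for m n by (rule lift_Suc_antimono_le[of J]) (use J in auto)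
      define K where "K n = saturation P (adjoin (J n) b)" for n
      have "\<exists>N. \<forall>n\<ge>N. K n = K N"
      proof -
        have "saturated P (K n) \<and> ?I' \<subseteq> K n \<and> K (Suc n) \<subseteq> K n" for n
          unfolding K_def
          using saturation_saturated[OF P adjoin_ideal(1)[OF Jid b(1)]]
          by (intro conjI saturation_mono adjoin_mono J)
        then show ?thesis using goodI'[unfolded good_def, rule_format, of K] by simp
      qed
      then obtain N where N: "\<And>n. n \<ge> N \<Longrightarrow> K n = K N" by auto
      \<comment> \<open>Up to a denominator, \<open>z\<close> in \<open>J n\<close> is a multiple of
        \<open>b\<close> modulo \<open>J (Suc n)\<close>. A multiplier \<open>r\<close> outside
        \<open>P\<close> would put \<open>b\<close> into \<open>J n\<close>; so \<open>r\<close>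
        lies in \<open>P\<close> and kills \<open>b\<close> modulo \<open>I\<close>.\<close>
      have step: "J n = J (Suc n)" if n: "n \<ge> N" "n \<ge> n1" for n
      proof
        show "J (Suc n) \<subseteq> J n" using J by auto
        interpret Jn: ideal "J n" R by (rule Jid)
        interpret Js: ideal "J (Suc n)" R by (rule Jid)
        show "J n \<subseteq> J (Suc n)"
        proof
          fix z assume z: "z \<in> J n"
          then have zc: "z \<in> carrier R" by (rule Jn.Icarr)
          have "z \<in> K n" unfolding K_def using z
            subset_saturation[OF P adjoin_ideal(1)[OF Jid b(1)]] adjoin_ideal(2)[OF Jid b(1)] by blast
          also have "K n = K (Suc n)" using N[of n] N[of "Suc n"] n by simp
          finally obtain s w r where h: "s \<in> carrier R" "s \<notin> P" "w \<in> J (Suc n)" "r \<in> carrier R"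
            "s \<otimes> z = w \<oplus> r \<otimes> b" by (auto simp: K_def saturation_def mem_adjoin)
          have wc: "w \<in> carrier R" using h by auto
          have "r \<otimes> b = s \<otimes> z \<oplus> (\<ominus> \<one>) \<otimes> w" using h(1,4,5) wc zc b(1) by algebra
          also have "\<dots> \<in> J n" using z h J(3)[of n] by (intro Jn.a_closed Jn.I_l_closed) auto
          finally have rb: "r \<otimes> b \<in> J n" .
          have "b \<notin> J n" using n1 anti n by auto
          then have "r \<in> P" using saturatedD[OF J(1) h(4) _ b(1) rb] by auto
          then have "r \<otimes> b \<in> J (Suc n)" using colP J(2)[of "Suc n"] by (auto simp: colon_def)
          then have "s \<otimes> z \<in> J (Suc n)" using h by (auto intro: Js.a_closed)
          then show "z \<in> J (Suc n)" using saturatedD[OF J(1) h(1,2) zc] by auto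
        qed
      qed
      have "J n = J (max N n1)" if "n \<ge> max N n1" for n
        using that
      proof (induction n rule: dec_induct)
        case (step m) then show ?case using \<open>\<And>n. \<lbrakk>N \<le> n; n1 \<le> n\<rbrakk> \<Longrightarrow> J n = J (Suc n)\<close>[of m] by simp
      qed simp
      then show False using nst[of "max N n1"] by blast
    qed
  qed
  moreover have "\<forall>n. saturated P (J n) \<and> saturation P Y \<subseteq> J n \<and> J (Suc n) \<subseteq> J n"
    using J saturation_least by auto
  ultimately show ?thesis unfolding good_def by simp
qed

text \<open>
  Saturation replaces localization. The ideals \<open>I n\<close> below play the role of the symbolic powers of
  \<open>Q\<close>; Nakayama's lemma is replaced by a maximal saturated ideal properly contained in \<open>I N\<close>.
\<close>

lemma principal_ideal_theorem:
  assumes p0: "primeideal p0 R" and Q: "primeideal Q R" and P: "primeideal P R"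
    and sub: "p0 \<subset> Q" "Q \<subset> P" and x: "x \<in> P"
  obtains p where "primeideal p R" "p0 \<subseteq> p" "x \<in> p" "p \<subset> P"
proof (rule ccontr)
  assume "\<not> thesis"
  with that have none: "\<And>p. primeideal p R \<Longrightarrow> p0 \<subseteq> p \<Longrightarrow> x \<in> p \<Longrightarrow> p \<subseteq> P \<Longrightarrow> p = P" by blast
  then have xQ: "x \<notin> Q" using Q sub by blast
  interpret P0: ideal p0 R using p0 by (rule prime_ideal)
  interpret Qi: ideal Q R using Q by (rule prime_ideal)
  interpret Pi: ideal P R using P by (rule prime_ideal)
  have xc: "x \<in> carrier R" using x by auto
  obtain y where y: "y \<in> Q" "y \<notin> p0" using sub by auto
  then have yc: "y \<in> carrier R" by auto
  \<comment> \<open>Powers of a single \<open>y\<close> in \<open>Q\<close> outside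
    \<open>p0\<close> replace the powers of \<open>Q\<close>. All these ideals contain
    \<open>p0\<close>, so the argument takes place over the domain \<open>R/p0\<close>.\<close>
  define I where "I n = saturation Q (adjoin p0 (y [^] n))" for n :: nat
  have Ig: "ideal (adjoin p0 (y [^] n)) R" for n :: nat using yc by (intro adjoin_ideal P0.ideal_axioms) auto
  have IQ: "saturated Q (I n)" for n unfolding I_def by (intro saturation_saturated Q Ig)
  then have IP: "saturated P (I n)" for n using saturated_antimono[OF IQ] sub by simp
  note Iid = saturated_ideal[OF IQ]
  have yI: "y [^] n \<in> I n" "p0 \<subseteq> I n" for n
    unfolding I_def using subset_saturation[OF Q Ig] adjoin_ideal(2,3)[OF P0.ideal_axioms] yc by blast+
  have Idec: "I (Suc n) \<subseteq> I n" for n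
  proof -
    interpret In: ideal "I n" R by (rule Iid)
    have "y [^] Suc n \<in> I n" using yI[of n] yc by (auto intro: In.I_r_closed)
    then show ?thesis unfolding I_def[of "Suc n"]
      by (intro saturation_least IQ adjoin_least Iid yI)
  qed
  \<comment> \<open>Every \<open>K n\<close> contains \<open>p0\<close> and \<open>x\<close>, and
    under the assumption to be refuted \<open>P\<close> is minimal over these. This is what brings
    the descending chain condition to bear.\<close>
  define K where "K n = saturation P (adjoin (I n) x)" for n
  have "\<exists>N. \<forall>n\<ge>N. K n = K N"
  proof (rule saturated_dcc[OF P])
    show "ideal (adjoin p0 x) R" by (intro adjoin_ideal P0.ideal_axioms xc)
    show "p = P" if "primeideal p R" "adjoin p0 x \<subseteq> p" "p \<subseteq> P" for p
      using none that adjoin_ideal[OF P0.ideal_axioms xc] by blast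
    show "saturated P (K n)" for n
      unfolding K_def by (intro saturation_saturated P adjoin_ideal Iid xc)
    show "adjoin p0 x \<subseteq> K n" for n
      unfolding K_def using subset_saturation[OF P adjoin_ideal(1)[OF Iid xc]] adjoin_mono[OF yI(2)] by blast
    show "K (Suc n) \<subseteq> K n" for n
      unfolding K_def by (intro saturation_mono adjoin_mono Idec)
  qed
  then obtain N where N: "K (Suc N) = K N" by (metis le_Suc_eq le_refl)
  interpret IN: ideal "I N" R by (rule Iid)
  have "I N \<subseteq> I (Suc N)"
  proof (rule ccontr)
    assume neq: "\<not> I N \<subseteq> I (Suc N)"
    let ?C = "{V. saturated P V \<and> I (Suc N) \<subseteq> V \<and> V \<subset> I N}"
    obtain V where V: "V \<in> ?C" and max: "\<And>V'. V' \<in> ?C \<Longrightarrow> V \<subseteq> V' \<Longrightarrow> V' = V"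
    proof (rule maximal_in_ideals[of ?C])
      have "I (Suc N) \<in> ?C" using neq Idec[of N] IP by auto
      then show "?C \<noteq> {}" by blast
    qed (use saturated_ideal in auto)
    then have satV: "saturated P V" by auto
    interpret V: ideal V R by (rule saturated_ideal[OF satV])
    obtain c where c: "c \<in> I N" "c \<notin> V" using V by auto
    then have cc: "c \<in> carrier R" by auto
    let ?U = "saturation P (adjoin V c)"
    have Usat: "saturated P ?U" by (intro saturation_saturated P adjoin_ideal V.ideal_axioms cc)
    have VU: "V \<subseteq> ?U" "c \<in> ?U"
      using subset_saturation[OF P adjoin_ideal(1)[OF V.ideal_axioms cc]] adjoin_ideal(2,3)[OF V.ideal_axioms cc] by auto
    have "?U \<subseteq> I N" using V c by (intro saturation_least IP adjoin_least Iid) auto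
    then have UI: "?U = I N" using max[of ?U] Usat VU V c by blast
    have "c \<in> K N" unfolding K_def
      using subset_saturation[OF P adjoin_ideal(1)[OF Iid xc]] adjoin_ideal(2)[OF Iid xc] c by blast
    then have "c \<in> K (Suc N)" using N by simp
    then obtain s w r where h: "s \<in> carrier R" "s \<notin> P" "w \<in> I (Suc N)" "r \<in> carrier R"
      "s \<otimes> c = w \<oplus> r \<otimes> x" by (auto simp: K_def saturation_def mem_adjoin)
    have wc: "w \<in> carrier R" using h(3) Idec[of N] by auto
    \<comment> \<open>As \<open>x\<close> lies outside \<open>Q\<close> and \<open>I N\<close> is
      saturated at \<open>Q\<close>, the factor \<open>x\<close> can be cancelled and
      \<open>r\<close> lies in \<open>I N\<close>. Up to denominators, \<open>c\<close> is thus in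
      \<open>I (Suc N) + x I N\<close>.\<close>
    have "x \<otimes> r = s \<otimes> c \<oplus> (\<ominus> \<one>) \<otimes> w" using h(1,4,5) wc cc xc by algebra
    also have "\<dots> \<in> I N" using c h Idec[of N] by (intro IN.a_closed IN.I_l_closed) auto
    finally have "r \<in> I N" using saturatedD[OF IQ xc xQ h(4)] by auto
    then have "r \<in> ?U" using UI by simp
    then obtain t v d where t: "t \<in> carrier R" "t \<notin> P" "v \<in> V" "d \<in> carrier R" "t \<otimes> r = v \<oplus> d \<otimes> c"
      by (auto simp: saturation_def mem_adjoin)
    have vc: "v \<in> carrier R" using t by auto
    have "(t \<otimes> s \<ominus> d \<otimes> x) \<otimes> c = t \<otimes> (s \<otimes> c) \<ominus> d \<otimes> x \<otimes> c" using t h(1) xc cc by algebra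
    also have "\<dots> = t \<otimes> w \<oplus> (t \<otimes> r) \<otimes> x \<ominus> d \<otimes> x \<otimes> c"
      unfolding h(5) using t(1,4) h(4) wc cc xc by algebra
    also have "\<dots> = t \<otimes> w \<oplus> x \<otimes> v"
      unfolding t(5) using t(1,4) vc h(4) wc cc xc by algebra
    also have "\<dots> \<in> V" using t h V xc by (intro V.a_closed V.I_l_closed) auto
    finally have *: "(t \<otimes> s \<ominus> d \<otimes> x) \<otimes> c \<in> V" .
    \<comment> \<open>The unit of Nakayama's lemma: a denominator minus a multiple of
      \<open>x\<close>, with \<open>x\<close> in \<open>P\<close>.\<close>
    have "t \<otimes> s \<ominus> d \<otimes> x \<notin> P"
    proof
      assume "t \<otimes> s \<ominus> d \<otimes> x \<in> P"
      moreover have "d \<otimes> x \<in> P" using x t by (auto intro: Pi.I_l_closed)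
      ultimately have "(t \<otimes> s \<ominus> d \<otimes> x) \<oplus> d \<otimes> x \<in> P" by (rule Pi.a_closed)
      moreover have "(t \<otimes> s \<ominus> d \<otimes> x) \<oplus> d \<otimes> x = t \<otimes> s" using t(1,4) h(1) xc by algebra
      ultimately show False using prime_mult_notin[OF P, of t s] t h by auto
    qed
    then show False using saturatedD[OF satV _ _ cc *] t h xc c by auto
  qed
  \<comment> \<open>Modulo \<open>p0\<close> and up to a denominator outside \<open>Q\<close>, the
    power \<open>y [^] N\<close> is a multiple of \<open>y [^] Suc N\<close>. Since \<open>y\<close>
    is in \<open>Q\<close>, the element \<open>s \<ominus> r \<otimes> y\<close> is again such a
    denominator, and it multiplies \<open>y [^] N\<close> into \<open>p0\<close>.\<close>
  then have "y [^] N \<in> saturation Q (adjoin p0 (y [^] Suc N))" using yI unfolding I_def by blast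
  then obtain s where s: "s \<in> carrier R" "s \<notin> Q" "s \<otimes> y [^] N \<in> adjoin p0 (y [^] Suc N)"
    unfolding saturation_def by blast
  from s(3) obtain z r where "z \<in> p0" "r \<in> carrier R" "s \<otimes> y [^] N = z \<oplus> r \<otimes> y [^] Suc N"
    unfolding mem_adjoin by blast
  note h = s(1,2) this
  have zc: "z \<in> carrier R" "y [^] N \<in> carrier R" using h yc by auto
  have "(s \<ominus> r \<otimes> y) \<otimes> y [^] N = s \<otimes> y [^] N \<ominus> r \<otimes> y [^] Suc N"
    using h(1,4) yc zc by (simp, algebra)
  also have "\<dots> = z" unfolding h(5) using h(4) zc yc by (simp, algebra)
  finally have "(s \<ominus> r \<otimes> y) \<otimes> y [^] N \<in> p0" using h by simp
  moreover have "s \<ominus> r \<otimes> y \<notin> Q"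
  proof
    assume "s \<ominus> r \<otimes> y \<in> Q"
    moreover have "r \<otimes> y \<in> Q" using y h by (auto intro: Qi.I_l_closed)
    ultimately have "(s \<ominus> r \<otimes> y) \<oplus> r \<otimes> y \<in> Q" by (rule Qi.a_closed)
    moreover have "(s \<ominus> r \<otimes> y) \<oplus> r \<otimes> y = s" using h(1,4) yc by algebra
    ultimately show False using h by auto
  qed
  ultimately have "y [^] N \<in> p0"
    using primeideal.I_prime[OF p0, of "s \<ominus> r \<otimes> y" "y [^] N"] h yc sub by auto
  then show False using prime_pow[OF p0 yc] y by auto
qed

text \<open>One step of the chain is spent on \<open>x\<close>. If \<open>x\<close> is missing from
  the prime below the top, that prime is exchanged, by the principal ideal theorem, for one that
  contains \<open>x\<close> and still lies strictly above the third prime; the claim then follows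
  from the shorter chain ending there.\<close>

lemma prime_chain_shift:
  "\<lbrakk>prime_chain (Suc n) p q; x \<in> q\<rbrakk> \<Longrightarrow> \<exists>p'. prime_chain n p' q \<and> p \<subseteq> p' \<and> x \<in> p'"
proof (induction n arbitrary: q)
  case 0 then show ?case by auto
next
  case (Suc n)
  then obtain q' where q': "primeideal q R" "prime_chain (Suc n) p q'" "q' \<subset> q"
    by (metis prime_chain.simps(2))
  then obtain q'' where q'': "primeideal q' R" "prime_chain n p q''" "q'' \<subset> q'"
    by (metis prime_chain.simps(2))
  obtain t where t: "prime_chain (Suc n) p t" "t \<subset> q" "x \<in> t"
  proof (cases "x \<in> q'")
    case True then show ?thesis using that q' by blast
  next
    case False
    obtain t where "primeideal t R" "q'' \<subseteq> t" "x \<in> t" "t \<subset> q"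
      using principal_ideal_theorem[OF prime_chain_prime[OF q''(2)] q''(1) q'(1) q''(3) q'(3) Suc.prems(2)] .
    moreover from this have "q'' \<subset> t" using False q'' by auto
    ultimately show ?thesis using q'' that[of t] by auto
  qed
  then show ?case using Suc.IH[OF t(1,3)] q'(1) by auto
qed

text \<open>\<open>S\<close> collects the generators already treated. Each generator costs one step
  and moves the lower end of the chain to a prime containing it, so \<open>S \<subseteq> p\<close>
  is preserved; when none is left, minimality of \<open>q\<close> over \<open>S\<close> leaves no
  room for a step.\<close>

theorem height_le_generators:
  assumes "prime_chain n p q" "S \<subseteq> p" "set xs \<subseteq> q"
    and "\<And>r. primeideal r R \<Longrightarrow> S \<union> set xs \<subseteq> r \<Longrightarrow> r \<subseteq> q \<Longrightarrow> r = q"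
  shows "n \<le> length xs"
  using assms
proof (induction xs arbitrary: S n p)
  case Nil
  show ?case
  proof (cases n)
    case (Suc m)
    then obtain q' where "prime_chain m p q'" "q' \<subset> q" using Nil by auto
    then show ?thesis using Nil(4)[of q'] Nil(2) prime_chain_subset[of m p q'] prime_chain_prime[of m p q']
      by auto
  qed simp
next
  case (Cons x xs)
  show ?case
  proof (cases n)
    case (Suc m)
    then obtain p' where p': "prime_chain m p' q" "p \<subseteq> p'" "x \<in> p'"
      using prime_chain_shift[of m p q x] Cons.prems by auto
    have "m \<le> length xs"
      using p' Cons.prems by (intro Cons.IH[of m p' "insert x S"]) auto
    then show ?thesis using Suc by simp
  qed simp
qed

end

subsection \<open>Prime avoidance and regular sequences\<close>

context cring
begin

lemma ideal_a_inv: "\<lbrakk>ideal I R; x \<in> I; y \<in> I\<rbrakk> \<Longrightarrow> x \<ominus> y \<in> I"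
proof -
  assume I: "ideal I R" and "x \<in> I" "y \<in> I"
  interpret I: ideal I R by fact
  show ?thesis using \<open>x \<in> I\<close> \<open>y \<in> I\<close> by (simp add: a_minus_def I.a_closed I.a_inv_closed)
qed

lemma avoiding_product:
  assumes "finite F" "primeideal p R" "\<And>q. q \<in> F \<Longrightarrow> ideal q R \<and> \<not> q \<subseteq> p"
  shows "\<exists>y\<in>carrier R - p. \<forall>q\<in>F. y \<in> q"
  using assms(1,3)
proof (induction F)
  case empty then show ?case using prime_one_notin[OF assms(2)] by auto
next
  case (insert q F)
  then obtain y where y: "y \<in> carrier R" "y \<notin> p" "\<forall>q\<in>F. y \<in> q" by auto
  obtain z where z: "z \<in> q" "z \<notin> p" using insert by auto
  have zc: "z \<in> carrier R" using z insert ideal_sub_carrier by blast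
  show ?case
  proof (intro bexI[of _ "y \<otimes> z"] ballI)
    show "y \<otimes> z \<in> carrier R - p" using prime_mult_notin[OF assms(2)] y z zc by simp
    fix r assume r: "r \<in> insert q F"
    then interpret r: ideal r R using insert.prems by auto
    show "y \<otimes> z \<in> r"
    proof (cases "r = q")
      case True then show ?thesis using r.I_l_closed[of z y] z y by simp
    next
      case False then show ?thesis using r y zc by (auto intro: r.I_r_closed)
    qed
  qed
qed

lemma prime_avoidance:
  assumes "finite F" "\<And>p. p \<in> F \<Longrightarrow> primeideal p R" "ideal J R" "\<And>p. p \<in> F \<Longrightarrow> \<not> J \<subseteq> p"
  shows "\<exists>x\<in>J. \<forall>p\<in>F. x \<notin> p"
  using assms(1,2,4)
proof (induction F rule: finite_psubset_induct)
  case (psubset F)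
  interpret J: ideal J R by fact
  show ?case
  proof (cases "\<exists>p\<in>F. \<exists>q\<in>F. p \<noteq> q \<and> q \<subseteq> p")
    case True
    then obtain p q where pq: "p \<in> F" "q \<in> F" "p \<noteq> q" "q \<subseteq> p" by auto
    have "\<exists>x\<in>J. \<forall>p\<in>F - {q}. x \<notin> p" using pq psubset.prems by (intro psubset.IH) auto
    then show ?thesis using pq by blast
  next
    case False
    show ?thesis
    proof (cases "F = {}")
      case True then show ?thesis using J.zero_closed by blast
    next
      case nonempty: False
      then obtain p where p: "p \<in> F" by auto
      have "\<exists>x\<in>J. \<forall>p\<in>F - {p}. x \<notin> p" using p psubset.prems by (intro psubset.IH) auto
      then obtain x where x: "x \<in> J" "\<forall>q\<in>F - {p}. x \<notin> q" by auto
      show ?thesis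
      proof (cases "x \<in> p")
        case xp: True
        have pp: "primeideal p R" using p psubset.prems by auto
        interpret p: ideal p R using pp by (rule prime_ideal)
        \<comment> \<open>Here \<open>x\<close> avoids every prime of \<open>F\<close> except
          \<open>p\<close>. It is corrected by \<open>j \<otimes> y\<close>, which lies in
          \<open>J\<close> and in all the other primes but not in \<open>p\<close>; such a
          \<open>y\<close> exists because no two members of \<open>F\<close> are comparable.\<close>
        have "\<exists>y\<in>carrier R - p. \<forall>q\<in>F - {p}. y \<in> q"
        proof (rule avoiding_product[OF _ pp])
          show "finite (F - {p})" using psubset.hyps by simp
          show "ideal q R \<and> \<not> q \<subseteq> p" if "q \<in> F - {p}" for q
            using that p False prime_ideal[OF psubset.prems(1)] by blast
        qed
        then obtain y where y: "y \<in> carrier R" "y \<notin> p" "\<forall>q\<in>F - {p}. y \<in> q" by blast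
        obtain j where j: "j \<in> J" "j \<notin> p" using psubset.prems p by blast
        have jc: "j \<in> carrier R" "x \<in> carrier R" using j x by auto
        have jy: "j \<otimes> y \<notin> p" "j \<otimes> y \<in> carrier R" using prime_mult_notin[OF pp] jc j y by auto
        have "x \<oplus> j \<otimes> y \<in> J" using x j y by (auto intro: J.a_closed J.I_r_closed)
        moreover have "x \<oplus> j \<otimes> y \<notin> q" if q: "q \<in> F" for q
        proof
          assume in_q: "x \<oplus> j \<otimes> y \<in> q"
          have qi: "ideal q R" using q psubset.prems prime_ideal by blast
          interpret q: ideal q R by (rule qi)
          show False
          proof (cases "q = p")
            case True
            have "(x \<oplus> j \<otimes> y) \<ominus> x \<in> q" using ideal_a_inv[OF qi in_q] xp True by simp
            moreover have "(x \<oplus> j \<otimes> y) \<ominus> x = j \<otimes> y" using jc y(1) by algebra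
            ultimately show False using jy True by simp
          next
            case False
            then have "j \<otimes> y \<in> q" using y q jc by (auto intro: q.I_l_closed)
            then have "(x \<oplus> j \<otimes> y) \<ominus> j \<otimes> y \<in> q" using ideal_a_inv[OF qi in_q] by simp
            moreover have "(x \<oplus> j \<otimes> y) \<ominus> j \<otimes> y = x" using jc y(1) by algebra
            ultimately show False using x q False by simp
          qed
        qed
        ultimately show ?thesis by blast
      next
        case False then show ?thesis using x by blast
      qed
    qed
  qed
qed

section \<open>Regular sequences modulo an ideal\<close>

definition nonzerodivisor :: "'a set \<Rightarrow> 'a \<Rightarrow> bool" where
  "nonzerodivisor I x \<longleftrightarrow> x \<in> carrier R \<and> (\<forall>a\<in>carrier R. x \<otimes> a \<in> I \<longrightarrow> a \<in> I)"

text \<open>In other words \<open>Hom (R/P, R/I)\<close> is nonzero. Tracking this through regular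
  sequences replaces the Ext groups by which Rees' theorem measures depth.\<close>

definition socle_nonzero :: "'a set \<Rightarrow> 'a set \<Rightarrow> bool" where
  "socle_nonzero P I \<longleftrightarrow> (\<exists>a\<in>carrier R. a \<notin> I \<and> P \<subseteq> colon I a)"

primrec adjoin_list :: "'a set \<Rightarrow> 'a list \<Rightarrow> 'a set" where
  "adjoin_list I [] = I"
| "adjoin_list I (x # xs) = adjoin_list (adjoin I x) xs"

primrec regular_over :: "'a set \<Rightarrow> 'a list \<Rightarrow> bool" where
  "regular_over I [] \<longleftrightarrow> True"
| "regular_over I (x # xs) \<longleftrightarrow> nonzerodivisor I x \<and> regular_over (adjoin I x) xs"

lemma nonzerodivisorD: "\<lbrakk>nonzerodivisor I x; a \<in> carrier R; x \<otimes> a \<in> I\<rbrakk> \<Longrightarrow> a \<in> I"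
  by (simp add: nonzerodivisor_def)

lemma socle_no_nonzerodivisor: "\<lbrakk>socle_nonzero P I; x \<in> P; nonzerodivisor I x\<rbrakk> \<Longrightarrow> False"
  unfolding socle_nonzero_def nonzerodivisor_def colon_def by blast

lemma adjoin_commute:
  assumes I: "ideal I R" and xy: "x \<in> carrier R" "y \<in> carrier R"
  shows "adjoin (adjoin I x) y = adjoin (adjoin I y) x"
proof -
  have "adjoin (adjoin I x) y \<subseteq> adjoin (adjoin I y) x" if c: "x \<in> carrier R" "y \<in> carrier R" for x y
  proof (rule adjoin_least)
    show "ideal (adjoin (adjoin I y) x) R" using I c by (intro adjoin_ideal)
    show "adjoin I x \<subseteq> adjoin (adjoin I y) x" by (intro adjoin_mono adjoin_ideal I c)
    show "y \<in> adjoin (adjoin I y) x"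
      using adjoin_ideal(2)[OF adjoin_ideal(1)[OF I c(2)] c(1)] adjoin_ideal(3)[OF I c(2)] by blast
  qed
  then show ?thesis using xy by blast
qed

lemma adjoin_list_append: "adjoin_list I (xs @ ys) = adjoin_list (adjoin_list I xs) ys"
  by (induction xs arbitrary: I) auto

lemma regular_over_append:
  "regular_over I (xs @ ys) \<longleftrightarrow> regular_over I xs \<and> regular_over (adjoin_list I xs) ys"
  by (induction xs arbitrary: I) auto

lemma adjoin_list_ideal: "\<lbrakk>ideal I R; set xs \<subseteq> carrier R\<rbrakk> \<Longrightarrow> ideal (adjoin_list I xs) R"
  by (induction xs arbitrary: I) (auto intro: adjoin_ideal)

lemma adjoin_list_adjoin:
  "\<lbrakk>ideal I R; set xs \<subseteq> carrier R; z \<in> carrier R\<rbrakk> \<Longrightarrow> adjoin_list (adjoin I z) xs = adjoin (adjoin_list I xs) z"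
  by (induction xs arbitrary: I) (auto simp: adjoin_commute adjoin_ideal)

lemma adjoin_list_Idl:
  "\<lbrakk>S \<subseteq> carrier R; set xs \<subseteq> carrier R\<rbrakk> \<Longrightarrow> adjoin_list (Idl S) xs = Idl (S \<union> set xs)"
proof (induction xs arbitrary: S)
  case (Cons x xs)
  then have "adjoin_list (Idl (insert x S)) xs = Idl (insert x S \<union> set xs)" by (intro Cons.IH) auto
  then show ?case using Cons.prems by (simp add: Idl_insert)
qed auto

lemma regular_over_nth:
  "regular_over I xs \<longleftrightarrow> (\<forall>i<length xs. nonzerodivisor (adjoin_list I (take i xs)) (xs ! i))"
proof (induction xs arbitrary: I)
  case (Cons x xs)
  show ?case by (simp add: Cons.IH All_less_Suc2)
qed simp

lemma Idl_empty: "Idl {} = {\<zero>}"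
  using genideal_zero genideal_minimal[of "{\<zero>}" "{}"] zeroideal
  by (metis Idl_subset_ideal empty_subsetI genideal_ideal ideal.Icarr subset_antisym
      additive_subgroup.zero_closed ideal_def insert_subset)

lemma regular_seq_iff:
  "regular_seq R xs \<longleftrightarrow> set xs \<subseteq> carrier R \<and> regular_over {\<zero>} xs \<and> adjoin_list {\<zero>} xs \<noteq> carrier R"
proof (cases "set xs \<subseteq> carrier R")
  case True
  have *: "adjoin_list {\<zero>} (take i xs) = Idl (set (take i xs))" for i
    using adjoin_list_Idl[of "{}" "take i xs"] set_take_subset[of i xs] True by (auto simp: Idl_empty)
  have "adjoin_list {\<zero>} xs = Idl (set xs)"
    using adjoin_list_Idl[of "{}" xs] True by (auto simp: Idl_empty)
  then show ?thesis
    using True nth_mem[of _ xs] by (auto simp: regular_seq_def regular_over_nth nonzerodivisor_def *)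
qed (simp add: regular_seq_def)

text \<open>Half of the exchange of two consecutive entries: from \<open>x a = i + r z\<close>,
  regularity of \<open>z\<close> modulo \<open>x\<close> gives \<open>r = j + d x\<close>, and
  cancelling \<open>x\<close> in \<open>x (a - d z) \<in> I\<close> yields
  \<open>a \<in> I + Rz\<close>. The other half, regularity of \<open>z\<close> modulo
  \<open>I\<close>, does not follow, so \<open>regular_over_adjoin\<close> assumes it at every
  stage.\<close>

lemma nonzerodivisor_adjoin:
  assumes I: "ideal I R" and x: "nonzerodivisor I x" and z: "nonzerodivisor (adjoin I x) z"
  shows "nonzerodivisor (adjoin I z) x"
proof -
  interpret I: ideal I R by fact
  have c: "x \<in> carrier R" "z \<in> carrier R" using x z unfolding nonzerodivisor_def by blast+
  have "a \<in> adjoin I z" if a: "a \<in> carrier R" "x \<otimes> a \<in> adjoin I z" for a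
  proof -
    obtain i r where h: "i \<in> I" "r \<in> carrier R" "x \<otimes> a = i \<oplus> r \<otimes> z"
      using a(2) unfolding mem_adjoin by blast
    have ic: "i \<in> carrier R" using h by auto
    have "z \<otimes> r = (i \<oplus> r \<otimes> z) \<oplus> \<ominus> i" using h(2) ic c by algebra
    also have "\<dots> = \<ominus> i \<oplus> a \<otimes> x" unfolding h(3)[symmetric] using ic c a(1) by algebra
    finally have "z \<otimes> r \<in> adjoin I x"
      unfolding mem_adjoin using h(1) a(1) I.a_inv_closed by blast
    then obtain j d where j: "j \<in> I" "d \<in> carrier R" "r = j \<oplus> d \<otimes> x"
      using nonzerodivisorD[OF z h(2)] unfolding mem_adjoin by blast
    have jc: "j \<in> carrier R" using j by auto
    have "x \<otimes> (a \<ominus> d \<otimes> z) = x \<otimes> a \<ominus> d \<otimes> x \<otimes> z" using a(1) c j(2) by algebra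
    also have "\<dots> = i \<oplus> z \<otimes> j" unfolding h(3) j(3) using ic jc j(2) c by algebra
    also have "\<dots> \<in> I" using h(1) I.I_l_closed[OF j(1) c(2)] I.a_closed by blast
    finally have *: "x \<otimes> (a \<ominus> d \<otimes> z) \<in> I" .
    have "a \<ominus> d \<otimes> z \<in> I" by (rule nonzerodivisorD[OF x _ *]) (use a(1) c j(2) in simp)
    moreover have "a = (a \<ominus> d \<otimes> z) \<oplus> d \<otimes> z" using a(1) c j(2) by algebra
    ultimately show ?thesis unfolding mem_adjoin using j(2) by blast
  qed
  then show ?thesis using c by (simp add: nonzerodivisor_def)
qed

lemma regular_over_adjoin:
  "\<lbrakk>ideal I R; set xs \<subseteq> carrier R; regular_over I xs; z \<in> carrier R;
    \<And>i. i \<le> length xs \<Longrightarrow> nonzerodivisor (adjoin_list I (take i xs)) z\<rbrakk> \<Longrightarrow> regular_over (adjoin I z) xs"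
proof (induction xs arbitrary: I)
  case (Cons x xs)
  have x: "x \<in> carrier R" "nonzerodivisor I x" using Cons.prems by auto
  have "nonzerodivisor (adjoin I x) z" using Cons.prems(5)[of 1] by simp
  then have "nonzerodivisor (adjoin I z) x" using nonzerodivisor_adjoin Cons.prems(1) x by blast
  moreover have "regular_over (adjoin (adjoin I x) z) xs"
  proof (rule Cons.IH)
    show "nonzerodivisor (adjoin_list (adjoin I x) (take i xs)) z" if "i \<le> length xs" for i
      using Cons.prems(5)[of "Suc i"] that by simp
  qed (use Cons.prems adjoin_ideal x in auto)
  ultimately show ?case using adjoin_commute[OF Cons.prems(1) x(1) Cons.prems(4)] by simp
qed simp

text \<open>The connecting map of \<open>x\<close> embeds the first socle in
  \<open>Ext^1 (R/P, R/I)\<close>, which the connecting map of \<open>z\<close> identifies with the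
  second. Explicitly, a class \<open>a\<close> killed by \<open>P\<close> modulo \<open>x\<close>
  satisfies \<open>z a = i + b x\<close>, and \<open>b\<close> is the class wanted modulo
  \<open>z\<close>.\<close>

lemma socle_exchange:
  assumes I: "ideal I R" and P: "ideal P R" and x: "nonzerodivisor I x" and z: "nonzerodivisor I z" "z \<in> P"
    and soc: "socle_nonzero P (adjoin I x)"
  shows "socle_nonzero P (adjoin I z)"
proof -
  interpret I: ideal I R by fact
  have c: "x \<in> carrier R" "z \<in> carrier R" using x z unfolding nonzerodivisor_def by blast+
  obtain a where a: "a \<in> carrier R" "a \<notin> adjoin I x" "P \<subseteq> colon (adjoin I x) a"
    using soc by (auto simp: socle_nonzero_def)
  then have "z \<otimes> a \<in> adjoin I x" using z by (auto simp: colon_def)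
  then obtain i b where b: "i \<in> I" "b \<in> carrier R" "z \<otimes> a = i \<oplus> b \<otimes> x" unfolding mem_adjoin by blast
  have ic: "i \<in> carrier R" using b by auto
  have "b \<notin> adjoin I z"
  proof
    assume "b \<in> adjoin I z"
    then obtain j d where j: "j \<in> I" "d \<in> carrier R" "b = j \<oplus> d \<otimes> z" unfolding mem_adjoin by blast
    have jc: "j \<in> carrier R" using j by auto
    have "z \<otimes> (a \<ominus> d \<otimes> x) = z \<otimes> a \<ominus> d \<otimes> z \<otimes> x" using a(1) c j(2) by algebra
    also have "\<dots> = i \<oplus> x \<otimes> j" unfolding b(3) j(3) using ic jc j(2) c by algebra
    also have "\<dots> \<in> I" using b(1) I.I_l_closed[OF j(1) c(1)] I.a_closed by blast
    finally have *: "z \<otimes> (a \<ominus> d \<otimes> x) \<in> I" .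
    have "a \<ominus> d \<otimes> x \<in> I" by (rule nonzerodivisorD[OF z(1) _ *]) (use a(1) c j(2) in simp)
    moreover have "a = (a \<ominus> d \<otimes> x) \<oplus> d \<otimes> x" using a(1) c j(2) by algebra
    ultimately show False using a(2) unfolding mem_adjoin using j(2) by blast
  qed
  moreover have "p \<in> colon (adjoin I z) b" if p: "p \<in> P" for p
  proof -
    have pc: "p \<in> carrier R" using p ideal_sub_carrier[OF P] by auto
    have "p \<otimes> a \<in> adjoin I x" using a(3) p by (auto simp: colon_def)
    then obtain j d where j: "j \<in> I" "d \<in> carrier R" "p \<otimes> a = j \<oplus> d \<otimes> x" unfolding mem_adjoin by blast
    have jc: "j \<in> carrier R" using j by auto
    have "x \<otimes> (p \<otimes> b \<ominus> d \<otimes> z) = p \<otimes> (i \<oplus> b \<otimes> x) \<ominus> p \<otimes> i \<ominus> d \<otimes> x \<otimes> z"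
      using pc b(2) j(2) c ic by algebra
    also have "\<dots> = z \<otimes> (p \<otimes> a) \<ominus> p \<otimes> i \<ominus> d \<otimes> x \<otimes> z"
      unfolding b(3)[symmetric] using pc ic a(1) c j(2) by algebra
    also have "\<dots> = z \<otimes> j \<ominus> p \<otimes> i" unfolding j(3) using pc ic jc c j(2) by algebra
    also have "\<dots> \<in> I" using ideal_a_inv[OF I] I.I_l_closed[OF j(1) c(2)] I.I_l_closed[OF b(1) pc] by blast
    finally have *: "x \<otimes> (p \<otimes> b \<ominus> d \<otimes> z) \<in> I" .
    have "p \<otimes> b \<ominus> d \<otimes> z \<in> I" by (rule nonzerodivisorD[OF x _ *]) (use pc b(2) j(2) c in simp)
    moreover have "p \<otimes> b = (p \<otimes> b \<ominus> d \<otimes> z) \<oplus> d \<otimes> z" using pc b(2) j(2) c by algebra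
    ultimately have "p \<otimes> b \<in> adjoin I z" unfolding mem_adjoin using j(2) by blast
    then show ?thesis using pc by (simp add: colon_def)
  qed
  ultimately show ?thesis using b(2) unfolding socle_nonzero_def by blast
qed

lemma nonzerodivisor_pow:
  assumes "nonzerodivisor I x" "s \<in> carrier R" "x [^] (k::nat) \<otimes> s \<in> I" shows "s \<in> I"
  using assms(3)
proof (induction k)
  case 0 then show ?case using assms by simp
next
  case (Suc k)
  have x: "x \<in> carrier R" using assms by (simp add: nonzerodivisor_def)
  have "x \<otimes> (x [^] k \<otimes> s) \<in> I" using Suc.prems x assms(2) by (simp add: m_ac)
  then have "x [^] k \<otimes> s \<in> I" by (rule nonzerodivisorD[OF assms(1), rotated]) (use x assms(2) in simp)
  then show ?case by (rule Suc.IH)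
qed

end

context noetherian_cring
begin

text \<open>Let \<open>T\<close> be a finite set of elements with maximal annihilators modulo
  \<open>I\<close> whose ideal is as large as possible; that ideal then contains all such elements.
  If the annihilator of such a \<open>d\<close> were not among those of \<open>T\<close>, some
  \<open>r\<close> outside it would kill all of \<open>T\<close>, hence also
  \<open>d\<close>.\<close>

lemma finite_zerodivisor_primes:
  assumes I: "ideal I R"
  obtains F where "finite F" "F \<subseteq> carrier R" "\<And>b. b \<in> F \<Longrightarrow> b \<notin> I \<and> primeideal (colon I b) R"
    "\<And>x. x \<in> carrier R \<Longrightarrow> (\<And>b. b \<in> F \<Longrightarrow> x \<notin> colon I b) \<Longrightarrow> nonzerodivisor I x"
proof -
  let ?D = "{b \<in> carrier R. b \<notin> I \<and> primeideal (colon I b) R \<and>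
    (\<forall>c\<in>carrier R. c \<notin> I \<longrightarrow> colon I b \<subseteq> colon I c \<longrightarrow> colon I c = colon I b)}"
  obtain M where M: "M \<in> {Idl T | T. finite T \<and> T \<subseteq> ?D}"
    and max: "\<And>J. J \<in> {Idl T | T. finite T \<and> T \<subseteq> ?D} \<Longrightarrow> M \<subseteq> J \<Longrightarrow> J = M"
    by (rule maximal_in_ideals[of "{Idl T | T. finite T \<and> T \<subseteq> ?D}"]) (auto intro!: genideal_ideal)
  then obtain T where T: "finite T" "T \<subseteq> ?D" "M = Idl T" by auto
  have Tc: "T \<subseteq> carrier R" using T by auto
  have D_sub: "d \<in> Idl T" if d: "d \<in> ?D" for d
  proof -
    have "Idl (insert d T) = M"
      using T d Idl_insert[OF Tc, of d] adjoin_ideal(2)[OF genideal_ideal[OF Tc]]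
      by (intro max CollectI exI[of _ "insert d T"]) auto
    then show ?thesis using genideal_self[of "insert d T"] d Tc T(3) by auto
  qed
  have ex: "\<exists>t\<in>T. colon I t = colon I d" if d: "d \<in> ?D" for d
  proof (rule ccontr)
    assume none: "\<not> ?thesis"
    obtain r where r: "r \<in> carrier R" "r \<notin> colon I d" "\<forall>q\<in>colon I ` T. r \<in> q"
      using avoiding_product[of "colon I ` T" "colon I d"] T d none colon_ideal[OF I] by fastforce
    have "T \<subseteq> colon I r"
    proof
      fix t assume t: "t \<in> T"
      then have "r \<otimes> t \<in> I" using r(3) by (auto simp: colon_def)
      then show "t \<in> colon I r" using t Tc r(1) m_comm[of r t] by (auto simp: colon_def)
    qed
    then have "Idl T \<subseteq> colon I r" by (intro genideal_minimal colon_ideal I r)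
    then have "d \<in> colon I r" using D_sub[OF d] by blast
    then have "r \<in> colon I d" using r(1) m_comm[of r d] by (auto simp: colon_def)
    then show False using r by simp
  qed
  show ?thesis
  proof (rule that[OF T(1) Tc])
    fix x assume x: "x \<in> carrier R" "\<And>b. b \<in> T \<Longrightarrow> x \<notin> colon I b"
    show "nonzerodivisor I x"
    proof (rule ccontr)
      assume "\<not> ?thesis"
      then obtain a where a: "a \<in> carrier R" "a \<notin> I" "x \<otimes> a \<in> I" using x by (auto simp: nonzerodivisor_def)
      obtain b where b: "b \<in> carrier R" "b \<notin> I" "colon I a \<subseteq> colon I b" "primeideal (colon I b) R"
        "\<And>c. c \<in> carrier R \<Longrightarrow> c \<notin> I \<Longrightarrow> colon I b \<subseteq> colon I c \<Longrightarrow> colon I c = colon I b"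
        by (rule assoc_prime_exists[OF I a(1,2)]) blast
      have "x \<in> colon I a" using a x by (simp add: colon_def)
      moreover obtain t where "t \<in> T" "colon I t = colon I b" using ex[of b] b by auto
      ultimately show False using x(2) b(3) by auto
    qed
  qed (use T in auto)
qed

text \<open>If \<open>P\<close> lay in an associated prime \<open>colon I b\<close>, then
  \<open>b\<close> would be a socle element. So \<open>P\<close> is contained in none of the
  finitely many associated primes of the finitely many quotients, and prime avoidance treats all of
  them at once.\<close>

lemma common_nonzerodivisor:
  assumes P: "ideal P R" and "finite \<I>" "\<And>I. I \<in> \<I> \<Longrightarrow> ideal I R \<and> \<not> socle_nonzero P I"
  obtains z where "z \<in> P" "\<And>I. I \<in> \<I> \<Longrightarrow> nonzerodivisor I z"
proof -
  have "\<exists>F. finite F \<and> F \<subseteq> carrier R \<and> (\<forall>b\<in>F. b \<notin> I \<and> primeideal (colon I b) R) \<and>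
      (\<forall>x\<in>carrier R. (\<forall>b\<in>F. x \<notin> colon I b) \<longrightarrow> nonzerodivisor I x)" if "I \<in> \<I>" for I
    by (rule finite_zerodivisor_primes[of I]) (use assms(3)[OF that] in \<open>auto 0 3\<close>)
  then obtain F where F: "\<And>I. I \<in> \<I> \<Longrightarrow> finite (F I) \<and> F I \<subseteq> carrier R \<and> (\<forall>b\<in>F I. b \<notin> I \<and> primeideal (colon I b) R) \<and>
      (\<forall>x\<in>carrier R. (\<forall>b\<in>F I. x \<notin> colon I b) \<longrightarrow> nonzerodivisor I x)" by metis
  let ?Q = "\<Union>I\<in>\<I>. colon I ` F I"
  have "\<exists>x\<in>P. \<forall>p\<in>?Q. x \<notin> p"
  proof (rule prime_avoidance)
    show "finite ?Q" using assms(2) F by auto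
    show "primeideal p R" if "p \<in> ?Q" for p using that F by auto
    show "\<not> P \<subseteq> p" if p: "p \<in> ?Q" for p
    proof
      assume "P \<subseteq> p"
      with p obtain I b where "I \<in> \<I>" "b \<in> F I" "P \<subseteq> colon I b" by auto
      then have "socle_nonzero P I" using F unfolding socle_nonzero_def by blast
      then show False using assms(3) \<open>I \<in> \<I>\<close> by blast
    qed
  qed (rule P)
  then obtain x where x: "x \<in> P" "\<forall>p\<in>?Q. x \<notin> p" by blast
  then have "nonzerodivisor I x" if "I \<in> \<I>" for I
    using F[OF that] that ideal_sub_carrier[OF P] by blast
  then show ?thesis using x that by blast
qed

text \<open>
  Both sequences are compared with sequences whose last entry is a common element \<open>z\<close>, which may
  then be moved to the front.
\<close>

lemma socle_transfer:
  "\<lbrakk>ideal P R; ideal I R; length xs = length ys; set xs \<subseteq> P; set ys \<subseteq> P; regular_over I xs; regular_over I ys;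
    socle_nonzero P (adjoin_list I xs)\<rbrakk> \<Longrightarrow> socle_nonzero P (adjoin_list I ys)"
proof (induction "length xs" arbitrary: xs ys I)
  case 0 then show ?case by auto
next
  case (Suc n)
  note Pc = ideal_sub_carrier[OF Suc.prems(1)]
  obtain xs' x where xs: "xs = xs' @ [x]" using Suc(2) by (cases xs rule: rev_exhaust) auto
  obtain ys' y where ys: "ys = ys' @ [y]" using Suc(2) Suc.prems(3) by (cases ys rule: rev_exhaust) auto
  have sub: "set xs' \<subseteq> carrier R" "set ys' \<subseteq> carrier R" "x \<in> P" "y \<in> P"
    using Suc.prems Pc by (auto simp: xs ys)
  \<comment> \<open>The proper initial stages of both sequences. At each of them the next entry is a
    nonzerodivisor from \<open>P\<close>, so none has a socle.\<close>
  let ?\<I> = "(\<lambda>i. adjoin_list I (take i xs')) ` {..n} \<union> (\<lambda>i. adjoin_list I (take i ys')) ` {..n}"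
  have nosoc: "ideal (adjoin_list I (take i us)) R \<and> \<not> socle_nonzero P (adjoin_list I (take i us))"
    if us: "regular_over I us" "set us \<subseteq> P" "i < length us" for us i
  proof
    show "ideal (adjoin_list I (take i us)) R"
      using us set_take_subset[of i us] Pc by (intro adjoin_list_ideal Suc.prems) auto
    show "\<not> socle_nonzero P (adjoin_list I (take i us))"
      using us(1,3) socle_no_nonzerodivisor[OF _ subsetD[OF us(2) nth_mem[OF us(3)]]]
      unfolding regular_over_nth by blast
  qed
  obtain z where z: "z \<in> P" "\<And>J. J \<in> ?\<I> \<Longrightarrow> nonzerodivisor J z"
  proof (rule common_nonzerodivisor[OF Suc.prems(1), of ?\<I>])
    fix J assume "J \<in> ?\<I>"
    then obtain i where i: "i \<le> n" "J = adjoin_list I (take i xs') \<or> J = adjoin_list I (take i ys')" by auto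
    then have "J = adjoin_list I (take i xs) \<or> J = adjoin_list I (take i ys)"
      using Suc(2) Suc.prems(3) by (auto simp: xs ys)
    then show "ideal J R \<and> \<not> socle_nonzero P J"
      using nosoc[of xs i] nosoc[of ys i] Suc.prems Suc(2) i by auto
  qed auto
  have zc: "z \<in> carrier R" using z Pc by auto
  have len: "length xs' = n" "length ys' = n" using Suc(2) Suc.prems(3) by (auto simp: xs ys)
  have zx: "nonzerodivisor (adjoin_list I (take i xs')) z" "nonzerodivisor (adjoin_list I (take i ys')) z"
    if "i \<le> n" for i using z(2) that by auto
  have zx': "nonzerodivisor (adjoin_list I xs') z" "nonzerodivisor (adjoin_list I ys') z"
    using zx[of n] len by auto
  have idx: "ideal (adjoin_list I xs') R" "ideal (adjoin_list I ys') R"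
    using sub Suc.prems by (auto intro: adjoin_list_ideal)
  have rx: "regular_over I xs'" "nonzerodivisor (adjoin_list I xs') x"
    and ry: "regular_over I ys'" "nonzerodivisor (adjoin_list I ys') y"
    using Suc.prems(6,7) by (auto simp: xs ys regular_over_append)
  have "socle_nonzero P (adjoin (adjoin_list I xs') z)"
    using socle_exchange[OF idx(1) Suc.prems(1) rx(2) zx'(1) z(1)] Suc.prems(8)
    by (simp add: xs adjoin_list_append)
  then have "socle_nonzero P (adjoin_list (adjoin I z) xs')"
    using adjoin_list_adjoin[OF Suc.prems(2) sub(1) zc] by simp
  \<comment> \<open>Without their last entries both sequences are shorter by one and regular over
    \<open>I + Rz\<close>, where the induction hypothesis compares them.\<close>
  then have "socle_nonzero P (adjoin_list (adjoin I z) ys')"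
    using Suc.prems sub len zc rx ry zx
    by (intro Suc.hyps(1)[of xs' "adjoin I z" ys'] adjoin_ideal regular_over_adjoin) (auto simp: xs ys)
  then have "socle_nonzero P (adjoin (adjoin_list I ys') z)"
    using adjoin_list_adjoin[OF Suc.prems(2) sub(2) zc] by simp
  then show ?case
    using socle_exchange[OF idx(2) Suc.prems(1) zx'(2) ry(2) sub(4)]
    by (simp add: ys adjoin_list_append)
qed

text \<open>Below a prime \<open>p\<close> that contains \<open>J\<close> and a nonzerodivisor
  \<open>x\<close> modulo \<open>J\<close> there is a strictly smaller prime over \<open>J\<close>.
  One such descent per entry bounds the depth by the dimension.\<close>

lemma regular_prime_chain:
  "\<lbrakk>ideal I R; set xs \<subseteq> carrier R; regular_over I xs; primeideal p R; adjoin_list I xs \<subseteq> p\<rbrakk>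
   \<Longrightarrow> \<exists>q. prime_chain (length xs) q p"
proof (induction xs arbitrary: p rule: rev_induct)
  case Nil then show ?case by auto
next
  case (snoc x xs)
  let ?J = "adjoin_list I xs"
  have J: "ideal ?J R" using snoc.prems by (intro adjoin_list_ideal) auto
  have x: "nonzerodivisor ?J x" "x \<in> carrier R" using snoc.prems by (auto simp: regular_over_append)
  have Jp: "?J \<subseteq> p" "x \<in> p" using snoc.prems(5) adjoin_ideal(2,3)[OF J x(2)] by (auto simp: adjoin_list_append)
  \<comment> \<open>A prime that misses these products omits \<open>x\<close>, by the choice of a
    unit for \<open>s\<close>, and lies inside \<open>p\<close>, by \<open>k = 0\<close>.\<close>
  let ?M = "{x [^] k \<otimes> s | (k::nat) s. s \<in> carrier R \<and> s \<notin> p}"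
  obtain q where q: "primeideal q R" "?J \<subseteq> q" "q \<inter> ?M = {}"
  proof (rule prime_disjoint_mult_set[OF J, of ?M])
    show "?M \<subseteq> carrier R" using x by auto
    have one: "\<one> \<notin> p" using prime_one_notin snoc.prems by blast
    then show "\<one> \<in> ?M" by (auto intro!: exI[of _ "0::nat"] exI[of _ \<one>])
    fix a b assume "a \<in> ?M" "b \<in> ?M"
    then obtain k l s t where h: "a = x [^] (k::nat) \<otimes> s" "b = x [^] (l::nat) \<otimes> t"
      "s \<in> carrier R" "s \<notin> p" "t \<in> carrier R" "t \<notin> p" by auto
    have "a \<otimes> b = x [^] (k + l) \<otimes> (s \<otimes> t)"
      using h x by (simp add: nat_pow_mult[symmetric] m_ac)
    moreover have "s \<otimes> t \<notin> p" using prime_mult_notin snoc.prems h by blast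
    ultimately show "a \<otimes> b \<in> ?M" using h by blast
  next
    show "?J \<inter> ?M = {}" using nonzerodivisor_pow[OF x(1)] Jp by auto
  qed
  have "x [^] (1::nat) \<otimes> \<one> \<in> ?M" using prime_one_notin snoc.prems by blast
  then have "x \<notin> q" using q x by auto
  moreover have "q \<subseteq> p"
  proof
    fix s assume s: "s \<in> q"
    then have sc: "s \<in> carrier R" using q prime_ideal ideal_sub_carrier by blast
    show "s \<in> p"
    proof (rule ccontr)
      assume "s \<notin> p"
      then have "x [^] (0::nat) \<otimes> s \<in> ?M" using sc by blast
      then show False using q s sc by auto
    qed
  qed
  ultimately have "q \<subset> p" using Jp by auto
  moreover have "\<exists>q0. prime_chain (length xs) q0 q"
    using snoc.prems q by (intro snoc.IH) (auto simp: regular_over_append)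
  ultimately show ?case using snoc.prems by auto
qed

end

subsection \<open>Pure local homomorphisms\<close>

lemma (in ring_hom_cring) prime_vimage:
  assumes "primeideal Q S"
  shows "primeideal {r \<in> carrier R. h r \<in> Q} R"
proof -
  interpret Q: primeideal Q S by fact
  have "ring_hom_ring R S h" ..
  note vimage = ring_hom_ring.ideal_vimage[OF this Q.ideal_axioms]
  show ?thesis
  proof (rule primeidealI[OF vimage R.is_cring])
    have "\<one> \<notin> {r \<in> carrier R. h r \<in> Q}" using S.prime_one_notin[OF assms] by simp
    then show "carrier R \<noteq> {r \<in> carrier R. h r \<in> Q}" by blast
  qed (use Q.I_prime in auto)
qed

lemma (in cring) maximal_unique_contains:
  assumes "noetherian_ring R" "{I. maximalideal I R} = {m}" "ideal I R" "\<one> \<notin> I"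
  shows "I \<subseteq> m"
proof -
  interpret noetherian_cring R using assms is_cring by (simp add: noetherian_cring_def)
  obtain Q where "maximalideal Q R" "I \<subseteq> Q" using maximal_containing[OF assms(3,4)] .
  then show ?thesis using assms(2) by blast
qed

lemma (in cring) depth_le_krull_dim:
  assumes "noetherian_ring R" "maximalideal m R"
  shows "depth R m \<le> krull_dim R"
  unfolding depth_def
proof (rule Sup_least)
  interpret noetherian_cring R using assms is_cring by (simp add: noetherian_cring_def)
  interpret m: ideal m R using assms(2) maximal_prime prime_ideal by blast
  fix d assume "d \<in> {enat (length xs) |xs. regular_seq R xs \<and> set xs \<subseteq> m}"
  then obtain xs where xs: "d = enat (length xs)" "regular_seq R xs" "set xs \<subseteq> m" by auto
  have "adjoin_list {\<zero>} xs = Idl (set xs)"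
    using adjoin_list_Idl[of "{}" xs] subset_trans[OF xs(3) m.a_subset] by (simp add: Idl_empty)
  then have "adjoin_list {\<zero>} xs \<subseteq> m" using genideal_minimal[OF m.ideal_axioms xs(3)] by simp
  then have "\<exists>q. prime_chain (length xs) q m"
    using xs(2) by (intro regular_prime_chain[OF zeroideal] maximal_prime assms) (auto simp: regular_seq_iff)
  then show "d \<le> krull_dim R" using krull_dim_ge xs(1) by blast
qed

text \<open>What is kept of the map from \<open>A\<close> localized at \<open>n\<close> to
  \<open>B\<close> localized at \<open>P\<close>. The assumption \<open>pure\<close> says that
  ideals of \<open>R\<close> are contracted from their extensions; \<open>incomparable\<close> says
  that the closed fibre is a single point, i.e. that \<open>n\<close> extends to an ideal primary to
  \<open>m\<close>.\<close>

locale pure_local_hom = ring_hom_cring R S h for R (structure) and S (structure) and h +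
  fixes n m
  assumes noethR: "noetherian_ring R" and noethS: "noetherian_ring S"
    and localR: "{I. maximalideal I R} = {n}" and localS: "{I. maximalideal I S} = {m}"
    and local_hom: "h ` n \<subseteq> m"
    and pure: "\<And>I a. \<lbrakk>ideal I R; a \<in> carrier R; h a \<in> Idl\<^bsub>S\<^esub> (h ` I)\<rbrakk> \<Longrightarrow> a \<in> I"
    and incomparable: "\<And>Q. \<lbrakk>primeideal Q S; h ` n \<subseteq> Q\<rbrakk> \<Longrightarrow> Q = m"
begin

sublocale noeR: noetherian_cring R
  using noethR R.is_cring by (simp add: noetherian_cring_def)

sublocale noeS: noetherian_cring S
  using noethS S.is_cring by (simp add: noetherian_cring_def)

lemma n_maximal: "maximalideal n R" and m_maximal: "maximalideal m S"
  using localR localS by blast+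

lemma n_prime: "primeideal n R" and m_prime: "primeideal m S"
  by (rule R.maximal_prime[OF n_maximal], rule S.maximal_prime[OF m_maximal])

lemma n_sub: "n \<subseteq> carrier R" and m_sub: "m \<subseteq> carrier S"
  using R.ideal_sub_carrier R.prime_ideal n_prime S.ideal_sub_carrier S.prime_ideal m_prime by blast+

lemma adjoin_list_map:
  assumes "set xs \<subseteq> carrier R"
  shows "S.adjoin_list {\<zero>\<^bsub>S\<^esub>} (map h xs) = Idl\<^bsub>S\<^esub> (h ` R.adjoin_list {\<zero>} xs)"
proof -
  have 1: "R.adjoin_list {\<zero>} xs = Idl (set xs)"
    using R.adjoin_list_Idl[of "{}" xs] assms by (auto simp: R.Idl_empty)
  have hc: "h ` set xs \<subseteq> carrier S" using assms by auto
  have 2: "S.adjoin_list {\<zero>\<^bsub>S\<^esub>} (map h xs) = Idl\<^bsub>S\<^esub> (h ` set xs)"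
    using S.adjoin_list_Idl[of "{}" "map h xs"] hc by (auto simp: S.Idl_empty)
  have hr: "ring_hom_ring R S h" ..
  have I2: "ideal (Idl\<^bsub>S\<^esub> (h ` set xs)) S" by (rule S.genideal_ideal[OF hc])
  have "Idl (set xs) \<subseteq> {r \<in> carrier R. h r \<in> Idl\<^bsub>S\<^esub> (h ` set xs)}"
    using assms S.genideal_self[OF hc]
    by (intro R.genideal_minimal ring_hom_ring.ideal_vimage[OF hr I2]) auto
  then have *: "h ` (Idl (set xs)) \<subseteq> Idl\<^bsub>S\<^esub> (h ` set xs)" by auto
  have c: "h ` (Idl (set xs)) \<subseteq> carrier S" using * S.ideal_sub_carrier[OF I2] by blast
  have "Idl\<^bsub>S\<^esub> (h ` (Idl (set xs))) = Idl\<^bsub>S\<^esub> (h ` set xs)"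
  proof
    show "Idl\<^bsub>S\<^esub> (h ` (Idl (set xs))) \<subseteq> Idl\<^bsub>S\<^esub> (h ` set xs)" using * by (intro S.genideal_minimal I2)
    show "Idl\<^bsub>S\<^esub> (h ` set xs) \<subseteq> Idl\<^bsub>S\<^esub> (h ` (Idl (set xs)))"
      using S.genideal_self[OF c] R.genideal_self[OF assms]
      by (intro S.genideal_minimal S.genideal_ideal c) blast
  qed
  then show ?thesis using 1 2 by simp
qed

lemma pure_adjoin_list:
  assumes "set xs \<subseteq> carrier R" "a \<in> carrier R" "h a \<in> S.adjoin_list {\<zero>\<^bsub>S\<^esub>} (map h xs)"
  shows "a \<in> R.adjoin_list {\<zero>} xs"
  using pure[OF R.adjoin_list_ideal[OF R.zeroideal assms(1)] assms(2)] assms(3)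
  by (simp add: adjoin_list_map[OF assms(1)])

lemma h_adjoin_list:
  assumes "set xs \<subseteq> carrier R" "a \<in> R.adjoin_list {\<zero>} xs"
  shows "h a \<in> S.adjoin_list {\<zero>\<^bsub>S\<^esub>} (map h xs)"
proof -
  have "h ` R.adjoin_list {\<zero>} xs \<subseteq> carrier S"
    using R.ideal_sub_carrier[OF R.adjoin_list_ideal[OF R.zeroideal assms(1)]] by auto
  then show ?thesis using S.genideal_self assms adjoin_list_map by auto
qed

text \<open>A relation expressing that \<open>xs ! i\<close> times \<open>a\<close> lies in the
  ideal of the earlier entries is pushed to \<open>S\<close>, where the factor is cancelled; since
  ideals of \<open>R\<close> are contracted from \<open>S\<close>, the result comes back to
  \<open>R\<close>.\<close>

lemma regular_descends:
  assumes xs: "set xs \<subseteq> carrier R" and reg: "S.regular_over {\<zero>\<^bsub>S\<^esub>} (map h xs)"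
  shows "R.regular_over {\<zero>} xs"
  unfolding R.regular_over_nth
proof (intro allI impI)
  fix i assume i: "i < length xs"
  have sub: "set (take i xs) \<subseteq> carrier R" "xs ! i \<in> carrier R"
    using xs i set_take_subset[of i xs] nth_mem[OF i] by auto
  have nz: "S.nonzerodivisor (S.adjoin_list {\<zero>\<^bsub>S\<^esub>} (map h (take i xs))) (h (xs ! i))"
    using reg i by (auto simp: S.regular_over_nth take_map)
  show "R.nonzerodivisor (R.adjoin_list {\<zero>} (take i xs)) (xs ! i)"
    unfolding R.nonzerodivisor_def
  proof (intro conjI ballI impI sub)
    fix a assume a: "a \<in> carrier R" "xs ! i \<otimes> a \<in> R.adjoin_list {\<zero>} (take i xs)"
    have "h (xs ! i) \<otimes>\<^bsub>S\<^esub> h a \<in> S.adjoin_list {\<zero>\<^bsub>S\<^esub>} (map h (take i xs))"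
      using h_adjoin_list[OF sub(1) a(2)] sub a by simp
    then have "h a \<in> S.adjoin_list {\<zero>\<^bsub>S\<^esub>} (map h (take i xs))"
      using S.nonzerodivisorD[OF nz] a by simp
    then show "a \<in> R.adjoin_list {\<zero>} (take i xs)" by (rule pure_adjoin_list[OF sub(1) a(1)])
  qed
qed

text \<open>By Rees' theorem the quotient of \<open>S\<close> by the shorter sequence has no socle,
  since \<open>ys\<close> continues beyond that length. Its associated primes therefore differ from
  \<open>m\<close>, so by \<open>incomparable\<close> their contractions do not contain
  \<open>n\<close>. Prime avoidance is then carried out in \<open>R\<close>, which places the new
  entry in \<open>n\<close>.\<close>

lemma extend_regular:
  assumes xs: "set xs \<subseteq> n" and reg: "S.regular_over {\<zero>\<^bsub>S\<^esub>} (map h xs)"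
    and ys: "set ys \<subseteq> m" "S.regular_over {\<zero>\<^bsub>S\<^esub>} ys" "length xs < length ys"
  shows "\<exists>x\<in>n. S.regular_over {\<zero>\<^bsub>S\<^esub>} (map h (xs @ [x]))"
proof -
  let ?J = "S.adjoin_list {\<zero>\<^bsub>S\<^esub>} (map h xs)"
  have hxs: "set (map h xs) \<subseteq> m" using xs local_hom by auto
  have J: "ideal ?J S" using hxs m_sub by (intro S.adjoin_list_ideal S.zeroideal) auto
  have mi: "ideal m S" using m_prime S.prime_ideal by blast
  have nosoc: "\<not> S.socle_nonzero m ?J"
  proof
    assume soc: "S.socle_nonzero m ?J"
    let ?k = "length xs"
    have "ys = take ?k ys @ ys ! ?k # drop (Suc ?k) ys" using ys(3) by (rule id_take_nth_drop)
    then have *: "S.regular_over {\<zero>\<^bsub>S\<^esub>} (take ?k ys)"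
      "S.nonzerodivisor (S.adjoin_list {\<zero>\<^bsub>S\<^esub>} (take ?k ys)) (ys ! ?k)"
      using ys(2,3) by (metis S.regular_over_append, simp add: S.regular_over_nth)
    have "S.socle_nonzero m (S.adjoin_list {\<zero>\<^bsub>S\<^esub>} (take ?k ys))"
      by (rule noeS.socle_transfer[OF mi S.zeroideal _ hxs _ reg *(1) soc])
        (use ys set_take_subset[of ?k ys] in auto)
    then show False using S.socle_no_nonzerodivisor[OF _ _ *(2)] ys nth_mem by blast
  qed
  obtain F where F: "finite F" "F \<subseteq> carrier S" "\<And>b. b \<in> F \<Longrightarrow> b \<notin> ?J \<and> primeideal (S.colon ?J b) S"
    "\<And>x. x \<in> carrier S \<Longrightarrow> (\<And>b. b \<in> F \<Longrightarrow> x \<notin> S.colon ?J b) \<Longrightarrow> S.nonzerodivisor ?J x"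
    by (rule noeS.finite_zerodivisor_primes[OF J]) blast
  have "\<exists>x\<in>n. \<forall>p\<in>(\<lambda>b. {r \<in> carrier R. h r \<in> S.colon ?J b}) ` F. x \<notin> p"
  proof (rule R.prime_avoidance)
    show "ideal n R" using n_prime R.prime_ideal by blast
    show "primeideal p R" if "p \<in> (\<lambda>b. {r \<in> carrier R. h r \<in> S.colon ?J b}) ` F" for p
      using that F(3) prime_vimage by auto
    show "\<not> n \<subseteq> p" if p: "p \<in> (\<lambda>b. {r \<in> carrier R. h r \<in> S.colon ?J b}) ` F" for p
    proof
      assume "n \<subseteq> p"
      then obtain b where b: "b \<in> F" "h ` n \<subseteq> S.colon ?J b" using p by auto
      then have "S.colon ?J b = m" using incomparable F(3) by blast
      then have "S.socle_nonzero m ?J" using b F unfolding S.socle_nonzero_def by blast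
      then show False using nosoc by simp
    qed
  qed (use F in auto)
  then obtain x where x: "x \<in> n" "\<forall>p\<in>(\<lambda>b. {r \<in> carrier R. h r \<in> S.colon ?J b}) ` F. x \<notin> p" ..
  then have "h x \<notin> S.colon ?J b" if "b \<in> F" for b using that n_sub by auto
  then have "S.nonzerodivisor ?J (h x)" using x(1) n_sub by (intro F(4)) auto
  then show ?thesis using x reg by (auto simp: S.regular_over_append)
qed

text \<open>The depth is a supremum that might be infinite, so the claim is made for every finite
  \<open>k\<close> up to it.\<close>

lemma regular_in_source:
  assumes "enat k \<le> depth S m"
  shows "\<exists>xs. length xs = k \<and> set xs \<subseteq> n \<and> S.regular_over {\<zero>\<^bsub>S\<^esub>} (map h xs)"
  using assms
proof (induction k)
  case (Suc k)
  then have "enat k < depth S m" by (meson enat_ord_simps(2) less_le_trans lessI)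
  then obtain ys where ys: "regular_seq S ys" "set ys \<subseteq> m" "k < length ys"
    unfolding depth_def less_Sup_iff by auto
  obtain xs where xs: "length xs = k" "set xs \<subseteq> n" "S.regular_over {\<zero>\<^bsub>S\<^esub>} (map h xs)"
    using Suc.IH[OF less_imp_le[OF \<open>enat k < depth S m\<close>]] by blast
  obtain x where "x \<in> n" "S.regular_over {\<zero>\<^bsub>S\<^esub>} (map h (xs @ [x]))"
    using extend_regular[OF xs(2,3) ys(2)] ys xs by (auto simp: S.regular_seq_iff)
  then show ?case using xs by (intro exI[of _ "xs @ [x]"]) auto
qed auto

lemma adjoin_list_sub_n:
  assumes "set xs \<subseteq> n" shows "R.adjoin_list {\<zero>} xs \<subseteq> n"
proof -
  have "R.adjoin_list {\<zero>} xs = Idl (set xs)"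
    using R.adjoin_list_Idl[of "{}" xs] assms n_sub by (auto simp: R.Idl_empty)
  then show ?thesis using R.genideal_minimal[OF R.prime_ideal[OF n_prime] assms] by simp
qed

lemma depth_ge: "depth S m \<le> depth R n"
proof (rule ccontr)
  assume "\<not> ?thesis"
  then have lt: "depth R n < depth S m" by simp
  then obtain k where k: "depth R n = enat k" by (cases "depth R n") auto
  then have "enat (Suc k) \<le> depth S m" using lt by (simp add: Suc_ile_eq)
  then obtain xs where xs: "length xs = Suc k" "set xs \<subseteq> n" "S.regular_over {\<zero>\<^bsub>S\<^esub>} (map h xs)"
    using regular_in_source by blast
  have "\<one> \<notin> R.adjoin_list {\<zero>} xs" using adjoin_list_sub_n xs(2) R.prime_one_notin[OF n_prime] by blast
  then have "regular_seq R xs"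
    using regular_descends xs n_sub unfolding R.regular_seq_iff by auto
  then have "enat (Suc k) \<le> depth R n"
    unfolding depth_def using xs by (intro Sup_upper) force
  then show False using k by simp
qed

text \<open>This is where equality of depth and dimension in \<open>S\<close> enters. A sequence
  from \<open>n\<close> of that length cuts \<open>S\<close> down to its closed point; purity
  carries this to \<open>R\<close>, where \<open>n\<close> becomes the only prime over the same
  number of generators, and the height theorem bounds the dimension.\<close>

lemma dim_le:
  assumes CM: "depth S m = krull_dim S"
  shows "krull_dim R \<le> depth S m"
proof (cases "depth S m")
  case (enat k)
  then obtain xs where xs: "length xs = k" "set xs \<subseteq> n" "S.regular_over {\<zero>\<^bsub>S\<^esub>} (map h xs)"
    using regular_in_source[of k] by auto
  have xc: "set xs \<subseteq> carrier R" using xs n_sub by auto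
  let ?J = "S.adjoin_list {\<zero>\<^bsub>S\<^esub>} (map h xs)"
  have J: "ideal ?J S" using xc by (intro S.adjoin_list_ideal S.zeroideal) auto
  \<comment> \<open>The sequence yields a chain of length \<open>k\<close> ending at any prime over
    it; if that prime were not \<open>m\<close>, adding \<open>m\<close> on top would exceed the
    dimension.\<close>
  have only: "Q = m" if Q: "primeideal Q S" "?J \<subseteq> Q" for Q
  proof (rule ccontr)
    assume "Q \<noteq> m"
    moreover have "Q \<subseteq> m"
      using S.maximal_unique_contains[OF noethS localS] Q S.prime_one_notin S.prime_ideal by blast
    moreover obtain q where "S.prime_chain (length (map h xs)) q Q"
      using noeS.regular_prime_chain[OF S.zeroideal _ xs(3) Q] xc by auto
    ultimately have "S.prime_chain (Suc k) q m" using xs m_prime by auto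
    then have "enat (Suc k) \<le> krull_dim S" by (rule S.krull_dim_ge)
    moreover have "krull_dim S = enat k" using CM enat by simp
    ultimately show False by simp
  qed
  have min: "r = n" if r: "primeideal r R" "set xs \<subseteq> r" "r \<subseteq> n" for r
  proof (rule ccontr)
    assume "r \<noteq> n"
    then obtain y where y: "y \<in> n" "y \<notin> r" using r by auto
    then have yc: "y \<in> carrier R" using n_sub by auto
    let ?M = "{h y [^]\<^bsub>S\<^esub> (i::nat) | i. True}"
    \<comment> \<open>If no power of \<open>h y\<close> lay in the extended ideal, some prime over
      that ideal would omit \<open>h y\<close>, against \<open>only\<close>. So \<open>y\<close> is
      nilpotent modulo the sequence, first in \<open>S\<close> and then by purity in
      \<open>R\<close>.\<close>
    have "?J \<inter> ?M \<noteq> {}"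
    proof
      assume dis: "?J \<inter> ?M = {}"
      obtain Q where Q: "primeideal Q S" "?J \<subseteq> Q" "Q \<inter> ?M = {}"
      proof (rule noeS.prime_disjoint_mult_set[OF J _ _ _ dis])
        show "\<one>\<^bsub>S\<^esub> \<in> ?M" by (auto intro!: exI[of _ "0::nat"])
        show "a \<otimes>\<^bsub>S\<^esub> b \<in> ?M" if "a \<in> ?M" "b \<in> ?M" for a b
          using that yc S.nat_pow_mult[of "h y"] by auto
      qed (use yc in auto)
      have "h y [^]\<^bsub>S\<^esub> (1::nat) \<in> ?M" by blast
      then have "h y \<notin> Q" using Q(3) yc by auto
      moreover have "h y \<in> m" using local_hom y by auto
      ultimately show False using only[OF Q(1,2)] by simp
    qed
    then obtain i :: nat where "h y [^]\<^bsub>S\<^esub> i \<in> ?J" by auto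
    then have "h (y [^] i) \<in> ?J" using yc by (simp add: hom_nat_pow)
    then have "y [^] i \<in> R.adjoin_list {\<zero>} xs" using yc by (intro pure_adjoin_list xc) auto
    also have "R.adjoin_list {\<zero>} xs = Idl (set xs)"
      using R.adjoin_list_Idl[of "{}" xs] xc by (auto simp: R.Idl_empty)
    also have "\<dots> \<subseteq> r" using r R.prime_ideal by (intro R.genideal_minimal) auto
    finally show False using R.prime_pow[OF r(1) yc] y by auto
  qed
  show ?thesis
  proof (rule R.krull_dim_le)
    fix l p q assume ch: "R.prime_chain l p q"
    \<comment> \<open>The top prime may be replaced by \<open>n\<close>, as the inclusion below it
      stays strict. For \<open>l = 0\<close> the top is also the bottom, and the bound is trivial
      instead.\<close>
    have "R.prime_chain l p n \<or> l = 0"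
    proof (cases l)
      case (Suc l')
      have "q \<subseteq> n"
        using R.maximal_unique_contains[OF noethR localR] R.prime_chain_prime[OF ch] R.prime_one_notin R.prime_ideal
        by blast
      moreover obtain q' where "R.prime_chain l' p q'" "q' \<subset> q" using ch Suc by auto
      ultimately have "R.prime_chain l' p q' \<and> q' \<subset> n" by blast
      then have "R.prime_chain l p n" unfolding Suc R.prime_chain.simps using n_prime by blast
      then show ?thesis by blast
    qed auto
    then consider "R.prime_chain l p n" | "l = 0" by blast
    then show "enat l \<le> depth S m"
    proof cases
      case 1
      then have "l \<le> length xs"
        by (rule noeR.height_le_generators[where S = "{}"]) (use xs min in auto)
      then show ?thesis using xs enat by simp
    qed (simp add: enat_0)
  qed
qed simp

theorem depth_eq_krull_dim:
  assumes "depth S m = krull_dim S"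
  shows "depth R n = krull_dim R"
proof (rule antisym)
  show "depth R n \<le> krull_dim R" by (rule R.depth_le_krull_dim[OF noethR n_maximal])
  show "krull_dim R \<le> depth R n" using dim_le[OF assms] depth_ge by (rule order_trans)
qed

end

subsection \<open>Localization\<close>

locale prime_localization = cring +
  fixes P
  assumes prime: "primeideal P R"
begin

abbreviation denominators ("D") where "D \<equiv> carrier R - P"

definition fraction :: "'a \<Rightarrow> 'a \<Rightarrow> ('a \<times> 'a) set" where
  "fraction a s = loc_rel R P `` {(a, s)}"

abbreviation loc ("L") where "L \<equiv> localization R P"

lemma one_D: "\<one> \<in> D"
  using prime_one_notin[OF prime] by simp

lemma mult_D: "s \<in> D \<Longrightarrow> t \<in> D \<Longrightarrow> s \<otimes> t \<in> D"
  using prime_mult_notin[OF prime] by simp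

lemma loc_rel_iff:
  "((a, s), (b, t)) \<in> loc_rel R P \<longleftrightarrow> a \<in> carrier R \<and> b \<in> carrier R \<and> s \<in> D \<and> t \<in> D \<and>
     (\<exists>u\<in>D. u \<otimes> (a \<otimes> t \<ominus> b \<otimes> s) = \<zero>)"
  by (auto simp: loc_rel_def)

lemma loc_rel_equiv: "equiv (carrier R \<times> D) (loc_rel R P)"
proof (rule equivI)
  show "loc_rel R P \<subseteq> (carrier R \<times> D) \<times> (carrier R \<times> D)" by (auto simp: loc_rel_def)
  show "refl_on (carrier R \<times> D) (loc_rel R P)"
  proof (rule refl_onI)
    fix p assume "p \<in> carrier R \<times> D"
    then show "(p, p) \<in> loc_rel R P"
      using one_D by (cases p) (auto simp: loc_rel_iff a_minus_def r_neg intro!: bexI[of _ \<one>])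
  qed
  show "sym (loc_rel R P)"
  proof (rule symI)
    fix p q assume pq: "(p, q) \<in> loc_rel R P"
    obtain a s b t where [simp]: "p = (a, s)" "q = (b, t)" by (cases p, cases q)
    obtain u where u: "a \<in> carrier R" "b \<in> carrier R" "s \<in> D" "t \<in> D" "u \<in> D" "u \<otimes> (a \<otimes> t \<ominus> b \<otimes> s) = \<zero>"
      using pq by (auto simp: loc_rel_iff)
    have "u \<otimes> (b \<otimes> s \<ominus> a \<otimes> t) = \<ominus> (u \<otimes> (a \<otimes> t \<ominus> b \<otimes> s))"
      using u(1-5) by (simp, algebra)
    then show "(q, p) \<in> loc_rel R P" using u by (auto simp: loc_rel_iff)
  qed
  show "trans (loc_rel R P)"
  proof (rule transI)
    fix p q r assume pq: "(p, q) \<in> loc_rel R P" and qr: "(q, r) \<in> loc_rel R P"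
    obtain a s b t c w where [simp]: "p = (a, s)" "q = (b, t)" "r = (c, w)" by (cases p, cases q, cases r)
    obtain u where u: "a \<in> carrier R" "b \<in> carrier R" "s \<in> D" "t \<in> D" "u \<in> D" "u \<otimes> (a \<otimes> t \<ominus> b \<otimes> s) = \<zero>"
      using pq by (auto simp: loc_rel_iff)
    obtain v where v: "c \<in> carrier R" "w \<in> D" "v \<in> D" "v \<otimes> (b \<otimes> w \<ominus> c \<otimes> t) = \<zero>"
      using qr by (auto simp: loc_rel_iff)
    have c: "s \<in> carrier R" "t \<in> carrier R" "u \<in> carrier R" "w \<in> carrier R" "v \<in> carrier R" using u v by auto
    \<comment> \<open>Combining the two relations, scaled by \<open>w\<close> and \<open>s\<close>,
      leaves the middle denominator \<open>t\<close> as a common factor; it joins the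
      multiplier.\<close>
    have "(u \<otimes> v \<otimes> t) \<otimes> (a \<otimes> w \<ominus> c \<otimes> s) =
        w \<otimes> v \<otimes> (u \<otimes> (a \<otimes> t \<ominus> b \<otimes> s)) \<oplus> s \<otimes> u \<otimes> (v \<otimes> (b \<otimes> w \<ominus> c \<otimes> t))"
      using u(1,2) v(1) c by algebra
    also have "\<dots> = \<zero>" using u(6) v(4) c by simp
    finally show "(p, r) \<in> loc_rel R P"
      using u v mult_D by (auto simp: loc_rel_iff intro!: bexI[of _ "u \<otimes> v \<otimes> t"])
  qed
qed

lemma fraction_eq_iff:
  assumes "a \<in> carrier R" "b \<in> carrier R" "s \<in> D" "t \<in> D"
  shows "fraction a s = fraction b t \<longleftrightarrow> (\<exists>u\<in>D. u \<otimes> (a \<otimes> t \<ominus> b \<otimes> s) = \<zero>)"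
proof -
  have "fraction a s = fraction b t \<longleftrightarrow> ((a, s), (b, t)) \<in> loc_rel R P"
    unfolding fraction_def using eq_equiv_class_iff[OF loc_rel_equiv, of "(a, s)" "(b, t)"] assms by simp
  then show ?thesis using assms by (simp add: loc_rel_iff)
qed

lemma fraction_eqI:
  assumes "a \<in> carrier R" "b \<in> carrier R" "s \<in> D" "t \<in> D" "a \<otimes> t = b \<otimes> s"
  shows "fraction a s = fraction b t"
  using assms one_D by (auto simp: fraction_eq_iff a_minus_def r_neg intro!: bexI[of _ \<one>])

lemma carrier_loc: "carrier L = {fraction a s | a s. a \<in> carrier R \<and> s \<in> D}"
  by (auto simp: localization_def quotient_def fraction_def)

lemma fraction_in_loc [simp, intro]: "a \<in> carrier R \<Longrightarrow> s \<in> D \<Longrightarrow> fraction a s \<in> carrier L"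
  by (auto simp: carrier_loc)

lemma in_locE:
  assumes "x \<in> carrier L"
  obtains a s where "a \<in> carrier R" "s \<in> carrier R" "s \<in> D" "x = fraction a s"
  using assms by (auto simp: carrier_loc)

lemma mem_fraction_iff:
  assumes "a \<in> carrier R" "s \<in> D"
  shows "(b, t) \<in> fraction a s \<longleftrightarrow> b \<in> carrier R \<and> t \<in> D \<and> fraction b t = fraction a s"
proof -
  have "(b, t) \<in> fraction a s \<longleftrightarrow> ((a, s), (b, t)) \<in> loc_rel R P" by (simp add: fraction_def)
  also have "\<dots> \<longleftrightarrow> b \<in> carrier R \<and> t \<in> D \<and> fraction a s = fraction b t"
    using assms fraction_eq_iff[of a b s t] by (auto simp: loc_rel_iff)
  finally show ?thesis by auto
qed

text \<open>The operations of \<open>localization\<close> take the union of the classes of all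
  results. It is enough that these results form a nonempty set and share one class.\<close>

lemma Image_same_class:
  assumes "z \<in> Z" "\<And>b t. (b, t) \<in> Z \<Longrightarrow> fraction b t = E"
  shows "loc_rel R P `` Z = E"
proof -
  have "loc_rel R P `` Z = (\<Union>p\<in>Z. loc_rel R P `` {p})" by blast
  also have "\<dots> = (\<Union>p\<in>Z. E)" using assms(2) by (intro SUP_cong) (auto simp: fraction_def)
  also have "\<dots> = E" using assms(1) by blast
  finally show ?thesis .
qed

lemma fraction_mult:
  assumes ab: "a \<in> carrier R" "b \<in> carrier R" "s \<in> D" "t \<in> D"
  shows "fraction a s \<otimes>\<^bsub>L\<^esub> fraction b t = fraction (a \<otimes> b) (s \<otimes> t)"
proof -
  have "loc_rel R P `` {(x \<otimes> y, p \<otimes> q) | x p y q. (x, p) \<in> fraction a s \<and> (y, q) \<in> fraction b t} = fraction (a \<otimes> b) (s \<otimes> t)"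
  proof (rule Image_same_class)
    show "(a \<otimes> b, s \<otimes> t) \<in> {(x \<otimes> y, p \<otimes> q) | x p y q. (x, p) \<in> fraction a s \<and> (y, q) \<in> fraction b t}"
      using mem_fraction_iff ab by blast
    fix z w assume "(z, w) \<in> {(x \<otimes> y, p \<otimes> q) | x p y q. (x, p) \<in> fraction a s \<and> (y, q) \<in> fraction b t}"
    then obtain x p y q where h: "z = x \<otimes> y" "w = p \<otimes> q" "x \<in> carrier R" "p \<in> D" "y \<in> carrier R" "q \<in> D"
      "fraction x p = fraction a s" "fraction y q = fraction b t" using ab by (auto simp: mem_fraction_iff)
    obtain u where u: "u \<in> D" "u \<otimes> (x \<otimes> s \<ominus> a \<otimes> p) = \<zero>" using h ab by (auto simp: fraction_eq_iff)
    obtain v where v: "v \<in> D" "v \<otimes> (y \<otimes> t \<ominus> b \<otimes> q) = \<zero>" using h ab by (auto simp: fraction_eq_iff)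
    have c: "s \<in> carrier R" "t \<in> carrier R" "u \<in> carrier R" "v \<in> carrier R" "p \<in> carrier R" "q \<in> carrier R"
      using h u v ab by auto
    \<comment> \<open>The two fractions are changed one at a time, and each change is annihilated by
      its own multiplier.\<close>
    have "(u \<otimes> v) \<otimes> ((x \<otimes> y) \<otimes> (s \<otimes> t) \<ominus> (a \<otimes> b) \<otimes> (p \<otimes> q)) =
        v \<otimes> y \<otimes> t \<otimes> (u \<otimes> (x \<otimes> s \<ominus> a \<otimes> p)) \<oplus> u \<otimes> a \<otimes> p \<otimes> (v \<otimes> (y \<otimes> t \<ominus> b \<otimes> q))"
      using h(3,5) ab(1,2) c by algebra
    also have "\<dots> = \<zero>" using u v c h(3,5) ab(1,2) by simp
    finally show "fraction z w = fraction (a \<otimes> b) (s \<otimes> t)"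
      using h(1-6) ab mult_D u v by (auto simp: fraction_eq_iff intro!: bexI[of _ "u \<otimes> v"])
  qed
  then show ?thesis by (simp add: localization_def)
qed

lemma fraction_add:
  assumes ab: "a \<in> carrier R" "b \<in> carrier R" "s \<in> D" "t \<in> D"
  shows "fraction a s \<oplus>\<^bsub>L\<^esub> fraction b t = fraction (a \<otimes> t \<oplus> b \<otimes> s) (s \<otimes> t)"
proof -
  have "loc_rel R P `` {(x \<otimes> q \<oplus> y \<otimes> p, p \<otimes> q) | x p y q. (x, p) \<in> fraction a s \<and> (y, q) \<in> fraction b t}
      = fraction (a \<otimes> t \<oplus> b \<otimes> s) (s \<otimes> t)"
  proof (rule Image_same_class)
    show "(a \<otimes> t \<oplus> b \<otimes> s, s \<otimes> t) \<in>
        {(x \<otimes> q \<oplus> y \<otimes> p, p \<otimes> q) | x p y q. (x, p) \<in> fraction a s \<and> (y, q) \<in> fraction b t}"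
      using mem_fraction_iff ab by blast
    fix z w assume "(z, w) \<in> {(x \<otimes> q \<oplus> y \<otimes> p, p \<otimes> q) | x p y q. (x, p) \<in> fraction a s \<and> (y, q) \<in> fraction b t}"
    then obtain x p y q where h: "z = x \<otimes> q \<oplus> y \<otimes> p" "w = p \<otimes> q" "x \<in> carrier R" "p \<in> D" "y \<in> carrier R" "q \<in> D"
      "fraction x p = fraction a s" "fraction y q = fraction b t" using ab by (auto simp: mem_fraction_iff)
    obtain u where u: "u \<in> D" "u \<otimes> (x \<otimes> s \<ominus> a \<otimes> p) = \<zero>" using h ab by (auto simp: fraction_eq_iff)
    obtain v where v: "v \<in> D" "v \<otimes> (y \<otimes> t \<ominus> b \<otimes> q) = \<zero>" using h ab by (auto simp: fraction_eq_iff)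
    have c: "s \<in> carrier R" "t \<in> carrier R" "u \<in> carrier R" "v \<in> carrier R" "p \<in> carrier R" "q \<in> carrier R"
      using h u v ab by auto
    have "(u \<otimes> v) \<otimes> ((x \<otimes> q \<oplus> y \<otimes> p) \<otimes> (s \<otimes> t) \<ominus> (a \<otimes> t \<oplus> b \<otimes> s) \<otimes> (p \<otimes> q)) =
        v \<otimes> q \<otimes> t \<otimes> (u \<otimes> (x \<otimes> s \<ominus> a \<otimes> p)) \<oplus> u \<otimes> p \<otimes> s \<otimes> (v \<otimes> (y \<otimes> t \<ominus> b \<otimes> q))"
      using h(3,5) ab(1,2) c by algebra
    also have "\<dots> = \<zero>" using u v c h(3,5) ab(1,2) by simp
    finally show "fraction z w = fraction (a \<otimes> t \<oplus> b \<otimes> s) (s \<otimes> t)"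
      using h(1-6) ab mult_D u v by (auto simp: fraction_eq_iff intro!: bexI[of _ "u \<otimes> v"])
  qed
  then show ?thesis by (simp add: localization_def)
qed

lemma loc_one: "\<one>\<^bsub>L\<^esub> = fraction \<one> \<one>" and loc_zero: "\<zero>\<^bsub>L\<^esub> = fraction \<zero> \<one>"
  by (simp_all add: localization_def fraction_def)

lemma loc_cring: "cring L"
proof (rule cringI)
  show "abelian_group L"
  proof (rule abelian_groupI)
    fix x y assume "x \<in> carrier L" "y \<in> carrier L"
    then obtain a s b t where h: "a \<in> carrier R" "s \<in> carrier R" "s \<in> D" "x = fraction a s"
       "b \<in> carrier R" "t \<in> carrier R" "t \<in> D" "y = fraction b t" by (metis in_locE)
    then show "x \<oplus>\<^bsub>L\<^esub> y \<in> carrier L" using mult_D by (simp add: fraction_add)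
    show "x \<oplus>\<^bsub>L\<^esub> y = y \<oplus>\<^bsub>L\<^esub> x"
      using h mult_D by (simp add: fraction_add, intro fraction_eqI) (auto simp: a_comm m_comm)
    fix z assume "z \<in> carrier L"
    then obtain c w where k: "c \<in> carrier R" "w \<in> carrier R" "w \<in> D" "z = fraction c w" by (metis in_locE)
    show "x \<oplus>\<^bsub>L\<^esub> y \<oplus>\<^bsub>L\<^esub> z = x \<oplus>\<^bsub>L\<^esub> (y \<oplus>\<^bsub>L\<^esub> z)"
    proof -
      have "((a \<otimes> t \<oplus> b \<otimes> s) \<otimes> w \<oplus> c \<otimes> (s \<otimes> t)) \<otimes> (s \<otimes> (t \<otimes> w)) =
        (a \<otimes> (t \<otimes> w) \<oplus> (b \<otimes> w \<oplus> c \<otimes> t) \<otimes> s) \<otimes> (s \<otimes> t \<otimes> w)"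
        using h(1,2,5,6) k(1,2) by algebra
      then show ?thesis using h k mult_D by (simp add: fraction_add) (intro fraction_eqI, auto)
    qed
  next
    show "\<zero>\<^bsub>L\<^esub> \<in> carrier L" using one_D by (simp add: loc_zero)
    fix x assume "x \<in> carrier L"
    then obtain a s where h: "a \<in> carrier R" "s \<in> carrier R" "s \<in> D" "x = fraction a s" by (metis in_locE)
    show "\<zero>\<^bsub>L\<^esub> \<oplus>\<^bsub>L\<^esub> x = x" using h one_D by (simp add: fraction_add loc_zero)
    have "(\<ominus> a \<otimes> s \<oplus> a \<otimes> s) \<otimes> \<one> = \<zero> \<otimes> (s \<otimes> s)" using h(1,2) by algebra
    then have "fraction (\<ominus> a) s \<oplus>\<^bsub>L\<^esub> x = \<zero>\<^bsub>L\<^esub>"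
      using h one_D mult_D by (simp add: fraction_add loc_zero) (intro fraction_eqI, auto)
    then show "\<exists>y\<in>carrier L. y \<oplus>\<^bsub>L\<^esub> x = \<zero>\<^bsub>L\<^esub>" using h by (intro bexI[of _ "fraction (\<ominus> a) s"]) auto
  qed
  show "comm_monoid L"
  proof (rule comm_monoidI)
    fix x y assume "x \<in> carrier L" "y \<in> carrier L"
    then obtain a s b t where h: "a \<in> carrier R" "s \<in> carrier R" "s \<in> D" "x = fraction a s"
       "b \<in> carrier R" "t \<in> carrier R" "t \<in> D" "y = fraction b t" by (metis in_locE)
    then show "x \<otimes>\<^bsub>L\<^esub> y \<in> carrier L" using mult_D by (simp add: fraction_mult)
    show "x \<otimes>\<^bsub>L\<^esub> y = y \<otimes>\<^bsub>L\<^esub> x" using h by (simp add: fraction_mult m_comm)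
    fix z assume "z \<in> carrier L"
    then obtain c w where k: "c \<in> carrier R" "w \<in> carrier R" "w \<in> D" "z = fraction c w" by (metis in_locE)
    show "x \<otimes>\<^bsub>L\<^esub> y \<otimes>\<^bsub>L\<^esub> z = x \<otimes>\<^bsub>L\<^esub> (y \<otimes>\<^bsub>L\<^esub> z)"
      using h k mult_D by (simp add: fraction_mult m_assoc)
  next
    show "\<one>\<^bsub>L\<^esub> \<in> carrier L" using one_D by (simp add: loc_one)
    fix x assume "x \<in> carrier L"
    then obtain a s where h: "a \<in> carrier R" "s \<in> carrier R" "s \<in> D" "x = fraction a s" by (metis in_locE)
    then show "\<one>\<^bsub>L\<^esub> \<otimes>\<^bsub>L\<^esub> x = x" using one_D by (simp add: fraction_mult loc_one)
  qed
  fix x y z assume "x \<in> carrier L" "y \<in> carrier L" "z \<in> carrier L"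
  then obtain a s b t c w where h: "a \<in> carrier R" "s \<in> carrier R" "s \<in> D" "x = fraction a s"
       "b \<in> carrier R" "t \<in> carrier R" "t \<in> D" "y = fraction b t"
       "c \<in> carrier R" "w \<in> carrier R" "w \<in> D" "z = fraction c w" by (metis in_locE)
  have "((a \<otimes> t \<oplus> b \<otimes> s) \<otimes> c) \<otimes> ((s \<otimes> w) \<otimes> (t \<otimes> w)) =
      ((a \<otimes> c) \<otimes> (t \<otimes> w) \<oplus> (b \<otimes> c) \<otimes> (s \<otimes> w)) \<otimes> (s \<otimes> t \<otimes> w)"
    using h(1,2,5,6,9,10) by algebra
  then show "(x \<oplus>\<^bsub>L\<^esub> y) \<otimes>\<^bsub>L\<^esub> z = x \<otimes>\<^bsub>L\<^esub> z \<oplus>\<^bsub>L\<^esub> y \<otimes>\<^bsub>L\<^esub> z"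
    using h mult_D by (simp add: fraction_add fraction_mult) (intro fraction_eqI, auto)
qed

sublocale loc: cring L by (rule loc_cring)

lemma fraction_hom: "(\<lambda>a. fraction a \<one>) \<in> ring_hom R L"
  using one_D by (intro ring_hom_memI) (auto simp: fraction_mult fraction_add loc_one)

sublocale fraction_hom: ring_hom_cring R L "\<lambda>a. fraction a \<one>"
  by unfold_locales (rule fraction_hom)

text \<open>Elements of \<open>D\<close> become units, so a change of denominator is multiplication
  by a unit.\<close>

lemma fraction_mem_ideal:
  assumes J: "ideal J L" and as: "a \<in> carrier R" "s \<in> D" "t \<in> D" and mem: "fraction a s \<in> J"
  shows "fraction a t \<in> J"
proof -
  have "fraction s t \<otimes>\<^bsub>L\<^esub> fraction a s = fraction a t"
    using as mult_D by (simp add: fraction_mult) (intro fraction_eqI, auto simp: m_ac)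
  then show ?thesis using ideal.I_l_closed[OF J mem, of "fraction s t"] as by auto
qed

text \<open>An ideal of the localization is generated by the fractions with denominator
  \<open>\<one>\<close> in it, and their numerators form an ideal of \<open>R\<close>.\<close>

lemma noetherian_loc:
  assumes "noetherian_ring R" shows "noetherian_ring L"
proof (rule loc.noetherian_ringI)
  interpret noetherian_ring R by fact
  fix J assume J: "ideal J L"
  have hr: "ring_hom_ring R L (\<lambda>a. fraction a \<one>)" ..
  obtain F where F: "finite F" "F \<subseteq> carrier R" "{a \<in> carrier R. fraction a \<one> \<in> J} = Idl F"
    using finetely_gen[OF ring_hom_ring.ideal_vimage[OF hr J]] by auto
  let ?G = "(\<lambda>a. fraction a \<one>) ` F"
  have G: "?G \<subseteq> carrier L" using F one_D by auto
  note Gid = loc.genideal_ideal[OF G]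
  have "Idl F \<subseteq> {a \<in> carrier R. fraction a \<one> \<in> Idl\<^bsub>L\<^esub> ?G}"
    using F(2) loc.genideal_self[OF G]
    by (intro genideal_minimal ring_hom_ring.ideal_vimage[OF hr Gid]) auto
  then have sub: "fraction a \<one> \<in> Idl\<^bsub>L\<^esub> ?G" if "a \<in> carrier R" "fraction a \<one> \<in> J" for a using F(3) that by blast
  have "J = Idl\<^bsub>L\<^esub> ?G"
  proof
    show "J \<subseteq> Idl\<^bsub>L\<^esub> ?G"
    proof
      fix x assume x: "x \<in> J"
      then obtain a s where h: "a \<in> carrier R" "s \<in> D" "x = fraction a s"
        using in_locE loc.ideal_sub_carrier[OF J] by (metis subsetD)
      then have "fraction a \<one> \<in> J" using fraction_mem_ideal[OF J h(1,2) one_D] x by simp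
      then show "x \<in> Idl\<^bsub>L\<^esub> ?G" using fraction_mem_ideal[OF Gid h(1) one_D h(2)] sub h by simp
    qed
    show "Idl\<^bsub>L\<^esub> ?G \<subseteq> J"
    proof (rule loc.genideal_minimal[OF J])
      have "F \<subseteq> {a \<in> carrier R. fraction a \<one> \<in> J}" using genideal_self[OF F(2)] F(3) by simp
      then show "?G \<subseteq> J" by blast
    qed
  qed
  then show "\<exists>A\<subseteq>carrier L. finite A \<and> J = Idl\<^bsub>L\<^esub> A" using F(1) G by blast
qed

definition max_loc :: "('a \<times> 'a) set set" where
  "max_loc = {fraction a s | a s. a \<in> P \<and> s \<in> D}"

lemma P_carrier: "a \<in> P \<Longrightarrow> a \<in> carrier R"
  using prime_ideal[OF prime] ideal.Icarr by metis

lemma fraction_mem_max: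
  assumes "a \<in> carrier R" "s \<in> D" shows "fraction a s \<in> max_loc \<longleftrightarrow> a \<in> P"
proof
  assume "fraction a s \<in> max_loc"
  then obtain b t where h: "b \<in> P" "t \<in> D" "fraction a s = fraction b t" by (auto simp: max_loc_def)
  then obtain u where u: "u \<in> D" "u \<otimes> (a \<otimes> t \<ominus> b \<otimes> s) = \<zero>" using assms P_carrier by (auto simp: fraction_eq_iff)
  interpret P: ideal P R using prime by (rule prime_ideal)
  have bc: "b \<in> carrier R" "t \<in> carrier R" "s \<in> carrier R" "u \<in> carrier R" using h u assms by (auto simp: P_carrier)
  have "u \<otimes> t \<otimes> a = u \<otimes> (a \<otimes> t \<ominus> b \<otimes> s) \<oplus> (u \<otimes> s) \<otimes> b"
    using bc assms(1) by algebra
  also have "\<dots> = (u \<otimes> s) \<otimes> b" using u bc by simp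
  also have "\<dots> \<in> P" using h bc by (intro P.I_l_closed) auto
  finally have "u \<otimes> t \<otimes> a \<in> P" .
  then show "a \<in> P" using primeideal.I_prime[OF prime, of "u \<otimes> t" a] mult_D[OF u(1) h(2)] assms by auto
qed (use assms in \<open>auto simp: max_loc_def\<close>)

lemma max_loc_ideal: "ideal max_loc L"
proof (rule loc.ideal_of_closed)
  interpret P: ideal P R using prime by (rule prime_ideal)
  show "max_loc \<subseteq> carrier L" by (auto simp: max_loc_def P_carrier)
  show "\<zero>\<^bsub>L\<^esub> \<in> max_loc" unfolding loc_zero fraction_mem_max[OF zero_closed one_D] by (rule P.zero_closed)
  show "x \<oplus>\<^bsub>L\<^esub> y \<in> max_loc" if xy: "x \<in> max_loc" "y \<in> max_loc" for x y
  proof -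
    obtain a s b t where h: "a \<in> P" "s \<in> D" "x = fraction a s" "b \<in> P" "t \<in> D" "y = fraction b t"
      using xy by (auto simp: max_loc_def)
    have "a \<otimes> t \<oplus> b \<otimes> s \<in> P" using h by (intro P.a_closed P.I_r_closed) auto
    then show ?thesis using h mult_D by (simp add: fraction_add fraction_mem_max P_carrier)
  qed
  show "r \<otimes>\<^bsub>L\<^esub> x \<in> max_loc" if rx: "r \<in> carrier L" "x \<in> max_loc" for r x
  proof -
    obtain a s b t where "a \<in> carrier R" "s \<in> D" "r = fraction a s" "b \<in> P" "t \<in> D" "x = fraction b t"
      using rx by (auto simp: max_loc_def carrier_loc)
    then show ?thesis using mult_D by (simp add: fraction_mult fraction_mem_max P_carrier P.I_l_closed)
  qed
qed

lemma ideal_sub_max_loc: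
  assumes J: "ideal J L" "J \<noteq> carrier L" shows "J \<subseteq> max_loc"
proof
  fix x assume x: "x \<in> J"
  then obtain a s where h: "a \<in> carrier R" "s \<in> D" "x = fraction a s"
    using in_locE loc.ideal_sub_carrier[OF J(1)] by (metis subsetD)
  have "a \<in> P"
  proof (rule ccontr)
    assume "a \<notin> P"
    then have "fraction a a \<in> J" using fraction_mem_ideal[OF J(1) h(1,2)] h x by auto
    moreover have "fraction a a = \<one>\<^bsub>L\<^esub>" unfolding loc_one using \<open>a \<notin> P\<close> h one_D by (intro fraction_eqI) auto
    ultimately show False using ideal.one_imp_carrier[OF J(1)] J(2) by simp
  qed
  then show "x \<in> max_loc" using h fraction_mem_max by simp
qed

lemma maximal_loc: "{I. maximalideal I L} = {max_loc}"
proof -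
  have ne: "max_loc \<noteq> carrier L"
    using one_D prime_one_notin[OF prime] fraction_mem_max[of \<one> \<one>] fraction_in_loc[of \<one> \<one>] by auto
  have 1: "maximalideal max_loc L"
    by (rule maximalidealI[OF max_loc_ideal]) (use ne ideal_sub_max_loc in blast)+
  have 2: "I = max_loc" if I: "maximalideal I L" for I
  proof -
    interpret I: maximalideal I L by fact
    have "I \<subseteq> max_loc" using ideal_sub_max_loc[OF I.ideal_axioms] I.I_notcarr by auto
    then show ?thesis
      using I.I_maximal[OF max_loc_ideal] ne loc.ideal_sub_carrier[OF max_loc_ideal] by auto
  qed
  show ?thesis
  proof (intro equalityI subsetI)
    show "I \<in> {max_loc}" if "I \<in> {I. maximalideal I L}" for I using 2 that by simp
    show "I \<in> {I. maximalideal I L}" if "I \<in> {max_loc}" for I using 1 that by simp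
  qed
qed

end

subsection \<open>Reynolds operators\<close>

context ring_hom_cring
begin

inductive_set hspan :: "'c set \<Rightarrow> 'c set" for V where
  zero: "\<zero>\<^bsub>S\<^esub> \<in> hspan V"
| step: "\<lbrakk>c \<in> carrier R; x \<in> V; m \<in> hspan V\<rbrakk> \<Longrightarrow> h c \<otimes>\<^bsub>S\<^esub> x \<oplus>\<^bsub>S\<^esub> m \<in> hspan V"

definition integral_element :: "'c \<Rightarrow> bool" where
  "integral_element u \<longleftrightarrow> u \<in> carrier S \<and> (\<exists>k::nat. u [^]\<^bsub>S\<^esub> k \<in> hspan ((\<lambda>i. u [^]\<^bsub>S\<^esub> i) ` {..<k}))"

lemma hspan_closed:
  assumes "V \<subseteq> carrier S" "m \<in> hspan V" shows "m \<in> carrier S"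
  using assms(2) by induction (use assms(1) in auto)

text \<open>Horner's rule: the constant term is split off and \<open>u\<close> is factored out of
  the rest.\<close>

lemma hspan_powers_Suc:
  assumes u: "u \<in> carrier S" and m: "m \<in> hspan ((\<lambda>i. u [^]\<^bsub>S\<^esub> i) ` {..<Suc k})"
  shows "\<exists>c\<in>carrier R. \<exists>m'\<in>hspan ((\<lambda>i. u [^]\<^bsub>S\<^esub> i) ` {..<k}). m = h c \<oplus>\<^bsub>S\<^esub> u \<otimes>\<^bsub>S\<^esub> m'"
  using m
proof induction
  case zero
  have "\<zero>\<^bsub>S\<^esub> = h \<zero> \<oplus>\<^bsub>S\<^esub> u \<otimes>\<^bsub>S\<^esub> \<zero>\<^bsub>S\<^esub>" using u by simp
  then show ?case using hspan.zero R.zero_closed by blast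
next
  case (step c x m)
  then obtain d m' where h: "d \<in> carrier R" "m' \<in> hspan ((\<lambda>i. u [^]\<^bsub>S\<^esub> i) ` {..<k})"
    "m = h d \<oplus>\<^bsub>S\<^esub> u \<otimes>\<^bsub>S\<^esub> m'" by blast
  have m'c: "m' \<in> carrier S" using hspan_closed[OF _ h(2)] u by auto
  obtain i where i: "i < Suc k" "x = u [^]\<^bsub>S\<^esub> i" using step by auto
  show ?case
  proof (cases i)
    case 0
    have "h c \<otimes>\<^bsub>S\<^esub> x \<oplus>\<^bsub>S\<^esub> m = h (c \<oplus> d) \<oplus>\<^bsub>S\<^esub> u \<otimes>\<^bsub>S\<^esub> m'"
      using h step u m'c i 0 by (simp add: S.a_assoc)
    then show ?thesis using h step by blast
  next
    case (Suc j)
    have "h c \<otimes>\<^bsub>S\<^esub> (u \<otimes>\<^bsub>S\<^esub> u [^]\<^bsub>S\<^esub> j) \<oplus>\<^bsub>S\<^esub> (h d \<oplus>\<^bsub>S\<^esub> u \<otimes>\<^bsub>S\<^esub> m')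
      = h d \<oplus>\<^bsub>S\<^esub> u \<otimes>\<^bsub>S\<^esub> (h c \<otimes>\<^bsub>S\<^esub> u [^]\<^bsub>S\<^esub> j \<oplus>\<^bsub>S\<^esub> m')"
      using hom_closed[OF h(1)] hom_closed[OF step(1)] u m'c S.nat_pow_closed[OF u, of j] by algebra
    then have "h c \<otimes>\<^bsub>S\<^esub> x \<oplus>\<^bsub>S\<^esub> m = h d \<oplus>\<^bsub>S\<^esub> u \<otimes>\<^bsub>S\<^esub> (h c \<otimes>\<^bsub>S\<^esub> u [^]\<^bsub>S\<^esub> j \<oplus>\<^bsub>S\<^esub> m')"
      using i Suc h(3) u by (simp add: S.m_comm)
    moreover have "h c \<otimes>\<^bsub>S\<^esub> u [^]\<^bsub>S\<^esub> j \<oplus>\<^bsub>S\<^esub> m' \<in> hspan ((\<lambda>i. u [^]\<^bsub>S\<^esub> i) ` {..<k})"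
      using i Suc h step by (intro hspan.step) auto
    ultimately show ?thesis using h(1) by blast
  qed
qed

text \<open>For \<open>u\<close> in \<open>P\<close> outside \<open>Q\<close>, take a monic relation
  of least degree modulo \<open>Q\<close>. Its constant term lies in \<open>P\<close> because
  \<open>u\<close> does, hence in \<open>Q\<close>; then \<open>u\<close> divides the relation and
  can be cancelled modulo the prime \<open>Q\<close>, which lowers the degree.\<close>

lemma integral_incomparable:
  assumes int: "\<And>b. b \<in> carrier S \<Longrightarrow> integral_element b"
    and Q: "primeideal Q S" and P: "primeideal P S" and QP: "Q \<subseteq> P"
    and contr: "\<And>c. c \<in> carrier R \<Longrightarrow> h c \<in> P \<Longrightarrow> h c \<in> Q"
  shows "Q = P"
proof (rule ccontr)
  assume "Q \<noteq> P"
  then obtain u where u: "u \<in> P" "u \<notin> Q" using QP by auto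
  interpret Q: primeideal Q S by fact
  interpret P: primeideal P S by fact
  have uc: "u \<in> carrier S" using u by auto
  define rel where "rel k \<longleftrightarrow> (\<exists>m\<in>hspan ((\<lambda>i. u [^]\<^bsub>S\<^esub> i) ` {..<k}). u [^]\<^bsub>S\<^esub> k \<ominus>\<^bsub>S\<^esub> m \<in> Q)" for k :: nat
  have clos: "m \<in> carrier S" if "m \<in> hspan ((\<lambda>i. u [^]\<^bsub>S\<^esub> i) ` {..<k})" for m and k :: nat
    using hspan_closed[OF _ that] uc by auto
  obtain k :: nat where k: "u [^]\<^bsub>S\<^esub> k \<in> hspan ((\<lambda>i. u [^]\<^bsub>S\<^esub> i) ` {..<k})"
    using int[OF uc] by (auto simp: integral_element_def)
  have "rel k" unfolding rel_def
    by (intro bexI[OF _ k]) (use uc Q.zero_closed in \<open>simp add: S.r_neg a_minus_def\<close>)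
  then have rL: "rel (LEAST k. rel k)" by (rule LeastI)
  show False
  proof (cases "LEAST k. rel k")
    case 0
    then obtain m where m: "m \<in> hspan {}" "\<one>\<^bsub>S\<^esub> \<ominus>\<^bsub>S\<^esub> m \<in> Q" using rL by (auto simp: rel_def)
    from m(1) have "m = \<zero>\<^bsub>S\<^esub>" by cases auto
    then have "\<one>\<^bsub>S\<^esub> \<in> Q" using m by (simp add: a_minus_def)
    then show False using S.prime_one_notin[OF Q] by simp
  next
    case (Suc l)
    then obtain m where m: "m \<in> hspan ((\<lambda>i. u [^]\<^bsub>S\<^esub> i) ` {..<Suc l})" "u [^]\<^bsub>S\<^esub> Suc l \<ominus>\<^bsub>S\<^esub> m \<in> Q"
      using rL by (auto simp: rel_def)
    obtain c m' where c: "c \<in> carrier R" "m' \<in> hspan ((\<lambda>i. u [^]\<^bsub>S\<^esub> i) ` {..<l})" "m = h c \<oplus>\<^bsub>S\<^esub> u \<otimes>\<^bsub>S\<^esub> m'"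
      using hspan_powers_Suc[OF uc m(1)] by blast
    have m'c: "m' \<in> carrier S" by (rule clos[OF c(2)])
    let ?v = "u [^]\<^bsub>S\<^esub> l \<ominus>\<^bsub>S\<^esub> m'"
    have vc: "?v \<in> carrier S" "u [^]\<^bsub>S\<^esub> l \<in> carrier S" using uc m'c by auto
    have eq: "u [^]\<^bsub>S\<^esub> Suc l \<ominus>\<^bsub>S\<^esub> m = u \<otimes>\<^bsub>S\<^esub> ?v \<ominus>\<^bsub>S\<^esub> h c"
      unfolding c(3) S.nat_pow_Suc using uc m'c hom_closed[OF c(1)] vc(2) by algebra
    have uv: "u \<otimes>\<^bsub>S\<^esub> ?v \<in> P" using u(1) vc by (intro P.I_r_closed)
    have "u \<otimes>\<^bsub>S\<^esub> ?v \<ominus>\<^bsub>S\<^esub> h c \<in> P" using m(2) eq QP by auto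
    then have "u \<otimes>\<^bsub>S\<^esub> ?v \<ominus>\<^bsub>S\<^esub> (u \<otimes>\<^bsub>S\<^esub> ?v \<ominus>\<^bsub>S\<^esub> h c) \<in> P"
      using S.ideal_a_inv[OF P.ideal_axioms uv] by simp
    also have "u \<otimes>\<^bsub>S\<^esub> ?v \<ominus>\<^bsub>S\<^esub> (u \<otimes>\<^bsub>S\<^esub> ?v \<ominus>\<^bsub>S\<^esub> h c) = h c"
      using uc vc(1) hom_closed[OF c(1)] by algebra
    finally have "h c \<in> Q" using contr c by simp
    then have "(u \<otimes>\<^bsub>S\<^esub> ?v \<ominus>\<^bsub>S\<^esub> h c) \<oplus>\<^bsub>S\<^esub> h c \<in> Q" using m(2) eq by (simp add: Q.a_closed)
    also have "(u \<otimes>\<^bsub>S\<^esub> ?v \<ominus>\<^bsub>S\<^esub> h c) \<oplus>\<^bsub>S\<^esub> h c = u \<otimes>\<^bsub>S\<^esub> ?v"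
      using uc vc(1) hom_closed[OF c(1)] by algebra
    finally have "?v \<in> Q" using Q.I_prime[OF uc vc(1)] u by blast
    then have "rel l" unfolding rel_def using c by blast
    then have "(LEAST k. rel k) \<le> l" by (rule Least_le)
    then show False using Suc by simp
  qed
qed

end

section \<open>Linear retractions and contracted ideals\<close>

locale reynolds = ring_hom_cring A B h for A (structure) and B (structure) and h +
  fixes \<rho>
  assumes \<rho>_closed [simp, intro]: "b \<in> carrier B \<Longrightarrow> \<rho> b \<in> carrier A"
    and \<rho>_add: "\<lbrakk>b \<in> carrier B; c \<in> carrier B\<rbrakk> \<Longrightarrow> \<rho> (b \<oplus>\<^bsub>B\<^esub> c) = \<rho> b \<oplus> \<rho> c"
    and \<rho>_mult: "\<lbrakk>a \<in> carrier A; b \<in> carrier B\<rbrakk> \<Longrightarrow> \<rho> (h a \<otimes>\<^bsub>B\<^esub> b) = a \<otimes> \<rho> b"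
    and \<rho>_one: "\<rho> \<one>\<^bsub>B\<^esub> = \<one>"
begin

lemma \<rho>_h: "a \<in> carrier A \<Longrightarrow> \<rho> (h a) = a"
  using \<rho>_mult[of a "\<one>\<^bsub>B\<^esub>"] by (simp add: \<rho>_one)

lemma \<rho>_zero: "\<rho> \<zero>\<^bsub>B\<^esub> = \<zero>"
  using \<rho>_h[of \<zero>] by simp

text \<open>The largest ideal of \<open>B\<close> contained in the preimage of \<open>I\<close> under \<open>\<rho>\<close>.\<close>

definition core :: "'a set \<Rightarrow> 'c set" where
  "core I = {b \<in> carrier B. \<forall>c\<in>carrier B. \<rho> (b \<otimes>\<^bsub>B\<^esub> c) \<in> I}"

lemma core_ideal:
  assumes "ideal I A" shows "ideal (core I) B"
proof -
  interpret I: ideal I A by fact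
  show ?thesis
  proof (rule S.ideal_of_closed)
    show "\<zero>\<^bsub>B\<^esub> \<in> core I" using \<rho>_zero I.zero_closed by (simp add: core_def)
    show "x \<oplus>\<^bsub>B\<^esub> y \<in> core I" if "x \<in> core I" "y \<in> core I" for x y
      using that by (simp add: core_def S.l_distr \<rho>_add I.a_closed)
    show "r \<otimes>\<^bsub>B\<^esub> x \<in> core I" if "r \<in> carrier B" "x \<in> core I" for r x
    proof -
      have "\<rho> (r \<otimes>\<^bsub>B\<^esub> x \<otimes>\<^bsub>B\<^esub> c) \<in> I" if c: "c \<in> carrier B" for c
      proof -
        have "r \<otimes>\<^bsub>B\<^esub> x \<otimes>\<^bsub>B\<^esub> c = x \<otimes>\<^bsub>B\<^esub> (r \<otimes>\<^bsub>B\<^esub> c)"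
          using c \<open>r \<in> carrier B\<close> \<open>x \<in> core I\<close> by (simp add: core_def S.m_ac)
        then show ?thesis using c \<open>r \<in> carrier B\<close> \<open>x \<in> core I\<close> by (simp add: core_def)
      qed
      then show ?thesis using that by (simp add: core_def)
    qed
  qed (auto simp: core_def)
qed

lemma h_core: "\<lbrakk>ideal I A; a \<in> I\<rbrakk> \<Longrightarrow> h a \<in> core I"
  using ideal.I_r_closed[of I A a] ideal.Icarr[of I A a] by (auto simp: core_def \<rho>_mult)

lemma core_\<rho>: "b \<in> core I \<Longrightarrow> \<rho> b \<in> I"
  by (auto simp: core_def dest!: bspec[of _ _ "\<one>\<^bsub>B\<^esub>"])

text \<open>Choose finitely many elements of \<open>I\<close> whose extension to \<open>B\<close> is
  as large as possible. Every \<open>a\<close> in \<open>I\<close> then has its image in that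
  extension, and \<open>\<rho>\<close> returns it to the ideal generated in \<open>A\<close>. The
  core is used because, unlike the preimage under \<open>\<rho>\<close> in general, it is an ideal
  of \<open>B\<close>.\<close>

lemma noetherian_source:
  assumes "noetherian_ring B" shows "noetherian_ring A"
proof (rule R.noetherian_ringI)
  interpret nB: noetherian_cring B using assms S.is_cring by (simp add: noetherian_cring_def)
  fix I assume I: "ideal I A"
  let ?C = "{Idl\<^bsub>B\<^esub> (h ` F) | F. finite F \<and> F \<subseteq> I}"
  have Ic: "I \<subseteq> carrier A" using R.ideal_sub_carrier[OF I] .
  have hc: "h ` F \<subseteq> carrier B" if "F \<subseteq> I" for F using that Ic by auto
  obtain M where M: "M \<in> ?C" and max: "\<And>J. J \<in> ?C \<Longrightarrow> M \<subseteq> J \<Longrightarrow> J = M"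
  proof (rule nB.maximal_in_ideals[of ?C])
    show "?C \<noteq> {}" by auto
    show "ideal J B" if "J \<in> ?C" for J using that hc by (auto intro: S.genideal_ideal)
  qed blast
  then obtain F where F: "finite F" "F \<subseteq> I" "M = Idl\<^bsub>B\<^esub> (h ` F)" by auto
  have Fc: "F \<subseteq> carrier A" using F Ic by auto
  have "I \<subseteq> Idl F"
  proof
    fix a assume a: "a \<in> I"
    have c: "insert a F \<subseteq> I" using a F by auto
    have "Idl\<^bsub>B\<^esub> (h ` insert a F) = M"
    proof (rule max)
      show "Idl\<^bsub>B\<^esub> (h ` insert a F) \<in> ?C" using c F by blast
      show "M \<subseteq> Idl\<^bsub>B\<^esub> (h ` insert a F)"
        unfolding F(3) using S.genideal_self[OF hc[OF c]]
        by (intro S.genideal_minimal S.genideal_ideal[OF hc[OF c]]) auto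
    qed
    then have "h a \<in> M" using S.genideal_self[OF hc[OF c]] by auto
    moreover have "M \<subseteq> core (Idl F)"
      unfolding F(3) using R.genideal_self[OF Fc] h_core[OF R.genideal_ideal[OF Fc]]
      by (intro S.genideal_minimal core_ideal R.genideal_ideal Fc) auto
    ultimately show "a \<in> Idl F" using core_\<rho> \<rho>_h a Ic by (metis subsetD)
  qed
  moreover have "Idl F \<subseteq> I" using F by (intro R.genideal_minimal I)
  ultimately show "\<exists>F\<subseteq>carrier A. finite F \<and> I = Idl F" using F Fc by blast
qed

end

locale reynolds_at = reynolds A B h \<rho> for A (structure) and B (structure) and h \<rho> +
  fixes n P
  assumes n_max: "maximalideal n A" and P_max: "maximalideal P B" and core_sub: "core n \<subseteq> P"
    and noeth: "noetherian_ring B"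
    and integral: "\<And>b. b \<in> carrier B \<Longrightarrow> integral_element b"
begin

lemma P_prime: "primeideal P B" and n_prime: "primeideal n A"
  by (rule S.maximal_prime[OF P_max], rule R.maximal_prime[OF n_max])

sublocale LA: prime_localization A n
  by (rule prime_localization.intro[OF R.is_cring prime_localization_axioms.intro[OF n_prime]])

sublocale LB: prime_localization B P
  by (rule prime_localization.intro[OF S.is_cring prime_localization_axioms.intro[OF P_prime]])

text \<open>The image of \<open>n\<close> lies in the core of \<open>n\<close>, hence in
  \<open>P\<close>; the rest is maximality of \<open>n\<close>.\<close>

lemma vimage_P: "{a \<in> carrier A. h a \<in> P} = n"
proof -
  interpret n: maximalideal n A by (rule n_max)
  have "n \<subseteq> {a \<in> carrier A. h a \<in> P}" using h_core[OF n.ideal_axioms] core_sub n.Icarr by auto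
  moreover have "ideal {a \<in> carrier A. h a \<in> P} A"
    by (rule R.prime_ideal[OF prime_vimage[OF P_prime]])
  moreover have "\<one> \<notin> {a \<in> carrier A. h a \<in> P}" using S.prime_one_notin[OF P_prime] by simp
  ultimately show ?thesis using n.I_maximal[of "{a \<in> carrier A. h a \<in> P}"] by blast
qed

lemma h_mem_P: "a \<in> carrier A \<Longrightarrow> h a \<in> P \<longleftrightarrow> a \<in> n"
  using vimage_P by auto

text \<open>The representative is arbitrary; \<open>loc_hom_fraction\<close> shows that the value
  does not depend on it.\<close>

definition loc_hom :: "('a \<times> 'a) set \<Rightarrow> ('c \<times> 'c) set" where
  "loc_hom V = (let p = SOME p. p \<in> V in LB.fraction (h (fst p)) (h (snd p)))"

lemma loc_hom_fraction:
  assumes a: "a \<in> carrier A" "s \<in> carrier A - n"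
  shows "loc_hom (LA.fraction a s) = LB.fraction (h a) (h s)"
proof -
  define p where "p = (SOME p. p \<in> LA.fraction a s)"
  have "(a, s) \<in> LA.fraction a s" using a by (simp add: LA.mem_fraction_iff)
  then have "p \<in> LA.fraction a s" unfolding p_def by (rule someI)
  then obtain b t where p: "p = (b, t)" "b \<in> carrier A" "t \<in> carrier A - n" "LA.fraction b t = LA.fraction a s"
    using LA.mem_fraction_iff[OF a] by (cases p) auto
  obtain u where u: "u \<in> carrier A - n" "u \<otimes> (b \<otimes> s \<ominus> a \<otimes> t) = \<zero>"
    using LA.fraction_eq_iff[OF p(2) a(1) p(3) a(2)] p(4) by auto
  have "h u \<otimes>\<^bsub>B\<^esub> (h b \<otimes>\<^bsub>B\<^esub> h s \<ominus>\<^bsub>B\<^esub> h a \<otimes>\<^bsub>B\<^esub> h t) = h (u \<otimes> (b \<otimes> s \<ominus> a \<otimes> t))"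
    using u(1) p(2,3) a by (simp add: a_minus_def)
  also have "\<dots> = \<zero>\<^bsub>B\<^esub>" using u(2) by simp
  finally have "LB.fraction (h b) (h t) = LB.fraction (h a) (h s)"
    using a p u(1) h_mem_P by (auto simp: LB.fraction_eq_iff intro!: bexI[of _ "h u"])
  then show ?thesis using p(1) by (simp add: loc_hom_def p_def Let_def)
qed

lemma h_D: "s \<in> carrier A - n \<Longrightarrow> h s \<in> carrier B - P"
  using h_mem_P by auto

lemma loc_hom: "loc_hom \<in> ring_hom LA.loc LB.loc"
proof (rule ring_hom_memI)
  fix x assume "x \<in> carrier LA.loc"
  then obtain a s where x: "a \<in> carrier A" "s \<in> carrier A - n" "x = LA.fraction a s" by (metis LA.in_locE)
  then show "loc_hom x \<in> carrier LB.loc" using h_D by (simp add: loc_hom_fraction)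
  fix y assume "y \<in> carrier LA.loc"
  then obtain b t where y: "b \<in> carrier A" "t \<in> carrier A - n" "y = LA.fraction b t" by (metis LA.in_locE)
  note D = h_D[OF x(2)] h_D[OF y(2)] LA.mult_D[OF x(2) y(2)]
  show "loc_hom (x \<otimes>\<^bsub>LA.loc\<^esub> y) = loc_hom x \<otimes>\<^bsub>LB.loc\<^esub> loc_hom y"
    using x y D by (simp add: LA.fraction_mult LB.fraction_mult loc_hom_fraction)
  show "loc_hom (x \<oplus>\<^bsub>LA.loc\<^esub> y) = loc_hom x \<oplus>\<^bsub>LB.loc\<^esub> loc_hom y"
    using x y D by (simp add: LA.fraction_add LB.fraction_add loc_hom_fraction)
next
  show "loc_hom \<one>\<^bsub>LA.loc\<^esub> = \<one>\<^bsub>LB.loc\<^esub>"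
    unfolding LA.loc_one LB.loc_one loc_hom_fraction[OF R.one_closed LA.one_D] by simp
qed

text \<open>Since \<open>\<rho>\<close> need not descend to fractions over \<open>B\<close>, the
  extended ideal is enclosed in the ideal \<open>J\<close> of fractions with numerator in the core
  of \<open>I0\<close>. If the image of \<open>x = a/s\<close> lies in \<open>J\<close>, some
  denominator multiplies \<open>h a\<close> into that core, and \<open>\<rho>\<close> turns this
  denominator into one over \<open>A\<close>.\<close>

lemma loc_hom_pure:
  assumes I: "ideal I LA.loc" and x: "x \<in> carrier LA.loc" "loc_hom x \<in> Idl\<^bsub>LB.loc\<^esub> (loc_hom ` I)"
  shows "x \<in> I"
proof -
  have hr: "ring_hom_ring A LA.loc (\<lambda>a. LA.fraction a \<one>)" ..
  define I0 where "I0 = {a \<in> carrier A. LA.fraction a \<one> \<in> I}"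
  have I0: "ideal I0 A" unfolding I0_def by (rule ring_hom_ring.ideal_vimage[OF hr I])
  interpret I0: ideal I0 A by (rule I0)
  interpret co: ideal "core I0" B by (rule core_ideal[OF I0])
  define J where "J = {LB.fraction b s | b s. b \<in> core I0 \<and> s \<in> carrier B - P}"
  have "ideal J LB.loc"
  proof (rule LB.loc.ideal_of_closed)
    show "J \<subseteq> carrier LB.loc" by (auto simp: J_def)
    show "\<zero>\<^bsub>LB.loc\<^esub> \<in> J" unfolding LB.loc_zero J_def using LB.one_D co.zero_closed by blast
    fix y z assume yz: "z \<in> J"
    then obtain c t where z: "c \<in> core I0" "t \<in> carrier B - P" "z = LB.fraction c t" by (auto simp: J_def)
    show "y \<oplus>\<^bsub>LB.loc\<^esub> z \<in> J" if y: "y \<in> J"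
    proof -
      obtain b s where y: "b \<in> core I0" "s \<in> carrier B - P" "y = LB.fraction b s" using y by (auto simp: J_def)
      have "b \<otimes>\<^bsub>B\<^esub> t \<oplus>\<^bsub>B\<^esub> c \<otimes>\<^bsub>B\<^esub> s \<in> core I0" using y z by (intro co.a_closed co.I_r_closed) auto
      then show ?thesis using y z LB.mult_D by (auto simp: J_def LB.fraction_add)
    qed
    show "y \<otimes>\<^bsub>LB.loc\<^esub> z \<in> J" if y: "y \<in> carrier LB.loc"
    proof -
      obtain b s where y: "b \<in> carrier B" "s \<in> carrier B - P" "y = LB.fraction b s" using y by (metis LB.in_locE)
      have "b \<otimes>\<^bsub>B\<^esub> c \<in> core I0" using y z by (intro co.I_l_closed) auto
      then show ?thesis using y z LB.mult_D by (auto simp: J_def LB.fraction_mult)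
    qed
  qed
  moreover have "loc_hom ` I \<subseteq> J"
  proof
    fix y assume "y \<in> loc_hom ` I"
    then obtain x where x: "x \<in> I" "y = loc_hom x" by auto
    have "x \<in> carrier LA.loc" by (rule subsetD[OF LA.loc.ideal_sub_carrier[OF I] x(1)])
    then obtain a s where "a \<in> carrier A" "s \<in> carrier A" "s \<in> carrier A - n" "x = LA.fraction a s"
      by (rule LA.in_locE)
    note a = this(1,3,4)
    have "LA.fraction a \<one> \<in> I"
      by (rule LA.fraction_mem_ideal[OF I a(1,2) LA.one_D x(1)[unfolded a(3)]])
    then have "a \<in> I0" using a(1) unfolding I0_def by blast
    then show "y \<in> J"
      unfolding x(2) a(3) loc_hom_fraction[OF a(1,2)] J_def using h_D[OF a(2)] h_core[OF I0] by blast
  qed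
  ultimately have "Idl\<^bsub>LB.loc\<^esub> (loc_hom ` I) \<subseteq> J" by (rule LB.loc.genideal_minimal)
  then have xJ: "loc_hom x \<in> J" using x(2) by blast
  obtain a s where a: "a \<in> carrier A" "s \<in> carrier A - n" "x = LA.fraction a s" using x(1) by (metis LA.in_locE)
  obtain b t where b: "b \<in> core I0" "t \<in> carrier B - P" "LB.fraction (h a) (h s) = LB.fraction b t"
    using xJ a by (auto simp: J_def loc_hom_fraction)
  obtain u where u: "u \<in> carrier B - P" "u \<otimes>\<^bsub>B\<^esub> (h a \<otimes>\<^bsub>B\<^esub> t \<ominus>\<^bsub>B\<^esub> b \<otimes>\<^bsub>B\<^esub> h s) = \<zero>\<^bsub>B\<^esub>"
    using b LB.fraction_eq_iff[OF _ _ h_D[OF a(2)] b(2)] a(1) by auto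
  have c: "h a \<in> carrier B" "h s \<in> carrier B" "t \<in> carrier B" "b \<in> carrier B" "u \<in> carrier B"
    using a b u by auto
  have "h a \<otimes>\<^bsub>B\<^esub> (u \<otimes>\<^bsub>B\<^esub> t) = u \<otimes>\<^bsub>B\<^esub> (h a \<otimes>\<^bsub>B\<^esub> t \<ominus>\<^bsub>B\<^esub> b \<otimes>\<^bsub>B\<^esub> h s) \<oplus>\<^bsub>B\<^esub> (u \<otimes>\<^bsub>B\<^esub> h s) \<otimes>\<^bsub>B\<^esub> b"
    using c by algebra
  also have "\<dots> = (u \<otimes>\<^bsub>B\<^esub> h s) \<otimes>\<^bsub>B\<^esub> b" unfolding u(2) using c by simp
  finally have eq: "h a \<otimes>\<^bsub>B\<^esub> (u \<otimes>\<^bsub>B\<^esub> t) \<in> core I0" using co.I_l_closed[OF b(1)] c by simp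
  have "u \<otimes>\<^bsub>B\<^esub> t \<in> carrier B - P" using LB.mult_D[OF u(1) b(2)] .
  \<comment> \<open>Here the choice of \<open>P\<close> is used: \<open>u\<close> times
    \<open>t\<close> is outside \<open>P\<close>, hence outside the core of
    \<open>n\<close>.\<close>
  then obtain d where d: "d \<in> carrier B" "\<rho> (u \<otimes>\<^bsub>B\<^esub> t \<otimes>\<^bsub>B\<^esub> d) \<notin> n"
    using core_sub unfolding core_def by blast
  let ?r = "\<rho> (u \<otimes>\<^bsub>B\<^esub> t \<otimes>\<^bsub>B\<^esub> d)"
  have rc: "?r \<in> carrier A - n" using d c by auto
  have "a \<otimes> ?r = \<rho> (h a \<otimes>\<^bsub>B\<^esub> (u \<otimes>\<^bsub>B\<^esub> t) \<otimes>\<^bsub>B\<^esub> d)"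
    using a(1) c d by (simp add: S.m_assoc \<rho>_mult)
  also have "\<dots> \<in> I0" using eq d(1) unfolding core_def by blast
  finally have "LA.fraction (a \<otimes> ?r) \<one> \<in> I" unfolding I0_def by blast
  moreover have "s \<otimes> ?r \<in> carrier A - n" using LA.mult_D[OF a(2) rc] .
  ultimately have "LA.fraction (a \<otimes> ?r) (s \<otimes> ?r) \<in> I"
    using LA.fraction_mem_ideal[OF I _ LA.one_D] a(1) rc by auto
  also have "LA.fraction (a \<otimes> ?r) (s \<otimes> ?r) = x"
    unfolding a(3) using a(1,2) rc LA.mult_D[OF a(2) rc] by (intro LA.fraction_eqI) (auto simp: R.m_ac)
  finally show ?thesis .
qed

sublocale pure: pure_local_hom LA.loc LB.loc loc_hom LA.max_loc LB.max_loc
proof (intro pure_local_hom.intro pure_local_hom_axioms.intro ring_hom_cring.intro ring_hom_cring_axioms.intro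
    LA.loc_cring LB.loc_cring)
  show "loc_hom \<in> ring_hom LA.loc LB.loc" by (rule loc_hom)
  show "noetherian_ring LA.loc" by (rule LA.noetherian_loc[OF noetherian_source[OF noeth]])
  show "noetherian_ring LB.loc" by (rule LB.noetherian_loc[OF noeth])
  show "{I. maximalideal I LA.loc} = {LA.max_loc}" by (rule LA.maximal_loc)
  show "{I. maximalideal I LB.loc} = {LB.max_loc}" by (rule LB.maximal_loc)
  show "loc_hom ` LA.max_loc \<subseteq> LB.max_loc"
    using h_D h_mem_P LA.P_carrier
    by (auto simp: LA.max_loc_def loc_hom_fraction LB.fraction_mem_max)
  show "\<And>I a. \<lbrakk>ideal I LA.loc; a \<in> carrier LA.loc; loc_hom a \<in> Idl\<^bsub>LB.loc\<^esub> (loc_hom ` I)\<rbrakk> \<Longrightarrow> a \<in> I"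
    by (rule loc_hom_pure)
  fix Q assume Q: "primeideal Q LB.loc" "loc_hom ` LA.max_loc \<subseteq> Q"
  have Qi: "ideal Q LB.loc" using Q(1) by (rule primeideal.axioms)
  define q where "q = {b \<in> carrier B. LB.fraction b \<one>\<^bsub>B\<^esub> \<in> Q}"
  have q: "primeideal q B" unfolding q_def by (rule LB.fraction_hom.prime_vimage[OF Q(1)])
  have Qsub: "Q \<subseteq> LB.max_loc"
    using LB.ideal_sub_max_loc[OF Qi] primeideal.I_notcarr[OF Q(1)] by auto
  then have qP: "q \<subseteq> P" using LB.one_D by (auto simp: q_def LB.fraction_mem_max)
  \<comment> \<open>Both primes contain the image of \<open>n\<close>, and \<open>P\<close>
    contracts exactly to \<open>n\<close>; so the inclusion of \<open>q\<close> in \<open>P\<close>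
    is an equality by integrality.\<close>
  have "q = P"
  proof (rule integral_incomparable[OF integral q P_prime qP])
    fix c assume c: "c \<in> carrier A" "h c \<in> P"
    then have "c \<in> n" using h_mem_P by simp
    then have "LA.fraction c \<one> \<in> LA.max_loc" using LA.one_D c by (simp add: LA.fraction_mem_max)
    then have "loc_hom (LA.fraction c \<one>) \<in> Q" using Q(2) by auto
    then show "h c \<in> q" using c LA.one_D by (simp add: q_def loc_hom_fraction)
  qed
  have "LB.max_loc \<subseteq> Q"
  proof
    fix x assume "x \<in> LB.max_loc"
    then obtain b s where b: "b \<in> P" "s \<in> carrier B - P" "x = LB.fraction b s" by (auto simp: LB.max_loc_def)
    then have "LB.fraction b \<one>\<^bsub>B\<^esub> \<in> Q" using \<open>q = P\<close> by (auto simp: q_def)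
    then show "x \<in> Q" using LB.fraction_mem_ideal[OF Qi _ LB.one_D b(2)] b LB.P_carrier by auto
  qed
  then show "Q = LB.max_loc" using Qsub by auto
qed

end

theorem (in reynolds) hochster_eagon:
  assumes CM: "cohen_macaulay B" and int: "\<And>b. b \<in> carrier B \<Longrightarrow> integral_element b"
  shows "cohen_macaulay A"
proof -
  have noeth: "noetherian_ring B" using CM by (simp add: cohen_macaulay_def)
  interpret nB: noetherian_cring B using noeth S.is_cring by (simp add: noetherian_cring_def)
  have "cohen_macaulay_local (localization A n)" if n: "maximalideal n A" for n
  proof -
    have ni: "ideal n A" using n by (rule maximalideal.axioms)
    have "\<one> \<notin> n" by (rule R.prime_one_notin[OF R.maximal_prime[OF n]])
    then have "\<one>\<^bsub>B\<^esub> \<notin> core n" using core_\<rho>[of "\<one>\<^bsub>B\<^esub>" n] \<rho>_one by auto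
    \<comment> \<open>The core of \<open>n\<close> is proper because \<open>\<rho>\<close> preserves
      the unit; any maximal ideal over it will do.\<close>
    then obtain P where P: "maximalideal P B" "core n \<subseteq> P"
      by (rule nB.maximal_containing[OF core_ideal[OF ni]])
    interpret reynolds_at A B h \<rho> n P
      by (intro reynolds_at.intro reynolds_axioms reynolds_at_axioms.intro n P noeth int)
    have "cohen_macaulay_local LB.loc" using CM P(1) by (simp add: cohen_macaulay_def)
    then have "depth LB.loc LB.max_loc = krull_dim LB.loc"
      using LB.maximal_loc by (auto simp: cohen_macaulay_local_def)
    then have "depth LA.loc LA.max_loc = krull_dim LA.loc" by (rule pure.depth_eq_krull_dim)
    then show ?thesis
      unfolding cohen_macaulay_local_def
      using LA.loc_cring LA.noetherian_loc[OF noetherian_source[OF noeth]] LA.maximal_loc by blast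
  qed
  then show ?thesis
    using R.is_cring noetherian_source[OF noeth] by (simp add: cohen_macaulay_def)
qed

subsection \<open>Integral elements\<close>

context ring_hom_cring
begin

lemma hspan_base: "V \<subseteq> carrier S \<Longrightarrow> x \<in> V \<Longrightarrow> x \<in> hspan V"
  using hspan.step[OF R.one_closed _ hspan.zero, of x V] by auto

lemma hspan_mono: "m \<in> hspan V \<Longrightarrow> V \<subseteq> W \<Longrightarrow> m \<in> hspan W"
  by (induction rule: hspan.induct) (auto intro: hspan.intros)

lemma hspan_add:
  assumes V: "V \<subseteq> carrier S" and m: "m \<in> hspan V" and n: "n \<in> hspan V"
  shows "m \<oplus>\<^bsub>S\<^esub> n \<in> hspan V"
  using m
proof induction
  case zero
  then show ?case using n hspan_closed[OF V n] by simp
next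
  case (step c x m)
  have "h c \<otimes>\<^bsub>S\<^esub> x \<oplus>\<^bsub>S\<^esub> m \<oplus>\<^bsub>S\<^esub> n = h c \<otimes>\<^bsub>S\<^esub> x \<oplus>\<^bsub>S\<^esub> (m \<oplus>\<^bsub>S\<^esub> n)"
    using step V hspan_closed[OF V] n by (intro S.a_assoc) auto
  then show ?case using step by (simp add: hspan.step)
qed

lemma hspan_mult:
  assumes V: "V \<subseteq> carrier S" and W: "W \<subseteq> carrier S" and u: "u \<in> carrier S"
    and uV: "\<And>x. x \<in> V \<Longrightarrow> u \<otimes>\<^bsub>S\<^esub> x \<in> hspan W" and m: "m \<in> hspan V"
    and scal: "\<And>c m. c \<in> carrier R \<Longrightarrow> m \<in> hspan W \<Longrightarrow> h c \<otimes>\<^bsub>S\<^esub> m \<in> hspan W"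
  shows "u \<otimes>\<^bsub>S\<^esub> m \<in> hspan W"
  using m
proof induction
  case zero
  then show ?case using u hspan.zero by simp
next
  case (step c x m)
  have c: "x \<in> carrier S" "m \<in> carrier S" "h c \<in> carrier S" using step V hspan_closed[OF V] by auto
  have "u \<otimes>\<^bsub>S\<^esub> (h c \<otimes>\<^bsub>S\<^esub> x \<oplus>\<^bsub>S\<^esub> m) = h c \<otimes>\<^bsub>S\<^esub> (u \<otimes>\<^bsub>S\<^esub> x) \<oplus>\<^bsub>S\<^esub> u \<otimes>\<^bsub>S\<^esub> m"
    using u c by algebra
  also have "\<dots> \<in> hspan W" using step uV scal by (intro hspan_add[OF W]) auto
  finally show ?case .
qed

lemma hspan_smult:
  assumes V: "V \<subseteq> carrier S" and c: "c \<in> carrier R" and m: "m \<in> hspan V"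
  shows "h c \<otimes>\<^bsub>S\<^esub> m \<in> hspan V"
  using m
proof induction
  case zero
  then show ?case using c hspan.zero by simp
next
  case (step d x m)
  have k: "x \<in> carrier S" "m \<in> carrier S" using step V hspan_closed[OF V] by auto
  have eq: "h c \<otimes>\<^bsub>S\<^esub> (h d \<otimes>\<^bsub>S\<^esub> x \<oplus>\<^bsub>S\<^esub> m) = h (c \<otimes> d) \<otimes>\<^bsub>S\<^esub> x \<oplus>\<^bsub>S\<^esub> h c \<otimes>\<^bsub>S\<^esub> m"
    using k c step(1) by (simp add: S.r_distr S.m_assoc)
  show ?case unfolding eq by (rule hspan.step[OF R.m_closed[OF c step(1)] step(2) step.IH])
qed

lemma hspan_mult_closed:
  assumes V: "V \<subseteq> carrier S" and W: "W \<subseteq> carrier S" and u: "u \<in> carrier S"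
    and uV: "\<And>x. x \<in> V \<Longrightarrow> u \<otimes>\<^bsub>S\<^esub> x \<in> hspan W" and m: "m \<in> hspan V"
  shows "u \<otimes>\<^bsub>S\<^esub> m \<in> hspan W"
  using hspan_mult[OF V W u uV m hspan_smult[OF W]] .

lemma hspan_minus:
  assumes V: "V \<subseteq> carrier S" and m: "m \<in> hspan V" and n: "n \<in> hspan V"
  shows "m \<ominus>\<^bsub>S\<^esub> n \<in> hspan V"
proof -
  have "h (\<ominus> \<one>) \<otimes>\<^bsub>S\<^esub> n = \<ominus>\<^bsub>S\<^esub> n" using hspan_closed[OF V n] by (simp add: S.l_minus)
  then show ?thesis
    using hspan_add[OF V m hspan_smult[OF V _ n, of "\<ominus> \<one>"]] by (simp add: a_minus_def)
qed

lemma hspan_subset: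
  assumes W: "W \<subseteq> carrier S" and VW: "V \<subseteq> hspan W" and m: "m \<in> hspan V"
  shows "m \<in> hspan W"
  using m
proof induction
  case zero then show ?case by (rule hspan.zero)
next
  case (step c x m)
  then show ?case using VW by (intro hspan_add[OF W] hspan_smult[OF W]) auto
qed

lemma hspan_insert:
  assumes "insert g V \<subseteq> carrier S" "m \<in> hspan (insert g V)"
  shows "\<exists>c\<in>carrier R. \<exists>w\<in>hspan V. m = h c \<otimes>\<^bsub>S\<^esub> g \<oplus>\<^bsub>S\<^esub> w"
  using assms(2)
proof induction
  case zero
  have "\<zero>\<^bsub>S\<^esub> = h \<zero> \<otimes>\<^bsub>S\<^esub> g \<oplus>\<^bsub>S\<^esub> \<zero>\<^bsub>S\<^esub>" using assms by simp
  then show ?case using hspan.zero R.zero_closed by blast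
next
  case (step c x m)
  then obtain d w where d: "d \<in> carrier R" "w \<in> hspan V" "m = h d \<otimes>\<^bsub>S\<^esub> g \<oplus>\<^bsub>S\<^esub> w" by blast
  have V: "V \<subseteq> carrier S" "g \<in> carrier S" using assms by auto
  have wc: "w \<in> carrier S" using hspan_closed[OF V(1) d(2)] .
  have xc: "x \<in> carrier S" using step assms by auto
  show ?case
  proof (cases "x = g")
    case True
    have "h c \<otimes>\<^bsub>S\<^esub> x \<oplus>\<^bsub>S\<^esub> m = h (c \<oplus> d) \<otimes>\<^bsub>S\<^esub> g \<oplus>\<^bsub>S\<^esub> w"
      using True d V wc step by (simp add: S.l_distr S.a_assoc)
    then show ?thesis using d step by blast
  next
    case False
    have "h c \<otimes>\<^bsub>S\<^esub> x \<oplus>\<^bsub>S\<^esub> (h d \<otimes>\<^bsub>S\<^esub> g \<oplus>\<^bsub>S\<^esub> w) = h d \<otimes>\<^bsub>S\<^esub> g \<oplus>\<^bsub>S\<^esub> (h c \<otimes>\<^bsub>S\<^esub> x \<oplus>\<^bsub>S\<^esub> w)"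
      using hom_closed[OF d(1)] hom_closed[OF step(1)] xc V(2) wc by algebra
    moreover have "h c \<otimes>\<^bsub>S\<^esub> x \<oplus>\<^bsub>S\<^esub> w \<in> hspan V" using False step d by (intro hspan.step) auto
    ultimately show ?thesis using d by blast
  qed
qed

text \<open>The ascending chain condition for a finitely generated module, put in terms of
  sequences. By induction on the generators: the ideal of the coefficients of \<open>g\<close> in
  the \<open>v i\<close> is generated by the first \<open>j\<close> of them, and subtracting from
  each later term a combination of the first \<open>j\<close> terms with the same coefficient leaves
  a sequence in the span of the remaining generators.\<close>

lemma noetherian_span:
  assumes noeth: "noetherian_ring R" and fin: "finite V" and V: "V \<subseteq> carrier S"
    and v: "\<And>i::nat. v i \<in> hspan V"
  shows "\<exists>k. v k \<in> hspan (v ` {..<k})"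
  using fin V v
proof (induction V arbitrary: v)
  case empty
  have "v 0 \<in> hspan (v ` {..<0})" using hspan_mono[OF empty(2)[of 0]] by simp
  then show ?case by blast
next
  case (insert g V)
  interpret nR: noetherian_cring R using noeth R.is_cring by (simp add: noetherian_cring_def)
  have V: "V \<subseteq> carrier S" "g \<in> carrier S" using insert by auto
  have vc: "v i \<in> carrier S" for i using hspan_closed[OF insert(4) insert(5)] .
  have "\<forall>i. \<exists>c w. c \<in> carrier R \<and> w \<in> hspan V \<and> v i = h c \<otimes>\<^bsub>S\<^esub> g \<oplus>\<^bsub>S\<^esub> w"
    using hspan_insert[OF insert(4) insert(5)] by blast
  then obtain c w where cw: "\<And>i. c i \<in> carrier R" "\<And>i. w i \<in> hspan V" "\<And>i. v i = h (c i) \<otimes>\<^bsub>S\<^esub> g \<oplus>\<^bsub>S\<^esub> w i"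
    by metis
  have sub: "c ` N \<subseteq> carrier R" for N using cw by auto
  obtain M where M: "M \<in> {Idl (c ` {..<j}) | j. True}"
    and max: "\<And>J. J \<in> {Idl (c ` {..<j}) | j. True} \<Longrightarrow> M \<subseteq> J \<Longrightarrow> J = M"
    by (rule nR.maximal_in_ideals[of "{Idl (c ` {..<j}) | j. True}"]) (auto intro!: R.genideal_ideal sub)
  then obtain j where j: "M = Idl (c ` {..<j})" by auto
  have cM: "c i \<in> M" for i
  proof -
    have "Idl (c ` {..<j + i + 1}) = M"
    proof (rule max)
      show "M \<subseteq> Idl (c ` {..<j + i + 1})" unfolding j
        using R.genideal_self[OF sub, of "{..<j + i + 1}"]
        by (intro R.genideal_minimal R.genideal_ideal sub) auto
    qed blast
    then show ?thesis using R.genideal_self[OF sub, of "{..<j + i + 1}"] by auto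
  qed
  let ?W = "v ` {..<j}"
  have W: "?W \<subseteq> carrier S" using vc by auto
  \<comment> \<open>The possible coefficients of \<open>g\<close> on elements of the span of the
    first \<open>j\<close> terms. Such a coefficient need not be unique, hence the existential
    form.\<close>
  define I where "I = {d \<in> carrier R. \<exists>m\<in>hspan ?W. \<exists>u\<in>hspan V. m = h d \<otimes>\<^bsub>S\<^esub> g \<oplus>\<^bsub>S\<^esub> u}"
  have "ideal I R"
  proof (rule R.ideal_of_closed)
    show "I \<subseteq> carrier R" by (auto simp: I_def)
    have "\<zero>\<^bsub>S\<^esub> = h \<zero> \<otimes>\<^bsub>S\<^esub> g \<oplus>\<^bsub>S\<^esub> \<zero>\<^bsub>S\<^esub>" using V by simp
    then show "\<zero> \<in> I" unfolding I_def using hspan.zero by blast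
    fix d e assume e: "e \<in> I"
    then obtain m u where m: "e \<in> carrier R" "m \<in> hspan ?W" "u \<in> hspan V" "m = h e \<otimes>\<^bsub>S\<^esub> g \<oplus>\<^bsub>S\<^esub> u" by (auto simp: I_def)
    note mc = hspan_closed[OF W m(2)] hspan_closed[OF V(1) m(3)] hom_closed[OF m(1)]
    show "d \<oplus> e \<in> I" if d: "d \<in> I"
    proof -
      obtain m' u' where m': "d \<in> carrier R" "m' \<in> hspan ?W" "u' \<in> hspan V" "m' = h d \<otimes>\<^bsub>S\<^esub> g \<oplus>\<^bsub>S\<^esub> u'"
        using d by (auto simp: I_def)
      note mc' = hspan_closed[OF W m'(2)] hspan_closed[OF V(1) m'(3)] hom_closed[OF m'(1)]
      have "(h d \<otimes>\<^bsub>S\<^esub> g \<oplus>\<^bsub>S\<^esub> u') \<oplus>\<^bsub>S\<^esub> (h e \<otimes>\<^bsub>S\<^esub> g \<oplus>\<^bsub>S\<^esub> u) = (h d \<oplus>\<^bsub>S\<^esub> h e) \<otimes>\<^bsub>S\<^esub> g \<oplus>\<^bsub>S\<^esub> (u' \<oplus>\<^bsub>S\<^esub> u)"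
        using mc(2,3) mc'(2,3) V(2) by algebra
      then have "m' \<oplus>\<^bsub>S\<^esub> m = h (d \<oplus> e) \<otimes>\<^bsub>S\<^esub> g \<oplus>\<^bsub>S\<^esub> (u' \<oplus>\<^bsub>S\<^esub> u)" using m m' by simp
      then show ?thesis
        using hspan_add[OF W m'(2) m(2)] hspan_add[OF V(1) m'(3) m(3)] m(1) m'(1) by (auto simp: I_def)
    qed
    show "d \<otimes> e \<in> I" if d: "d \<in> carrier R"
    proof -
      have "h d \<otimes>\<^bsub>S\<^esub> (h e \<otimes>\<^bsub>S\<^esub> g \<oplus>\<^bsub>S\<^esub> u) = (h d \<otimes>\<^bsub>S\<^esub> h e) \<otimes>\<^bsub>S\<^esub> g \<oplus>\<^bsub>S\<^esub> h d \<otimes>\<^bsub>S\<^esub> u"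
        using mc(2,3) hom_closed[OF d] V(2) by algebra
      then have "h d \<otimes>\<^bsub>S\<^esub> m = h (d \<otimes> e) \<otimes>\<^bsub>S\<^esub> g \<oplus>\<^bsub>S\<^esub> h d \<otimes>\<^bsub>S\<^esub> u" using m d by simp
      then show ?thesis
        using hspan_smult[OF W d m(2)] hspan_smult[OF V(1) d m(3)] m(1) d by (auto simp: I_def)
    qed
  qed
  moreover have "c ` {..<j} \<subseteq> I"
  proof
    fix d assume "d \<in> c ` {..<j}"
    then obtain i where i: "i < j" "d = c i" by auto
    have "v i \<in> hspan ?W" by (rule hspan_base[OF W]) (use i in auto)
    then show "d \<in> I" unfolding I_def using cw i by blast
  qed
  ultimately have "M \<subseteq> I" unfolding j by (rule R.genideal_minimal)
  then have "\<forall>i. \<exists>m u. m \<in> hspan ?W \<and> u \<in> hspan V \<and> m = h (c i) \<otimes>\<^bsub>S\<^esub> g \<oplus>\<^bsub>S\<^esub> u"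
    using cM unfolding I_def by blast
  then obtain m u where mu: "\<And>i. m i \<in> hspan ?W" "\<And>i. u i \<in> hspan V" "\<And>i. m i = h (c i) \<otimes>\<^bsub>S\<^esub> g \<oplus>\<^bsub>S\<^esub> u i" by metis
  have mc: "m i \<in> carrier S" "u i \<in> carrier S" "w i \<in> carrier S" "h (c i) \<in> carrier S" for i
    using hspan_closed[OF W mu(1)] hspan_closed[OF V(1) mu(2)] hspan_closed[OF V(1) cw(2)] cw(1) by auto
  define v' where "v' i = v (j + i) \<ominus>\<^bsub>S\<^esub> m (j + i)" for i
  have "v' i = w (j + i) \<ominus>\<^bsub>S\<^esub> u (j + i)" for i
    unfolding v'_def cw(3) mu(3) using mc[of "j + i"] V(2) by algebra
  then have "v' i \<in> hspan V" for i using hspan_minus[OF V(1) cw(2) mu(2)] by simp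
  then obtain k where k: "v' k \<in> hspan (v' ` {..<k})" using insert.IH[OF V(1)] by blast
  let ?U = "v ` {..<j + k}"
  have U: "?U \<subseteq> carrier S" using vc by auto
  have mU: "m i \<in> hspan ?U" for i by (rule hspan_mono[OF mu(1)]) auto
  have "v' ` {..<k} \<subseteq> hspan ?U"
  proof
    fix x assume "x \<in> v' ` {..<k}"
    then obtain i where i: "i < k" "x = v' i" by auto
    have "v (j + i) \<in> hspan ?U" by (rule hspan_base[OF U]) (use i in auto)
    then show "x \<in> hspan ?U" unfolding i(2) v'_def using mU by (rule hspan_minus[OF U])
  qed
  then have "v' k \<in> hspan ?U" by (rule hspan_subset[OF U _ k])
  then have "v' k \<oplus>\<^bsub>S\<^esub> m (j + k) \<in> hspan ?U" using mU by (rule hspan_add[OF U])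
  also have "v' k \<oplus>\<^bsub>S\<^esub> m (j + k) = v (j + k)"
    unfolding v'_def using mc(1)[of "j + k"] vc[of "j + k"] by algebra
  finally show ?case by blast
qed

text \<open>The powers of \<open>w\<close> stay in the module spanned by \<open>V\<close>, so by the
  chain condition one of them depends on its predecessors. Noetherianity of \<open>R\<close> takes
  the place of the determinant trick.\<close>

lemma integral_of_finite_module:
  assumes noeth: "noetherian_ring R" and fin: "finite V" and V: "V \<subseteq> carrier S"
    and one: "\<one>\<^bsub>S\<^esub> \<in> hspan V" and w: "w \<in> carrier S" "\<And>x. x \<in> V \<Longrightarrow> w \<otimes>\<^bsub>S\<^esub> x \<in> hspan V"
  shows "integral_element w"
proof -
  have "w [^]\<^bsub>S\<^esub> i \<in> hspan V" for i :: nat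
  proof (induction i)
    case (Suc i)
    have "w \<otimes>\<^bsub>S\<^esub> w [^]\<^bsub>S\<^esub> i \<in> hspan V" by (rule hspan_mult_closed[OF V V w Suc])
    then show ?case using w by (simp add: S.m_comm)
  qed (use one in simp)
  then have "\<exists>k::nat. w [^]\<^bsub>S\<^esub> k \<in> hspan ((\<lambda>i. w [^]\<^bsub>S\<^esub> i) ` {..<k})"
    by (rule noetherian_span[OF noeth fin V])
  then show ?thesis using w by (simp add: integral_element_def)
qed

text \<open>Multiplying a relation by \<open>u\<close> raises its degree. Positive degrees are
  wanted in \<open>integral_add_mult\<close>, where the unit must occur among the products of lower
  powers of \<open>u\<close> and \<open>v\<close>.\<close>

lemma integral_degree_pos:
  assumes "integral_element u"
  obtains k :: nat where "k > 0" "u [^]\<^bsub>S\<^esub> k \<in> hspan ((\<lambda>i. u [^]\<^bsub>S\<^esub> i) ` {..<k})"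
proof -
  obtain k :: nat where u: "u \<in> carrier S" "u [^]\<^bsub>S\<^esub> k \<in> hspan ((\<lambda>i. u [^]\<^bsub>S\<^esub> i) ` {..<k})"
    using assms by (auto simp: integral_element_def)
  have "u \<otimes>\<^bsub>S\<^esub> u [^]\<^bsub>S\<^esub> k \<in> hspan ((\<lambda>i. u [^]\<^bsub>S\<^esub> i) ` {..<Suc k})"
  proof (rule hspan_mult_closed[OF _ _ u(1) _ u(2)])
    fix x assume "x \<in> (\<lambda>i. u [^]\<^bsub>S\<^esub> i) ` {..<k}"
    then obtain i where i: "i < k" "x = u [^]\<^bsub>S\<^esub> i" by auto
    have "u \<otimes>\<^bsub>S\<^esub> x = u [^]\<^bsub>S\<^esub> Suc i" using i u by (simp add: S.m_comm)
    then show "u \<otimes>\<^bsub>S\<^esub> x \<in> hspan ((\<lambda>i. u [^]\<^bsub>S\<^esub> i) ` {..<Suc k})"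
      using i u by (intro hspan_base image_eqI[of _ _ "Suc i"]) auto
  qed (use u in auto)
  then have "u [^]\<^bsub>S\<^esub> Suc k \<in> hspan ((\<lambda>i. u [^]\<^bsub>S\<^esub> i) ` {..<Suc k})" using u by (simp add: S.m_comm)
  then show ?thesis using that[of "Suc k"] by simp
qed

lemma integral_add_mult:
  assumes noeth: "noetherian_ring R" and u: "integral_element u" and v: "integral_element v"
  shows "integral_element (u \<oplus>\<^bsub>S\<^esub> v)" "integral_element (u \<otimes>\<^bsub>S\<^esub> v)"
proof -
  have c: "u \<in> carrier S" "v \<in> carrier S" using u v by (auto simp: integral_element_def)
  obtain k :: nat where k: "k > 0" "u [^]\<^bsub>S\<^esub> k \<in> hspan ((\<lambda>i. u [^]\<^bsub>S\<^esub> i) ` {..<k})" using integral_degree_pos[OF u] .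
  obtain l :: nat where l: "l > 0" "v [^]\<^bsub>S\<^esub> l \<in> hspan ((\<lambda>i. v [^]\<^bsub>S\<^esub> i) ` {..<l})" using integral_degree_pos[OF v] .
  let ?V = "(\<lambda>(i, j). u [^]\<^bsub>S\<^esub> i \<otimes>\<^bsub>S\<^esub> v [^]\<^bsub>S\<^esub> j) ` ({..<k} \<times> {..<l})"
  have V: "?V \<subseteq> carrier S" using c by auto
  have base: "u [^]\<^bsub>S\<^esub> i \<otimes>\<^bsub>S\<^esub> v [^]\<^bsub>S\<^esub> j \<in> hspan ?V" if "i < k" "j < l" for i j
    using that by (intro hspan_base[OF V] image_eqI[of _ _ "(i, j)"]) auto
  have uV: "u \<otimes>\<^bsub>S\<^esub> x \<in> hspan ?V" if "x \<in> ?V" for x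
  proof -
    obtain i j where x: "i < k" "j < l" "x = u [^]\<^bsub>S\<^esub> i \<otimes>\<^bsub>S\<^esub> v [^]\<^bsub>S\<^esub> j" using \<open>x \<in> ?V\<close> by auto
    have eq: "u \<otimes>\<^bsub>S\<^esub> x = u [^]\<^bsub>S\<^esub> Suc i \<otimes>\<^bsub>S\<^esub> v [^]\<^bsub>S\<^esub> j" using x c by (simp add: S.m_ac)
    show ?thesis
    proof (cases "Suc i < k")
      case True then show ?thesis unfolding eq by (rule base[OF _ x(2)])
    next
      case False
      then have "Suc i = k" using x by simp
      moreover have "v [^]\<^bsub>S\<^esub> j \<otimes>\<^bsub>S\<^esub> u [^]\<^bsub>S\<^esub> k \<in> hspan ?V"
        by (rule hspan_mult_closed[OF _ V _ _ k(2)]) (use c base x(2) in \<open>auto simp: S.m_comm\<close>)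
      ultimately show ?thesis using eq c by (simp add: S.m_comm del: S.nat_pow_Suc)
    qed
  qed
  have vV: "v \<otimes>\<^bsub>S\<^esub> x \<in> hspan ?V" if "x \<in> ?V" for x
  proof -
    obtain i j where x: "i < k" "j < l" "x = u [^]\<^bsub>S\<^esub> i \<otimes>\<^bsub>S\<^esub> v [^]\<^bsub>S\<^esub> j" using \<open>x \<in> ?V\<close> by auto
    have eq: "v \<otimes>\<^bsub>S\<^esub> x = u [^]\<^bsub>S\<^esub> i \<otimes>\<^bsub>S\<^esub> v [^]\<^bsub>S\<^esub> Suc j" using x c by (simp add: S.m_ac)
    show ?thesis
    proof (cases "Suc j < l")
      case True then show ?thesis unfolding eq by (rule base[OF x(1)])
    next
      case False
      then have "Suc j = l" using x by simp
      moreover have "u [^]\<^bsub>S\<^esub> i \<otimes>\<^bsub>S\<^esub> v [^]\<^bsub>S\<^esub> l \<in> hspan ?V"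
        by (rule hspan_mult_closed[OF _ V _ _ l(2)]) (use c base x(1) in auto)
      ultimately show ?thesis using eq by simp
    qed
  qed
  have one: "\<one>\<^bsub>S\<^esub> \<in> hspan ?V" using base[of 0 0] k l by simp
  show "integral_element (u \<oplus>\<^bsub>S\<^esub> v)"
  proof (rule integral_of_finite_module[OF noeth _ V one])
    show "(u \<oplus>\<^bsub>S\<^esub> v) \<otimes>\<^bsub>S\<^esub> x \<in> hspan ?V" if x: "x \<in> ?V" for x
      using hspan_add[OF V uV[OF x] vV[OF x]] c x V by (simp add: S.l_distr subsetD)
  qed (use c in auto)
  show "integral_element (u \<otimes>\<^bsub>S\<^esub> v)"
  proof (rule integral_of_finite_module[OF noeth _ V one])
    show "(u \<otimes>\<^bsub>S\<^esub> v) \<otimes>\<^bsub>S\<^esub> x \<in> hspan ?V" if x: "x \<in> ?V" for x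
      using hspan_mult_closed[OF V V c(1) uV vV[OF x]] c subsetD[OF V x] by (simp add: S.m_assoc)
  qed (use c in auto)
qed

lemma integral_hom: "c \<in> carrier R \<Longrightarrow> integral_element (h c)"
  unfolding integral_element_def
  using hspan.step[of c "\<one>\<^bsub>S\<^esub>" "{\<one>\<^bsub>S\<^esub>}" "\<zero>\<^bsub>S\<^esub>"] hspan.zero
  by (intro conjI exI[of _ 1]) (auto simp: lessThan_Suc)

text \<open>A relation of degree \<open>k\<close> for the power is one of degree
  \<open>N * k\<close> for \<open>x\<close>; positivity of \<open>N\<close> keeps the lower
  exponents strictly below.\<close>

lemma integral_root:
  assumes x: "x \<in> carrier S" "N > 0" and int: "integral_element (x [^]\<^bsub>S\<^esub> (N::nat))"
  shows "integral_element x"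
proof -
  obtain k :: nat where k: "(x [^]\<^bsub>S\<^esub> N) [^]\<^bsub>S\<^esub> k \<in> hspan ((\<lambda>i. (x [^]\<^bsub>S\<^esub> N) [^]\<^bsub>S\<^esub> i) ` {..<k})"
    using int by (auto simp: integral_element_def)
  have "(\<lambda>i. (x [^]\<^bsub>S\<^esub> N) [^]\<^bsub>S\<^esub> i) ` {..<k} \<subseteq> (\<lambda>i. x [^]\<^bsub>S\<^esub> i) ` {..<N * k}"
    using x by (auto simp: S.nat_pow_pow)
  then have "(x [^]\<^bsub>S\<^esub> N) [^]\<^bsub>S\<^esub> k \<in> hspan ((\<lambda>i. x [^]\<^bsub>S\<^esub> i) ` {..<N * k})" by (rule hspan_mono[OF k])
  then show ?thesis unfolding integral_element_def using x by (auto simp: S.nat_pow_pow)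
qed

lemma integral_hom_image:
  assumes f: "ring_hom_cring S T f" and u: "integral_element u"
  shows "ring_hom_cring.integral_element R T (f \<circ> h) (f u)"
proof -
  interpret f: ring_hom_cring S T f by fact
  interpret fh: ring_hom_cring R T "f \<circ> h"
    by unfold_locales (rule ring_hom_trans[OF homh f.homh])
  have im: "f m \<in> fh.hspan (f ` V)" if "m \<in> hspan V" "V \<subseteq> carrier S" for m V
    using that(1)
  proof induction
    case zero
    show ?case unfolding f.hom_zero by (rule fh.hspan.zero)
  next
    case (step c x m)
    have eq: "f (h c \<otimes>\<^bsub>S\<^esub> x \<oplus>\<^bsub>S\<^esub> m) = (f \<circ> h) c \<otimes>\<^bsub>T\<^esub> f x \<oplus>\<^bsub>T\<^esub> f m"
      using step that(2) hspan_closed[OF that(2) step(3)] by auto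
    show ?case unfolding eq by (rule fh.hspan.step[OF step(1) imageI[OF step(2)] step.IH])
  qed
  obtain k :: nat where k: "u \<in> carrier S" "u [^]\<^bsub>S\<^esub> k \<in> hspan ((\<lambda>i. u [^]\<^bsub>S\<^esub> i) ` {..<k})"
    using u by (auto simp: integral_element_def)
  have "f (u [^]\<^bsub>S\<^esub> k) \<in> fh.hspan (f ` ((\<lambda>i. u [^]\<^bsub>S\<^esub> i) ` {..<k}))" using k by (intro im) auto
  then show ?thesis unfolding fh.integral_element_def using k(1) by (auto simp: f.hom_pow image_image)
qed

end

section \<open>Elementary symmetric functions and integrality\<close>

context cring
begin

text \<open>The subset \<open>T\<close> records the factors from which \<open>\<ominus> b\<close> is
  taken. In the induction, subsets with and without the new element contribute the two terms of the
  new factor.\<close>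

lemma finprod_minus_expand:
  assumes "finite E" "E \<subseteq> carrier R" "t \<in> carrier R"
  shows "(\<Otimes>b\<in>E. t \<ominus> b) = (\<Oplus>T\<in>Pow E. (\<Otimes>b\<in>T. \<ominus> b) \<otimes> t [^] card (E - T))"
  using assms(1,2)
proof (induction E)
  case empty then show ?case by simp
next
  case (insert x E)
  have Xc: "E \<subseteq> carrier R" "x \<in> carrier R" using insert by auto
  have fT: "finite T" if "T \<in> Pow E" for T using that insert(1) by (auto intro: finite_subset)
  have pc: "(\<Otimes>b\<in>T. \<ominus> b) \<in> carrier R" if "T \<in> Pow E" for T
    using that Xc by (intro finprod_closed) auto
  let ?F = "\<lambda>Y T. (\<Otimes>b\<in>T. \<ominus> b) \<otimes> t [^] card (Y - T)"
  have 1: "(\<Oplus>T\<in>Pow E. ?F (insert x E) T) = (\<Oplus>T\<in>Pow E. t \<otimes> ?F E T)"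
  proof (rule finsum_cong')
    fix T assume T: "T \<in> Pow E"
    have "insert x E - T = insert x (E - T)" using T insert(2) by auto
    then have "card (insert x E - T) = Suc (card (E - T))" using insert(1,2) by simp
    then show "?F (insert x E) T = t \<otimes> ?F E T" using pc[OF T] assms(3) by (simp add: m_ac)
  qed (use pc assms(3) in auto)
  have inj: "inj_on (insert x) (Pow E)" using insert(2) by (auto simp: inj_on_def)
  have "(\<Oplus>T\<in>insert x ` Pow E. ?F (insert x E) T) = (\<Oplus>T\<in>Pow E. ?F (insert x E) (insert x T))"
  proof (rule finsum_reindex[OF _ inj])
    show "?F (insert x E) \<in> insert x ` Pow E \<rightarrow> carrier R"
      using Xc assms(3) by (intro funcsetI m_closed finprod_closed) auto
  qed
  also have "\<dots> = (\<Oplus>T\<in>Pow E. \<ominus> x \<otimes> ?F E T)"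
  proof (rule finsum_cong')
    fix T assume T: "T \<in> Pow E"
    have "x \<notin> T" using T insert(2) by auto
    then have "(\<Otimes>b\<in>insert x T. \<ominus> b) = \<ominus> x \<otimes> (\<Otimes>b\<in>T. \<ominus> b)"
      using fT[OF T] T Xc by (intro finprod_insert) auto
    moreover have "insert x E - insert x T = E - T" using insert(2) by auto
    ultimately show "?F (insert x E) (insert x T) = \<ominus> x \<otimes> ?F E T"
      using pc[OF T] Xc assms(3) by (simp add: m_assoc)
  qed (use pc Xc assms(3) in auto)
  finally have 2: "(\<Oplus>T\<in>insert x ` Pow E. ?F (insert x E) T) = (\<Oplus>T\<in>Pow E. \<ominus> x \<otimes> ?F E T)" .
  have Fc: "?F E \<in> Pow E \<rightarrow> carrier R" using pc assms(3) by auto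
  have fc: "(\<Oplus>T\<in>Pow E. ?F E T) \<in> carrier R" by (rule finsum_closed[OF Fc])
  have "(\<Oplus>T\<in>Pow (insert x E). ?F (insert x E) T) =
      (\<Oplus>T\<in>Pow E. ?F (insert x E) T) \<oplus> (\<Oplus>T\<in>insert x ` Pow E. ?F (insert x E) T)"
    unfolding Pow_insert
  proof (rule finsum_Un_disjoint)
    show "Pow E \<inter> insert x ` Pow E = {}" using insert(2) by auto
    show "?F (insert x E) \<in> Pow E \<rightarrow> carrier R" using pc assms(3) by auto
    show "?F (insert x E) \<in> insert x ` Pow E \<rightarrow> carrier R"
      using Xc assms(3) by (intro funcsetI m_closed finprod_closed) auto
  qed (use insert in auto)
  also have "\<dots> = t \<otimes> (\<Oplus>T\<in>Pow E. ?F E T) \<oplus> \<ominus> x \<otimes> (\<Oplus>T\<in>Pow E. ?F E T)"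
    unfolding 1 2 using insert(1) assms(3) Xc Fc by (simp add: finsum_rdistr)
  also have "\<dots> = (t \<ominus> x) \<otimes> (\<Otimes>b\<in>E. t \<ominus> b)"
  proof -
    have "t \<otimes> F \<oplus> \<ominus> x \<otimes> F = (t \<ominus> x) \<otimes> F" if "F \<in> carrier R" for F
      using that assms(3) Xc(2) by algebra
    then show ?thesis unfolding insert.IH[OF Xc(1)] using fc by blast
  qed
  also have "\<dots> = (\<Otimes>b\<in>insert x E. t \<ominus> b)"
    using insert(1,2) Xc assms(3) by (intro finprod_insert[symmetric]) auto
  finally show ?case by simp
qed

text \<open>The elementary symmetric function of degree \<open>k\<close>, up to the sign
  \<open>(-1)^k\<close> that comes from negating each factor. \<open>E\<close> is a set, so
  coinciding conjugates count once.\<close>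

definition esym :: "'a set \<Rightarrow> nat \<Rightarrow> 'a" where
  "esym E k = (\<Oplus>T\<in>{T \<in> Pow E. card T = k}. \<Otimes>b\<in>T. \<ominus> b)"

lemma esym_closed: "E \<subseteq> carrier R \<Longrightarrow> esym E k \<in> carrier R"
  unfolding esym_def by (intro finsum_closed) (auto intro!: finprod_closed)

text \<open>A ring endomorphism that permutes \<open>E\<close> also permutes its subsets of size
  \<open>k\<close>, hence the summands.\<close>

lemma esym_invariant:
  assumes f: "ring_hom_cring R R f" and E: "finite E" "E \<subseteq> carrier R" "f ` E = E"
  shows "f (esym E k) = esym E k"
proof -
  interpret f: ring_hom_cring R R f by fact
  let ?P = "{T \<in> Pow E. card T = k}"
  have inj: "inj_on f E" using E by (simp add: eq_card_imp_inj_on)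
  have pc: "(\<Otimes>b\<in>T. \<ominus> b) \<in> carrier R" if "T \<in> ?P" for T
    using that E(2) by (intro finprod_closed) auto
  have "f (esym E k) = (\<Oplus>T\<in>?P. f (\<Otimes>b\<in>T. \<ominus> b))"
    unfolding esym_def using pc by (subst f.hom_finsum) (auto simp: comp_def)
  also have "\<dots> = (\<Oplus>T\<in>?P. \<Otimes>b\<in>f ` T. \<ominus> b)"
  proof (rule finsum_cong')
    fix T assume T: "T \<in> ?P"
    have "(\<Otimes>b\<in>f ` T. \<ominus> b) = (\<Otimes>b\<in>T. \<ominus> f b)"
      using T E inj by (intro finprod_reindex) (auto intro: inj_on_subset)
    also have "\<dots> = f (\<Otimes>b\<in>T. \<ominus> b)"
    proof -
      have "f (\<Otimes>b\<in>T. \<ominus> b) = finprod R (f \<circ> (\<lambda>b. \<ominus> b)) T"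
        using T E by (intro f.hom_finprod) auto
      also have "\<dots> = (\<Otimes>b\<in>T. \<ominus> f b)" using T E by (intro finprod_cong') auto
      finally show ?thesis by simp
    qed
    finally show "f (\<Otimes>b\<in>T. \<ominus> b) = (\<Otimes>b\<in>f ` T. \<ominus> b)" by simp
  next
    show "(\<lambda>T. \<Otimes>b\<in>f ` T. \<ominus> b) \<in> ?P \<rightarrow> carrier R" using E(2) by (intro funcsetI finprod_closed) auto
  qed simp
  also have "\<dots> = (\<Oplus>T\<in>(`) f ` ?P. \<Otimes>b\<in>T. \<ominus> b)"
  proof (rule finsum_reindex[symmetric])
    show "(\<lambda>T. \<Otimes>b\<in>T. \<ominus> b) \<in> (`) f ` ?P \<rightarrow> carrier R" using E(2) by (intro funcsetI finprod_closed) auto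
    show "inj_on ((`) f) ?P" by (rule inj_on_subset[OF inj_on_image_Pow[OF inj]]) auto
  qed
  also have "(`) f ` ?P = ?P"
  proof (rule endo_inj_surj)
    show "finite ?P" using E by simp
    show "(`) f ` ?P \<subseteq> ?P"
      using E inj by (auto simp: card_image inj_on_subset)
    show "inj_on ((`) f) ?P" by (rule inj_on_subset[OF inj_on_image_Pow[OF inj]]) auto
  qed
  finally show ?thesis by (simp add: esym_def)
qed

end

text \<open>\<open>u\<close> is a root of the product of the factors \<open>t - b\<close> over
  \<open>E\<close>. In the expansion the empty subset contributes the leading power, and the subsets
  of each positive size contribute a symmetric function times a lower power.\<close>

lemma (in ring_hom_cring) integral_of_esym:
  assumes E: "finite E" "E \<subseteq> carrier S" and sym: "\<And>k. S.esym E k \<in> h ` carrier R" and u: "u \<in> E"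
  shows "integral_element u"
proof -
  have uc: "u \<in> carrier S" using E u by auto
  let ?n = "card E"
  let ?P = "\<lambda>k. {T \<in> Pow E. T \<noteq> {} \<and> card T \<le> k}"
  let ?F = "\<lambda>T. (\<Otimes>\<^bsub>S\<^esub>b\<in>T. \<ominus>\<^bsub>S\<^esub> b) \<otimes>\<^bsub>S\<^esub> u [^]\<^bsub>S\<^esub> card (E - T)"
  let ?V = "(\<lambda>i. u [^]\<^bsub>S\<^esub> i) ` {..<?n}"
  have V: "?V \<subseteq> carrier S" using uc by auto
  have pc: "(\<Otimes>\<^bsub>S\<^esub>b\<in>T. \<ominus>\<^bsub>S\<^esub> b) \<in> carrier S" if "T \<in> Pow E" for T
    using that E by (intro S.finprod_closed) auto
  have Fc: "?F T \<in> carrier S" if "T \<in> Pow E" for T using pc[OF that] uc by simp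
  have card_diff: "card (E - T) = ?n - card T" if "T \<in> Pow E" for T
    using that E by (intro card_Diff_subset) (auto intro: finite_subset)
  have fin: "finite T" if "T \<in> Pow E" for T using that E by (auto intro: finite_subset)
  have "finsum S ?F (?P k) \<in> hspan ?V" for k
  proof (induction k)
    case 0
    have *: "?P 0 = {}" using fin by auto
    show ?case unfolding * by (simp add: hspan.zero)
  next
    case (Suc k)
    let ?Q = "{T \<in> Pow E. card T = Suc k}"
    have eq: "?P (Suc k) = ?P k \<union> ?Q" by (auto simp: le_Suc_eq)
    have "finsum S ?F (?P (Suc k)) = finsum S ?F (?P k) \<oplus>\<^bsub>S\<^esub> finsum S ?F ?Q"
      unfolding eq
    proof (rule S.finsum_Un_disjoint)
      show "finite (?P k)" "finite ?Q" using E by simp_all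
      show "?P k \<inter> ?Q = {}" by auto
      show "?F \<in> ?P k \<rightarrow> carrier S" "?F \<in> ?Q \<rightarrow> carrier S" by (rule funcsetI, rule Fc, simp)+
    qed
    moreover have "finsum S ?F ?Q \<in> hspan ?V"
    \<comment> \<open>For \<open>Suc k\<close> beyond \<open>card E\<close> the layer is empty, and
      the truncated subtraction in the exponent is avoided; otherwise the exponent is strictly below
      \<open>card E\<close>.\<close>
    proof (cases "?Q = {}")
      case True
      show ?thesis unfolding True by (simp add: hspan.zero)
    next
      case False
      then obtain T where T: "T \<subseteq> E" "card T = Suc k" by blast
      have k: "Suc k \<le> ?n" using card_mono[OF E(1) T(1)] T(2) by simp
      have "finsum S ?F ?Q = (\<Oplus>\<^bsub>S\<^esub>T\<in>?Q. (\<Otimes>\<^bsub>S\<^esub>b\<in>T. \<ominus>\<^bsub>S\<^esub> b) \<otimes>\<^bsub>S\<^esub> u [^]\<^bsub>S\<^esub> (?n - Suc k))"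
        using pc uc by (intro S.finsum_cong') (auto simp: card_diff)
      also have "\<dots> = S.esym E (Suc k) \<otimes>\<^bsub>S\<^esub> u [^]\<^bsub>S\<^esub> (?n - Suc k)"
        unfolding S.esym_def using E pc uc by (intro S.finsum_ldistr[symmetric]) auto
      finally obtain c where c: "c \<in> carrier R" "finsum S ?F ?Q = h c \<otimes>\<^bsub>S\<^esub> u [^]\<^bsub>S\<^esub> (?n - Suc k)"
        using sym[of "Suc k"] by auto
      have "u [^]\<^bsub>S\<^esub> (?n - Suc k) \<in> hspan ?V" using k by (intro hspan_base[OF V]) auto
      then show ?thesis unfolding c(2) using c(1) by (intro hspan_smult[OF V])
    qed
    ultimately show ?case using Suc hspan_add[OF V] by simp
  qed
  then have mem: "finsum S ?F (?P ?n) \<in> hspan ?V" .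
  have "Pow E = {{}} \<union> ?P ?n" using E by (auto simp: card_mono)
  then have "finsum S ?F (Pow E) = finsum S ?F ({{}} \<union> ?P ?n)" by (rule arg_cong)
  also have "\<dots> = finsum S ?F {{}} \<oplus>\<^bsub>S\<^esub> finsum S ?F (?P ?n)"
  proof (rule S.finsum_Un_disjoint)
    show "finite {{}}" "finite (?P ?n)" using E by simp_all
    show "{{}} \<inter> ?P ?n = {}" by auto
    show "?F \<in> {{}} \<rightarrow> carrier S" "?F \<in> ?P ?n \<rightarrow> carrier S" by (rule funcsetI, rule Fc, simp)+
  qed
  also have "finsum S ?F {{}} = u [^]\<^bsub>S\<^esub> ?n" using uc by simp
  finally have sum: "finsum S ?F (Pow E) = u [^]\<^bsub>S\<^esub> ?n \<oplus>\<^bsub>S\<^esub> finsum S ?F (?P ?n)" .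
  have "finsum S ?F (Pow E) = (\<Otimes>\<^bsub>S\<^esub>b\<in>E. u \<ominus>\<^bsub>S\<^esub> b)"
    using S.finprod_minus_expand[OF E uc] by simp
  also have "\<dots> = (\<Otimes>\<^bsub>S\<^esub>b\<in>insert u (E - {u}). u \<ominus>\<^bsub>S\<^esub> b)" using u by (simp add: insert_absorb)
  also have "\<dots> = (u \<ominus>\<^bsub>S\<^esub> u) \<otimes>\<^bsub>S\<^esub> (\<Otimes>\<^bsub>S\<^esub>b\<in>E - {u}. u \<ominus>\<^bsub>S\<^esub> b)"
    using E uc by (intro S.finprod_insert) auto
  also have "\<dots> = \<zero>\<^bsub>S\<^esub>"
  proof -
    have "(\<Otimes>\<^bsub>S\<^esub>b\<in>E - {u}. u \<ominus>\<^bsub>S\<^esub> b) \<in> carrier S" using E uc by (intro S.finprod_closed) auto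
    then show ?thesis using uc by (simp add: a_minus_def S.r_neg)
  qed
  finally have z: "u [^]\<^bsub>S\<^esub> ?n \<oplus>\<^bsub>S\<^esub> finsum S ?F (?P ?n) = \<zero>\<^bsub>S\<^esub>" using sum by simp
  have fc: "finsum S ?F (?P ?n) \<in> carrier S" using hspan_closed[OF V mem] .
  have "u [^]\<^bsub>S\<^esub> ?n = (u [^]\<^bsub>S\<^esub> ?n \<oplus>\<^bsub>S\<^esub> finsum S ?F (?P ?n)) \<ominus>\<^bsub>S\<^esub> finsum S ?F (?P ?n)"
  proof -
    have "a = (a \<oplus>\<^bsub>S\<^esub> b) \<ominus>\<^bsub>S\<^esub> b" if "a \<in> carrier S" "b \<in> carrier S" for a b
      using that by algebra
    then show ?thesis using S.nat_pow_closed[OF uc, of ?n] fc by blast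
  qed
  also have "\<dots> = \<zero>\<^bsub>S\<^esub> \<ominus>\<^bsub>S\<^esub> finsum S ?F (?P ?n)" unfolding z ..
  also have "\<dots> \<in> hspan ?V" by (intro hspan_minus[OF V] hspan.zero mem)
  finally show ?thesis unfolding integral_element_def using uc by blast
qed

subsection \<open>Group rings\<close>

locale group_ring = K: cring K + L: comm_group L
  for K :: "('k, 'r) ring_scheme" (structure) and L :: "('l, 'm) monoid_scheme"
begin

abbreviation KL where "KL \<equiv> group_algebra K L"

definition supp :: "('l \<Rightarrow> 'k) \<Rightarrow> 'l set" where
  "supp f = {x \<in> carrier L. f x \<noteq> \<zero>}"

lemma carrier_KL: "f \<in> carrier KL \<longleftrightarrow> f \<in> carrier L \<rightarrow>\<^sub>E carrier K \<and> finite (supp f)"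
  by (simp add: group_algebra_def supp_def)

lemma KL_coeff [simp]: "f \<in> carrier KL \<Longrightarrow> x \<in> carrier L \<Longrightarrow> f x \<in> carrier K"
  by (auto simp: carrier_KL)

lemma supp_finite: "f \<in> carrier KL \<Longrightarrow> finite (supp f)"
  by (simp add: carrier_KL)

lemma supp_sub: "supp f \<subseteq> carrier L"
  by (auto simp: supp_def)

lemma not_supp: "x \<in> carrier L \<Longrightarrow> x \<notin> supp f \<Longrightarrow> f x = \<zero>"
  by (auto simp: supp_def)

lemma KL_ext: "\<lbrakk>f \<in> carrier KL; h \<in> carrier KL; \<And>x. x \<in> carrier L \<Longrightarrow> f x = h x\<rbrakk> \<Longrightarrow> f = h"
  unfolding carrier_KL by (blast intro: PiE_ext)

lemma KL_memI:
  assumes "\<And>x. x \<in> carrier L \<Longrightarrow> f x \<in> carrier K" "finite A"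
    "\<And>x. x \<in> carrier L \<Longrightarrow> x \<notin> A \<Longrightarrow> f x = \<zero>"
  shows "(\<lambda>x\<in>carrier L. f x) \<in> carrier KL"
proof -
  have "supp (\<lambda>x\<in>carrier L. f x) \<subseteq> A" using assms(3) by (auto simp: supp_def)
  then show ?thesis using assms(1,2) by (auto simp: carrier_KL intro: finite_subset)
qed

lemma zero_eval [simp]: "x \<in> carrier L \<Longrightarrow> \<zero>\<^bsub>KL\<^esub> x = \<zero>"
  by (simp add: group_algebra_def)

lemma one_eval: "x \<in> carrier L \<Longrightarrow> \<one>\<^bsub>KL\<^esub> x = (if x = \<one>\<^bsub>L\<^esub> then \<one> else \<zero>)"
  by (simp add: group_algebra_def)

lemma add_eval [simp]: "x \<in> carrier L \<Longrightarrow> (f \<oplus>\<^bsub>KL\<^esub> h) x = f x \<oplus> h x"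
  by (simp add: group_algebra_def)

text \<open>Enlarging the support to any finite set allows products with different left factors to
  be summed over a common index set.\<close>

lemma mult_eval:
  assumes f: "f \<in> carrier KL" and h: "h \<in> carrier KL" and x: "x \<in> carrier L"
    and A: "finite A" "supp f \<subseteq> A" "A \<subseteq> carrier L"
  shows "(f \<otimes>\<^bsub>KL\<^esub> h) x = (\<Oplus>y\<in>A. f y \<otimes> h (inv\<^bsub>L\<^esub> y \<otimes>\<^bsub>L\<^esub> x))"
proof -
  have "(f \<otimes>\<^bsub>KL\<^esub> h) x = (\<Oplus>y\<in>supp f. f y \<otimes> h (inv\<^bsub>L\<^esub> y \<otimes>\<^bsub>L\<^esub> x))"
    using x by (simp add: group_algebra_def supp_def)
  also have "\<dots> = (\<Oplus>y\<in>A. f y \<otimes> h (inv\<^bsub>L\<^esub> y \<otimes>\<^bsub>L\<^esub> x))"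
  proof (rule K.add.finprod_mono_neutral_cong_left[OF A(1,2)])
    show "f y \<otimes> h (inv\<^bsub>L\<^esub> y \<otimes>\<^bsub>L\<^esub> x) = \<zero>" if "y \<in> A - supp f" for y
    proof -
      have y: "y \<in> carrier L" "f y = \<zero>" using that A(3) not_supp by auto
      then have "h (inv\<^bsub>L\<^esub> y \<otimes>\<^bsub>L\<^esub> x) \<in> carrier K" using h x by simp
      then show ?thesis using y by simp
    qed
    show "(\<lambda>y. f y \<otimes> h (inv\<^bsub>L\<^esub> y \<otimes>\<^bsub>L\<^esub> x)) \<in> A \<rightarrow> carrier K" using f h x A(3) by (auto simp: subset_iff)
  qed simp
  finally show ?thesis .
qed

lemma mult_KL:
  assumes f: "f \<in> carrier KL" and h: "h \<in> carrier KL"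
  shows "f \<otimes>\<^bsub>KL\<^esub> h \<in> carrier KL"
proof -
  let ?F = "\<lambda>x. \<Oplus>y\<in>supp f. f y \<otimes> h (inv\<^bsub>L\<^esub> y \<otimes>\<^bsub>L\<^esub> x)"
  let ?A = "(\<lambda>(y, z). y \<otimes>\<^bsub>L\<^esub> z) ` (supp f \<times> supp h)"
  have eq: "f \<otimes>\<^bsub>KL\<^esub> h = (\<lambda>x\<in>carrier L. ?F x)"
    by (simp add: group_algebra_def supp_def)
  have tc: "f y \<otimes> h (inv\<^bsub>L\<^esub> y \<otimes>\<^bsub>L\<^esub> x) \<in> carrier K" if "y \<in> supp f" "x \<in> carrier L" for x y
    using that supp_sub[of f] f h by (simp add: subset_iff)
  show ?thesis unfolding eq
  proof (rule KL_memI)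
    show "?F x \<in> carrier K" if "x \<in> carrier L" for x
      using tc that by (intro K.finsum_closed) auto
    show "finite ?A" using supp_finite f h by auto
    show "?F x = \<zero>" if x: "x \<in> carrier L" "x \<notin> ?A" for x
    proof (rule K.add.finprod_one_eqI)
      fix y assume y: "y \<in> supp f"
      then have yc: "y \<in> carrier L" using supp_sub by auto
      have "inv\<^bsub>L\<^esub> y \<otimes>\<^bsub>L\<^esub> x \<notin> supp h"
      proof
        assume "inv\<^bsub>L\<^esub> y \<otimes>\<^bsub>L\<^esub> x \<in> supp h"
        moreover have "x = y \<otimes>\<^bsub>L\<^esub> (inv\<^bsub>L\<^esub> y \<otimes>\<^bsub>L\<^esub> x)" using yc x by (simp add: L.m_assoc[symmetric])
        ultimately show False using y x(2) by force
      qed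
      then show "f y \<otimes> h (inv\<^bsub>L\<^esub> y \<otimes>\<^bsub>L\<^esub> x) = \<zero>" using not_supp[of "inv\<^bsub>L\<^esub> y \<otimes>\<^bsub>L\<^esub> x" h] yc x f by simp
    qed
  qed
qed

definition mon :: "'k \<Rightarrow> 'l \<Rightarrow> 'l \<Rightarrow> 'k" where
  "mon c x = (\<lambda>z\<in>carrier L. if z = x then c else \<zero>)"

lemma mon_KL [simp]: "c \<in> carrier K \<Longrightarrow> mon c x \<in> carrier KL"
  unfolding mon_def by (rule KL_memI[of _ "{x}"]) auto

lemma one_mon: "\<one>\<^bsub>KL\<^esub> = mon \<one> \<one>\<^bsub>L\<^esub>"
  by (simp add: group_algebra_def mon_def)

lemma mon_mult_eval:
  assumes "c \<in> carrier K" "x \<in> carrier L" "h \<in> carrier KL" "z \<in> carrier L"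
  shows "(mon c x \<otimes>\<^bsub>KL\<^esub> h) z = c \<otimes> h (inv\<^bsub>L\<^esub> x \<otimes>\<^bsub>L\<^esub> z)"
proof -
  have "(mon c x \<otimes>\<^bsub>KL\<^esub> h) z = (\<Oplus>y\<in>{x}. mon c x y \<otimes> h (inv\<^bsub>L\<^esub> y \<otimes>\<^bsub>L\<^esub> z))"
  proof (rule mult_eval)
    show "supp (mon c x) \<subseteq> {x}" by (auto simp: supp_def mon_def)
  qed (use assms in auto)
  then show ?thesis using assms by (simp add: mon_def)
qed

lemma mon_mult:
  assumes "c \<in> carrier K" "d \<in> carrier K" "x \<in> carrier L" "y \<in> carrier L"
  shows "mon c x \<otimes>\<^bsub>KL\<^esub> mon d y = mon (c \<otimes> d) (x \<otimes>\<^bsub>L\<^esub> y)"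
proof (rule KL_ext)
  fix z assume z: "z \<in> carrier L"
  have "inv\<^bsub>L\<^esub> x \<otimes>\<^bsub>L\<^esub> z = y \<longleftrightarrow> z = x \<otimes>\<^bsub>L\<^esub> y"
    using L.inv_solve_left'[of y x z] z assms by blast
  then show "(mon c x \<otimes>\<^bsub>KL\<^esub> mon d y) z = mon (c \<otimes> d) (x \<otimes>\<^bsub>L\<^esub> y) z"
    using assms z by (simp add: mon_mult_eval) (simp add: mon_def)
qed (use assms mult_KL in auto)

lemma zero_KL [simp]: "\<zero>\<^bsub>KL\<^esub> \<in> carrier KL"
proof -
  have "(\<lambda>x\<in>carrier L. \<zero>) \<in> carrier KL" by (rule KL_memI[of _ "{}"]) auto
  then show ?thesis by (simp add: group_algebra_def)
qed

lemma add_KL [simp]: "f \<in> carrier KL \<Longrightarrow> h \<in> carrier KL \<Longrightarrow> f \<oplus>\<^bsub>KL\<^esub> h \<in> carrier KL"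
proof -
  assume fh: "f \<in> carrier KL" "h \<in> carrier KL"
  have "(\<lambda>x\<in>carrier L. f x \<oplus> h x) \<in> carrier KL"
  proof (rule KL_memI[of _ "supp f \<union> supp h"])
    show "f x \<oplus> h x = \<zero>" if "x \<in> carrier L" "x \<notin> supp f \<union> supp h" for x
      using not_supp[of x f] not_supp[of x h] that by simp
  qed (use fh supp_finite in auto)
  then show ?thesis by (simp add: group_algebra_def)
qed

text \<open>Identities additive in an argument need only be checked on monomials. Commutativity,
  associativity and multiplicativity of \<open>push\<close> are reduced in this way to
  \<open>K\<close> and the groups.\<close>

lemma KL_induct [consumes 1, case_names zero add]:
  assumes f: "f \<in> carrier KL" and zero: "Q \<zero>\<^bsub>KL\<^esub>"
    and step: "\<And>c x f. \<lbrakk>c \<in> carrier K; x \<in> carrier L; f \<in> carrier KL; Q f\<rbrakk> \<Longrightarrow> Q (mon c x \<oplus>\<^bsub>KL\<^esub> f)"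
  shows "Q f"
proof -
  have "Q f" if "finite A" "f \<in> carrier KL" "supp f \<subseteq> A" for A f
    using that
  proof (induction A arbitrary: f)
    case empty
    then have "f = \<zero>\<^bsub>KL\<^esub>" using not_supp by (intro KL_ext) auto
    then show ?case using zero by simp
  next
    case (insert a A)
    show ?case
    proof (cases "a \<in> carrier L")
      case False
      then have "supp f \<subseteq> A" using insert.prems supp_sub by auto
      then show ?thesis using insert by blast
    next
      case True
      let ?f = "\<lambda>x\<in>carrier L. if x = a then \<zero> else f x"
      have f': "?f \<in> carrier KL"
      proof (rule KL_memI[of _ "supp f"])
        show "(if x = a then \<zero> else f x) = \<zero>" if "x \<in> carrier L" "x \<notin> supp f" for x
          using not_supp[of x f] that by simp
      qed (use insert.prems supp_finite in auto)
      have "supp ?f \<subseteq> A" using insert.prems by (auto simp: supp_def)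
      then have "Q ?f" using insert.IH f' by blast
      then have "Q (mon (f a) a \<oplus>\<^bsub>KL\<^esub> ?f)" using step True insert.prems f' by simp
      also have "mon (f a) a \<oplus>\<^bsub>KL\<^esub> ?f = f"
      proof (rule KL_ext)
        have "mon (f a) a \<in> carrier KL" using True insert.prems by simp
        then show "mon (f a) a \<oplus>\<^bsub>KL\<^esub> ?f \<in> carrier KL" using f' by (rule add_KL)
      qed (use True insert.prems in \<open>auto simp: mon_def\<close>)
      finally show ?thesis .
    qed
  qed
  then show ?thesis using f supp_finite by blast
qed

lemma KL_abelian_group: "abelian_group KL"
proof (rule abelian_groupI)
  show "f \<oplus>\<^bsub>KL\<^esub> h = h \<oplus>\<^bsub>KL\<^esub> f" if "f \<in> carrier KL" "h \<in> carrier KL" for f h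
    by (rule KL_ext) (use that in \<open>auto simp: K.a_comm\<close>)
  show "f \<oplus>\<^bsub>KL\<^esub> g \<oplus>\<^bsub>KL\<^esub> h = f \<oplus>\<^bsub>KL\<^esub> (g \<oplus>\<^bsub>KL\<^esub> h)"
    if "f \<in> carrier KL" "g \<in> carrier KL" "h \<in> carrier KL" for f g h
    by (rule KL_ext) (use that in \<open>auto simp: K.a_assoc\<close>)
  show "\<zero>\<^bsub>KL\<^esub> \<oplus>\<^bsub>KL\<^esub> f = f" if "f \<in> carrier KL" for f
    by (rule KL_ext) (use that in auto)
  show "\<exists>h\<in>carrier KL. h \<oplus>\<^bsub>KL\<^esub> f = \<zero>\<^bsub>KL\<^esub>" if f: "f \<in> carrier KL" for f
  proof
    show m: "(\<lambda>x\<in>carrier L. \<ominus> f x) \<in> carrier KL"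
    proof (rule KL_memI[of _ "supp f"])
      show "\<ominus> f x = \<zero>" if "x \<in> carrier L" "x \<notin> supp f" for x
        using not_supp[of x f] that by simp
    qed (use f supp_finite in auto)
    show "(\<lambda>x\<in>carrier L. \<ominus> f x) \<oplus>\<^bsub>KL\<^esub> f = \<zero>\<^bsub>KL\<^esub>"
      by (rule KL_ext[OF add_KL[OF m f] zero_KL]) (use f in \<open>auto simp: K.l_neg\<close>)
  qed
qed auto

sublocale KLa: abelian_group KL by (rule KL_abelian_group)

lemma mult_distrib:
  assumes f: "f \<in> carrier KL" and g: "g \<in> carrier KL" and h: "h \<in> carrier KL"
  shows "(f \<oplus>\<^bsub>KL\<^esub> g) \<otimes>\<^bsub>KL\<^esub> h = f \<otimes>\<^bsub>KL\<^esub> h \<oplus>\<^bsub>KL\<^esub> g \<otimes>\<^bsub>KL\<^esub> h" (is ?l)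
    and "h \<otimes>\<^bsub>KL\<^esub> (f \<oplus>\<^bsub>KL\<^esub> g) = h \<otimes>\<^bsub>KL\<^esub> f \<oplus>\<^bsub>KL\<^esub> h \<otimes>\<^bsub>KL\<^esub> g" (is ?r)
proof -
  have fg: "f \<oplus>\<^bsub>KL\<^esub> g \<in> carrier KL" using f g by simp
  let ?A = "supp f \<union> supp g \<union> supp h \<union> supp (f \<oplus>\<^bsub>KL\<^esub> g)"
  have A: "finite ?A" "?A \<subseteq> carrier L" using supp_finite f g h fg supp_sub by auto
  have ev: "(u \<otimes>\<^bsub>KL\<^esub> v) x = (\<Oplus>y\<in>?A. u y \<otimes> v (inv\<^bsub>L\<^esub> y \<otimes>\<^bsub>L\<^esub> x))"
    if "u \<in> carrier KL" "v \<in> carrier KL" "x \<in> carrier L" "supp u \<subseteq> ?A" for u v x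
    using that A by (intro mult_eval)
  have c: "u y \<in> carrier K" "u (inv\<^bsub>L\<^esub> y \<otimes>\<^bsub>L\<^esub> x) \<in> carrier K"
    if "y \<in> ?A" "x \<in> carrier L" "u \<in> carrier KL" for u x y
    using subsetD[OF A(2) that(1)] that by auto
  have tc: "u y \<otimes> v (inv\<^bsub>L\<^esub> y \<otimes>\<^bsub>L\<^esub> x) \<in> carrier K"
    if "y \<in> ?A" "x \<in> carrier L" "u \<in> carrier KL" "v \<in> carrier KL" for u v x y
    using c that by (intro K.m_closed)
  have sum: "(\<Oplus>y\<in>?A. s y) = (\<Oplus>y\<in>?A. t y) \<oplus> (\<Oplus>y\<in>?A. t' y)"
    if "\<And>y. y \<in> ?A \<Longrightarrow> s y = t y \<oplus> t' y" "t \<in> ?A \<rightarrow> carrier K" "t' \<in> ?A \<rightarrow> carrier K" for s t t'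
  proof -
    have "(\<Oplus>y\<in>?A. s y) = (\<Oplus>y\<in>?A. t y \<oplus> t' y)"
      using that by (intro K.finsum_cong') blast+
    then show ?thesis using that by (simp add: K.finsum_addf)
  qed
  show ?l
  proof (rule KL_ext)
    fix x assume x: "x \<in> carrier L"
    have "((f \<oplus>\<^bsub>KL\<^esub> g) \<otimes>\<^bsub>KL\<^esub> h) x = (f \<otimes>\<^bsub>KL\<^esub> h) x \<oplus> (g \<otimes>\<^bsub>KL\<^esub> h) x"
      unfolding ev[OF fg h x Un_upper2] ev[OF f h x le_supI1[OF le_supI1[OF Un_upper1]]]
        ev[OF g h x le_supI1[OF le_supI1[OF Un_upper2]]]
    proof (rule sum)
      fix y assume y: "y \<in> ?A"
      then have "y \<in> carrier L" using A(2) by blast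
      then show "(f \<oplus>\<^bsub>KL\<^esub> g) y \<otimes> h (inv\<^bsub>L\<^esub> y \<otimes>\<^bsub>L\<^esub> x) =
          f y \<otimes> h (inv\<^bsub>L\<^esub> y \<otimes>\<^bsub>L\<^esub> x) \<oplus> g y \<otimes> h (inv\<^bsub>L\<^esub> y \<otimes>\<^bsub>L\<^esub> x)"
        using x f g h by (simp add: K.l_distr)
    qed (rule funcsetI, rule tc, assumption, (rule x f g h)+)+
    then show "((f \<oplus>\<^bsub>KL\<^esub> g) \<otimes>\<^bsub>KL\<^esub> h) x = (f \<otimes>\<^bsub>KL\<^esub> h \<oplus>\<^bsub>KL\<^esub> g \<otimes>\<^bsub>KL\<^esub> h) x" using x by simp
  qed (use f g h fg mult_KL in auto)
  show ?r
  proof (rule KL_ext)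
    fix x assume x: "x \<in> carrier L"
    have h_sub: "supp h \<subseteq> ?A" by blast
    have "(h \<otimes>\<^bsub>KL\<^esub> (f \<oplus>\<^bsub>KL\<^esub> g)) x = (h \<otimes>\<^bsub>KL\<^esub> f) x \<oplus> (h \<otimes>\<^bsub>KL\<^esub> g) x"
      unfolding ev[OF h fg x h_sub] ev[OF h f x h_sub] ev[OF h g x h_sub]
    proof (rule sum)
      fix y assume y: "y \<in> ?A"
      then have "y \<in> carrier L" using A(2) by blast
      then show "h y \<otimes> (f \<oplus>\<^bsub>KL\<^esub> g) (inv\<^bsub>L\<^esub> y \<otimes>\<^bsub>L\<^esub> x) =
          h y \<otimes> f (inv\<^bsub>L\<^esub> y \<otimes>\<^bsub>L\<^esub> x) \<oplus> h y \<otimes> g (inv\<^bsub>L\<^esub> y \<otimes>\<^bsub>L\<^esub> x)"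
        using x f g h by (simp add: K.r_distr)
    qed (rule funcsetI, rule tc, assumption, (rule x f g h)+)+
    then show "(h \<otimes>\<^bsub>KL\<^esub> (f \<oplus>\<^bsub>KL\<^esub> g)) x = (h \<otimes>\<^bsub>KL\<^esub> f \<oplus>\<^bsub>KL\<^esub> h \<otimes>\<^bsub>KL\<^esub> g) x" using x by simp
  qed (use f g h fg mult_KL in auto)
qed

lemma mult_zero:
  assumes "f \<in> carrier KL"
  shows "\<zero>\<^bsub>KL\<^esub> \<otimes>\<^bsub>KL\<^esub> f = \<zero>\<^bsub>KL\<^esub>" "f \<otimes>\<^bsub>KL\<^esub> \<zero>\<^bsub>KL\<^esub> = \<zero>\<^bsub>KL\<^esub>"
proof -
  have "z = \<zero>\<^bsub>KL\<^esub>" if "z \<in> carrier KL" "z = z \<oplus>\<^bsub>KL\<^esub> z" for z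
    using that KLa.add.l_cancel_one'[of z z] by simp
  moreover have "\<zero>\<^bsub>KL\<^esub> \<otimes>\<^bsub>KL\<^esub> f = \<zero>\<^bsub>KL\<^esub> \<otimes>\<^bsub>KL\<^esub> f \<oplus>\<^bsub>KL\<^esub> \<zero>\<^bsub>KL\<^esub> \<otimes>\<^bsub>KL\<^esub> f"
    using mult_distrib(1)[of "\<zero>\<^bsub>KL\<^esub>" "\<zero>\<^bsub>KL\<^esub>" f] assms by simp
  moreover have "f \<otimes>\<^bsub>KL\<^esub> \<zero>\<^bsub>KL\<^esub> = f \<otimes>\<^bsub>KL\<^esub> \<zero>\<^bsub>KL\<^esub> \<oplus>\<^bsub>KL\<^esub> f \<otimes>\<^bsub>KL\<^esub> \<zero>\<^bsub>KL\<^esub>"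
    using mult_distrib(2)[of "\<zero>\<^bsub>KL\<^esub>" "\<zero>\<^bsub>KL\<^esub>" f] assms by simp
  ultimately show "\<zero>\<^bsub>KL\<^esub> \<otimes>\<^bsub>KL\<^esub> f = \<zero>\<^bsub>KL\<^esub>" "f \<otimes>\<^bsub>KL\<^esub> \<zero>\<^bsub>KL\<^esub> = \<zero>\<^bsub>KL\<^esub>"
    using mult_KL assms zero_KL by blast+
qed

lemma mult_KL_comm:
  assumes f: "f \<in> carrier KL" and h: "h \<in> carrier KL"
  shows "f \<otimes>\<^bsub>KL\<^esub> h = h \<otimes>\<^bsub>KL\<^esub> f"
proof -
  have mon: "mon c x \<otimes>\<^bsub>KL\<^esub> h = h \<otimes>\<^bsub>KL\<^esub> mon c x" if c: "c \<in> carrier K" "x \<in> carrier L" for c x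
    using h by (induction rule: KL_induct)
      (use c in \<open>simp_all add: mult_zero mult_distrib mon_mult K.m_comm L.m_comm\<close>)
  show ?thesis
    using f by (induction rule: KL_induct) (use h mon in \<open>simp_all add: mult_zero mult_distrib\<close>)
qed

lemma mult_KL_assoc:
  assumes f: "f \<in> carrier KL" and g: "g \<in> carrier KL" and h: "h \<in> carrier KL"
  shows "(f \<otimes>\<^bsub>KL\<^esub> g) \<otimes>\<^bsub>KL\<^esub> h = f \<otimes>\<^bsub>KL\<^esub> (g \<otimes>\<^bsub>KL\<^esub> h)"
proof -
  have mon2: "mon c x \<otimes>\<^bsub>KL\<^esub> mon d y \<otimes>\<^bsub>KL\<^esub> h = mon c x \<otimes>\<^bsub>KL\<^esub> (mon d y \<otimes>\<^bsub>KL\<^esub> h)"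
    if c: "c \<in> carrier K" "x \<in> carrier L" "d \<in> carrier K" "y \<in> carrier L" for c x d y
    using h by (induction rule: KL_induct)
      (use c mult_KL in \<open>simp_all add: mult_zero mult_distrib mon_mult K.m_assoc L.m_assoc\<close>)
  have mon: "mon c x \<otimes>\<^bsub>KL\<^esub> g \<otimes>\<^bsub>KL\<^esub> h = mon c x \<otimes>\<^bsub>KL\<^esub> (g \<otimes>\<^bsub>KL\<^esub> h)"
    if c: "c \<in> carrier K" "x \<in> carrier L" for c x
    using g by (induction rule: KL_induct)
      (use c h mult_KL mon2[OF c] in \<open>simp_all add: mult_zero mult_distrib\<close>)
  show ?thesis
    using f by (induction rule: KL_induct) (use g h mult_KL mon in \<open>simp_all add: mult_zero mult_distrib\<close>)
qed

lemma KL_cring: "cring KL"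
proof (rule cringI[OF KL_abelian_group])
  have one: "\<one>\<^bsub>KL\<^esub> \<in> carrier KL" unfolding one_mon by simp
  show "comm_monoid KL"
  proof (rule comm_monoidI)
    show "\<one>\<^bsub>KL\<^esub> \<otimes>\<^bsub>KL\<^esub> f = f" if f: "f \<in> carrier KL" for f
    proof (rule KL_ext[OF mult_KL[OF one f] f])
      show "(\<one>\<^bsub>KL\<^esub> \<otimes>\<^bsub>KL\<^esub> f) x = f x" if "x \<in> carrier L" for x
        unfolding one_mon using f that by (simp add: mon_mult_eval)
    qed
  qed (use one mult_KL mult_KL_comm mult_KL_assoc in auto)
qed (rule mult_distrib)

sublocale KL: cring KL by (rule KL_cring)

lemma mon_pow: "x \<in> carrier L \<Longrightarrow> mon \<one> x [^]\<^bsub>KL\<^esub> (n::nat) = mon \<one> (x [^]\<^bsub>L\<^esub> n)"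
proof (induction n)
  case 0 then show ?case by (simp add: one_mon)
next
  case (Suc n) then show ?case by (simp add: mon_mult)
qed

end

section \<open>Group rings along an embedding of groups\<close>

locale group_ring_embedding = group_ring K L + M: comm_group M
  for K :: "('k, 'r) ring_scheme" (structure) and L :: "('l, 'm) monoid_scheme" and M :: "('p, 'q) monoid_scheme" +
  fixes j
  assumes j_hom: "j \<in> hom M L" and j_inj: "inj_on j (carrier M)"
begin

sublocale M: group_ring K M ..

abbreviation KM where "KM \<equiv> group_algebra K M"

definition push :: "('p \<Rightarrow> 'k) \<Rightarrow> 'l \<Rightarrow> 'k" where
  "push f = (\<lambda>x\<in>carrier L. if x \<in> j ` carrier M then f (inv_into (carrier M) j x) else \<zero>)"

definition pull :: "('l \<Rightarrow> 'k) \<Rightarrow> 'p \<Rightarrow> 'k" where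
  "pull f = (\<lambda>z\<in>carrier M. f (j z))"

sublocale j: group_hom M L j
  by unfold_locales (rule j_hom)

lemma push_j [simp]: "z \<in> carrier M \<Longrightarrow> push f (j z) = f z"
  using j_inj by (simp add: push_def)

lemma push_other: "x \<in> carrier L \<Longrightarrow> x \<notin> j ` carrier M \<Longrightarrow> push f x = \<zero>"
  by (simp add: push_def)

lemma push_KL [simp]: "f \<in> carrier KM \<Longrightarrow> push f \<in> carrier KL"
  unfolding push_def
proof (rule KL_memI[of _ "j ` M.supp f"])
  assume f: "f \<in> carrier KM"
  show "(if x \<in> j ` carrier M then f (inv_into (carrier M) j x) else \<zero>) = \<zero>"
    if x: "x \<in> carrier L" "x \<notin> j ` M.supp f" for x
  proof (cases "x \<in> j ` carrier M")
    case True
    then obtain z where z: "z \<in> carrier M" "x = j z" by auto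
    then have "z \<notin> M.supp f" using x by auto
    then show ?thesis using z M.not_supp[of z f] j_inj by simp
  qed simp
qed (use M.supp_finite j_inj in auto)

lemma pull_KM [simp]:
  assumes f: "f \<in> carrier KL" shows "pull f \<in> carrier KM"
  unfolding pull_def
proof (rule M.KL_memI)
  let ?A = "{z \<in> carrier M. j z \<in> supp f}"
  have "j ` ?A \<subseteq> supp f" by auto
  then have "finite (j ` ?A)" using supp_finite[OF f] finite_subset by blast
  then show "finite ?A" using inj_on_subset[OF j_inj, of ?A] by (auto dest: finite_imageD)
  show "f (j z) = \<zero>" if "z \<in> carrier M" "z \<notin> ?A" for z using that not_supp[of "j z" f] by simp
qed (use f in simp)

lemma pull_eval [simp]: "z \<in> carrier M \<Longrightarrow> pull f z = f (j z)"
  by (simp add: pull_def)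

lemma push_mon: "z \<in> carrier M \<Longrightarrow> c \<in> carrier K \<Longrightarrow> push (M.mon c z) = mon c (j z)"
proof (rule KL_ext)
  fix x assume z: "z \<in> carrier M" "c \<in> carrier K" and x: "x \<in> carrier L"
  show "push (M.mon c z) x = mon c (j z) x"
  proof (cases "x \<in> j ` carrier M")
    case True
    then obtain w where "w \<in> carrier M" "x = j w" by auto
    then show ?thesis using z j_inj by (auto simp: M.mon_def mon_def dest: inj_onD)
  next
    case False
    then show ?thesis using x z by (auto simp: push_other mon_def)
  qed
qed auto

lemma push_add: "f \<in> carrier KM \<Longrightarrow> h \<in> carrier KM \<Longrightarrow> push (f \<oplus>\<^bsub>KM\<^esub> h) = push f \<oplus>\<^bsub>KL\<^esub> push h"
proof (rule KL_ext)
  fix x assume x: "x \<in> carrier L"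
  then show "push (f \<oplus>\<^bsub>KM\<^esub> h) x = (push f \<oplus>\<^bsub>KL\<^esub> push h) x"
    by (cases "x \<in> j ` carrier M") (auto simp: push_other)
qed auto

lemma push_zero: "push \<zero>\<^bsub>KM\<^esub> = \<zero>\<^bsub>KL\<^esub>"
proof (rule KL_ext)
  fix x assume x: "x \<in> carrier L"
  then show "push \<zero>\<^bsub>KM\<^esub> x = \<zero>\<^bsub>KL\<^esub> x"
    by (cases "x \<in> j ` carrier M") (auto simp: push_other)
qed auto

lemma push_hom: "push \<in> ring_hom KM KL"
proof (rule ring_hom_memI)
  fix f h assume f: "f \<in> carrier KM" and h: "h \<in> carrier KM"
  have mon: "push (M.mon c z \<otimes>\<^bsub>KM\<^esub> h) = mon c (j z) \<otimes>\<^bsub>KL\<^esub> push h"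
    if c: "c \<in> carrier K" "z \<in> carrier M" for c z
    using h by (induction rule: M.KL_induct)
      (use c in \<open>simp_all add: push_zero push_add M.KL.r_distr KL.r_distr M.mon_mult mon_mult push_mon\<close>)
  show "push (f \<otimes>\<^bsub>KM\<^esub> h) = push f \<otimes>\<^bsub>KL\<^esub> push h"
    using f by (induction rule: M.KL_induct)
      (use h mon in \<open>simp_all add: push_zero push_add M.KL.l_distr KL.l_distr push_mon\<close>)
  show "push (f \<oplus>\<^bsub>KM\<^esub> h) = push f \<oplus>\<^bsub>KL\<^esub> push h" by (rule push_add[OF f h])
next
  show "push \<one>\<^bsub>KM\<^esub> = \<one>\<^bsub>KL\<^esub>" by (simp add: M.one_mon one_mon push_mon)
qed simp

sublocale push: ring_hom_cring KM KL push
  by unfold_locales (rule push_hom)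

lemma pull_add: "pull (f \<oplus>\<^bsub>KL\<^esub> h) = pull f \<oplus>\<^bsub>KM\<^esub> pull h"
  by (auto simp: pull_def group_algebra_def restrict_def fun_eq_iff)

text \<open>A monomial at \<open>j z\<close> acts by a translation that preserves the image of
  \<open>j\<close>, so it commutes with restriction to that image. This linearity makes
  \<open>pull\<close> a Reynolds operator.\<close>

lemma pull_push_mult:
  assumes f: "f \<in> carrier KM" and h: "h \<in> carrier KL"
  shows "pull (push f \<otimes>\<^bsub>KL\<^esub> h) = f \<otimes>\<^bsub>KM\<^esub> pull h"
  using f
proof (induction rule: M.KL_induct)
  case zero
  show ?case using h by (simp add: push_zero) (rule M.KL_ext, auto)
next
  case (add c z f)
  have "pull (mon c (j z) \<otimes>\<^bsub>KL\<^esub> h) = M.mon c z \<otimes>\<^bsub>KM\<^esub> pull h"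
    by (rule M.KL_ext) (use add h in \<open>auto simp: M.mon_mult_eval mon_mult_eval simp flip: j.hom_inv j.hom_mult\<close>)
  then show ?case using add h by (simp add: push_mon KL.l_distr M.KL.l_distr pull_add)
qed

lemma pull_push: "f \<in> carrier KM \<Longrightarrow> pull (push f) = f"
  by (rule M.KL_ext) auto

lemma push_pull:
  assumes f: "f \<in> carrier KL" and surj: "j ` carrier M = carrier L"
  shows "push (pull f) = f"
proof (rule KL_ext)
  fix x assume "x \<in> carrier L"
  then obtain z where "z \<in> carrier M" "x = j z" using surj by blast
  then show "push (pull f) x = f x" by simp
qed (use f in auto)

text \<open>For surjective \<open>j\<close>, \<open>pull\<close> is inverse to \<open>push\<close>.
  It serves \<open>act_hom\<close>, since the action of \<open>g\<close> is the pullback along the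
  automorphism given by the inverse of \<open>g\<close>.\<close>

lemma pull_hom:
  assumes surj: "j ` carrier M = carrier L"
  shows "pull \<in> ring_hom KL KM"
proof (rule ring_hom_memI)
  fix f h assume f: "f \<in> carrier KL" and h: "h \<in> carrier KL"
  show "pull (f \<otimes>\<^bsub>KL\<^esub> h) = pull f \<otimes>\<^bsub>KM\<^esub> pull h"
    using pull_push_mult[of "pull f" h] f h push_pull[OF f surj] by simp
  show "pull (f \<oplus>\<^bsub>KL\<^esub> h) = pull f \<oplus>\<^bsub>KM\<^esub> pull h" by (rule pull_add)
next
  show "pull \<one>\<^bsub>KL\<^esub> = \<one>\<^bsub>KM\<^esub>" using pull_push[of "\<one>\<^bsub>KM\<^esub>"] by simp
qed simp

end

subsection \<open>Multiplicative invariants\<close>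

locale acted_group_ring = group_ring K L + G: group G
  for K :: "('k, 'r) ring_scheme" (structure) and L :: "('l, 'm) monoid_scheme" and G :: "('g, 'n) monoid_scheme" +
  fixes \<phi> :: "'g \<Rightarrow> 'l \<Rightarrow> 'l"
  assumes action: "\<phi> \<in> hom G (AutoGroup L)"
begin

lemma \<phi>_auto: "g \<in> carrier G \<Longrightarrow> \<phi> g \<in> auto L"
  using action by (auto simp: hom_def AutoGroup_def BijGroup_def)

lemma \<phi>_hom: "g \<in> carrier G \<Longrightarrow> \<phi> g \<in> hom L L"
  and \<phi>_bij: "g \<in> carrier G \<Longrightarrow> bij_betw (\<phi> g) (carrier L) (carrier L)"
  using \<phi>_auto[of g] by (auto simp: auto_def Bij_def)

lemma \<phi>_closed [simp]: "g \<in> carrier G \<Longrightarrow> x \<in> carrier L \<Longrightarrow> \<phi> g x \<in> carrier L"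
  using \<phi>_hom by (auto simp: hom_def)

lemma \<phi>_mult:
  assumes "g \<in> carrier G" "k \<in> carrier G" "x \<in> carrier L"
  shows "\<phi> (g \<otimes>\<^bsub>G\<^esub> k) x = \<phi> g (\<phi> k x)"
proof -
  have "\<phi> (g \<otimes>\<^bsub>G\<^esub> k) = \<phi> g \<otimes>\<^bsub>AutoGroup L\<^esub> \<phi> k" using action assms by (auto simp: hom_def)
  also have "\<dots> = compose (carrier L) (\<phi> g) (\<phi> k)"
    using \<phi>_auto[OF assms(1)] \<phi>_auto[OF assms(2)] by (simp add: AutoGroup_def BijGroup_def auto_def)
  finally show ?thesis using assms(3) by (simp add: compose_def)
qed

lemma \<phi>_one: "x \<in> carrier L \<Longrightarrow> \<phi> \<one>\<^bsub>G\<^esub> x = x"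
proof -
  assume x: "x \<in> carrier L"
  have "\<phi> \<one>\<^bsub>G\<^esub> (\<phi> \<one>\<^bsub>G\<^esub> x) = \<phi> \<one>\<^bsub>G\<^esub> x" using \<phi>_mult[of "\<one>\<^bsub>G\<^esub>" "\<one>\<^bsub>G\<^esub>" x] x by simp
  then show ?thesis
    using bij_betw_imp_inj_on[OF \<phi>_bij[OF G.one_closed]] x by (metis G.one_closed \<phi>_closed inj_onD)
qed

lemma \<phi>_inv [simp]:
  assumes "g \<in> carrier G" "x \<in> carrier L"
  shows "\<phi> (inv\<^bsub>G\<^esub> g) (\<phi> g x) = x" "\<phi> g (\<phi> (inv\<^bsub>G\<^esub> g) x) = x"
  using \<phi>_mult[of "inv\<^bsub>G\<^esub> g" g x] \<phi>_mult[of g "inv\<^bsub>G\<^esub> g" x] assms by (simp_all add: \<phi>_one)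

abbreviation act where "act \<equiv> group_algebra_act G L \<phi>"

abbreviation A where "A \<equiv> invariant_algebra K G L \<phi>"

lemma act_eval [simp]: "x \<in> carrier L \<Longrightarrow> act g f x = f (\<phi> (inv\<^bsub>G\<^esub> g) x)"
  by (simp add: group_algebra_act_def)

lemma act_hom:
  assumes g: "g \<in> carrier G"
  shows "ring_hom_cring KL KL (act g)"
proof -
  have gi: "inv\<^bsub>G\<^esub> g \<in> carrier G" using g by simp
  interpret e: group_ring_embedding K L L "\<phi> (inv\<^bsub>G\<^esub> g)"
    by unfold_locales (use \<phi>_hom[OF gi] \<phi>_bij[OF gi] in \<open>auto simp: bij_betw_def\<close>)
  have "e.pull = act g" by (auto simp: e.pull_def group_algebra_act_def fun_eq_iff)
  moreover have "e.pull \<in> ring_hom KL KL" using e.pull_hom \<phi>_bij[OF gi] by (auto simp: bij_betw_def)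
  ultimately have "act g \<in> ring_hom KL KL" by simp
  then show ?thesis by (intro ring_hom_cring.intro ring_hom_cring_axioms.intro KL_cring)
qed

lemma act_KL [simp]: "g \<in> carrier G \<Longrightarrow> f \<in> carrier KL \<Longrightarrow> act g f \<in> carrier KL"
  using ring_hom_closed[OF ring_hom_cring.homh[OF act_hom[of g]], of f] by simp

lemma act_inv: "g \<in> carrier G \<Longrightarrow> f \<in> carrier KL \<Longrightarrow> act (inv\<^bsub>G\<^esub> g) (act g f) = f"
  by (rule KL_ext) auto

lemma act_mon:
  assumes "g \<in> carrier G" "x \<in> carrier L" "c \<in> carrier K"
  shows "act g (mon c x) = mon c (\<phi> g x)"
proof (rule KL_ext)
  fix z assume z: "z \<in> carrier L"
  have "\<phi> (inv\<^bsub>G\<^esub> g) z = x \<longleftrightarrow> z = \<phi> g x" using assms z \<phi>_inv by metis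
  then show "act g (mon c x) z = mon c (\<phi> g x) z" using assms z by (simp add: mon_def)
qed (use assms in auto)

lemma carrier_A: "f \<in> carrier A \<longleftrightarrow> f \<in> carrier KL \<and> (\<forall>g\<in>carrier G. act g f = f)"
  by (simp add: invariant_algebra_def)

lemma A_ops [simp]: "monoid.mult A = monoid.mult KL" "ring.add A = ring.add KL"
  "\<one>\<^bsub>A\<^esub> = \<one>\<^bsub>KL\<^esub>" "\<zero>\<^bsub>A\<^esub> = \<zero>\<^bsub>KL\<^esub>"
  by (simp_all add: invariant_algebra_def)

lemma A_pow: "f [^]\<^bsub>A\<^esub> (n::nat) = f [^]\<^bsub>KL\<^esub> n"
  by (simp add: nat_pow_def)

lemma A_cring: "cring A"
proof -
  have "subring (carrier A) KL"
  proof (rule KL.subringI)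
    show "carrier A \<subseteq> carrier KL" by (auto simp: carrier_A)
    have hom: "act g \<in> ring_hom KL KL" if "g \<in> carrier G" for g
      by (rule ring_hom_cring.homh[OF act_hom[OF that]])
    show "\<one>\<^bsub>KL\<^esub> \<in> carrier A" using hom by (auto simp: carrier_A ring_hom_one)
    show "\<ominus>\<^bsub>KL\<^esub> f \<in> carrier A" if "f \<in> carrier A" for f
    proof -
      have "act g (\<ominus>\<^bsub>KL\<^esub> f) = \<ominus>\<^bsub>KL\<^esub> f" if g: "g \<in> carrier G" for g
      proof -
        interpret a: ring_hom_cring KL KL "act g" by (rule act_hom[OF g])
        show ?thesis using \<open>f \<in> carrier A\<close> g by (simp add: carrier_A)
      qed
      then show ?thesis using that by (simp add: carrier_A)
    qed
    show "f \<otimes>\<^bsub>KL\<^esub> h \<in> carrier A" "f \<oplus>\<^bsub>KL\<^esub> h \<in> carrier A" if "f \<in> carrier A" "h \<in> carrier A" for f h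
      using that ring_hom_mult[OF hom, of _ f h] ring_hom_add[OF hom, of _ f h] by (auto simp: carrier_A)
  qed
  then have "subcring (carrier A) KL" by (rule KL.subcringI')
  moreover have "A = KL \<lparr>carrier := carrier A\<rparr>" by (simp add: invariant_algebra_def)
  ultimately show ?thesis using KL.subcring_iff[of "carrier A"] by (auto simp: carrier_A subset_iff)
qed

lemma incl_hom: "ring_hom_cring A KL (\<lambda>f. f)"
  using A_cring KL_cring
  by (intro ring_hom_cring.intro ring_hom_cring_axioms.intro ring_hom_memI) (auto simp: carrier_A)

text \<open>The monomial is a root of the product over its orbit, and \<open>G\<close> permutes that
  orbit, so the coefficients are invariant. The orbit is taken as a set, so stabilizers cause no
  multiplicities.\<close>

lemma mon_integral:
  assumes fin: "finite (carrier G)" and x: "x \<in> carrier L"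
  shows "ring_hom_cring.integral_element A KL (\<lambda>f. f) (mon \<one> x)"
proof -
  interpret i: ring_hom_cring A KL "\<lambda>f. f" by (rule incl_hom)
  let ?O = "(\<lambda>g. mon \<one> (\<phi> g x)) ` carrier G"
  have Oc: "?O \<subseteq> carrier KL" "finite ?O" using fin by auto
  show ?thesis
  proof (rule i.integral_of_esym[OF Oc(2,1)])
    show "mon \<one> x \<in> ?O" using \<phi>_one[OF x] by (intro image_eqI[of _ _ "\<one>\<^bsub>G\<^esub>"]) auto
    fix k
    have "act g (KL.esym ?O k) = KL.esym ?O k" if g: "g \<in> carrier G" for g
    proof (rule KL.esym_invariant[OF act_hom[OF g] Oc(2,1)])
      show "act g ` ?O = ?O"
      proof (rule endo_inj_surj[OF Oc(2)])
        show "act g ` ?O \<subseteq> ?O"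
        proof
          fix f assume "f \<in> act g ` ?O"
          then obtain k where "k \<in> carrier G" "f = act g (mon \<one> (\<phi> k x))" by auto
          then have "f = mon \<one> (\<phi> (g \<otimes>\<^bsub>G\<^esub> k) x)" "g \<otimes>\<^bsub>G\<^esub> k \<in> carrier G"
            using g x by (simp_all add: act_mon \<phi>_mult)
          then show "f \<in> ?O" by blast
        qed
        show "inj_on (act g) ?O"
          by (rule inj_on_inverseI[of _ "act (inv\<^bsub>G\<^esub> g)"]) (use act_inv[OF g] Oc(1) in blast)
      qed
    qed
    then have "KL.esym ?O k \<in> carrier A" using KL.esym_closed[OF Oc(1)] by (simp add: carrier_A)
    then show "KL.esym ?O k \<in> (\<lambda>f. f) ` carrier A" by simp
  qed
qed

end

section \<open>The Reynolds operator of an equivariant isogeny\<close>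

locale isogeny = group_ring_embedding K L M j + L: acted_group_ring K L G \<phi> + M: acted_group_ring K M G \<phi>'
  for K :: "('k, 'r) ring_scheme" (structure) and L :: "('l, 'm) monoid_scheme"
    and M :: "('p, 'q) monoid_scheme" and j and G :: "('g, 'n) monoid_scheme" and \<phi> \<phi>' +
  assumes fin: "finite (carrier G)"
    and equivariant: "\<lbrakk>g \<in> carrier G; z \<in> carrier M\<rbrakk> \<Longrightarrow> j (\<phi>' g z) = \<phi> g (j z)"
    and torsion: "x \<in> carrier L \<Longrightarrow> \<exists>N>0::nat. x [^]\<^bsub>L\<^esub> N \<in> j ` carrier M"
begin

abbreviation A where "A \<equiv> invariant_algebra K G M \<phi>'"
abbreviation B where "B \<equiv> invariant_algebra K G L \<phi>"

lemma push_invariant: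
  assumes f: "f \<in> carrier A" shows "push f \<in> carrier B"
proof -
  have fK: "f \<in> carrier KM" using f by (simp add: M.carrier_A)
  have "L.act g (push f) = push f" if g: "g \<in> carrier G" for g
  proof (rule KL_ext)
    fix x assume x: "x \<in> carrier L"
    show "L.act g (push f) x = push f x"
    proof (cases "x \<in> j ` carrier M")
      case True
      then obtain z where z: "z \<in> carrier M" "x = j z" by auto
      have "M.act g f z = f z" using f g by (simp add: M.carrier_A)
      then show ?thesis using z g equivariant[of "inv\<^bsub>G\<^esub> g" z] by (simp flip: equivariant)
    next
      case False
      \<comment> \<open>The image of \<open>j\<close> is stable under \<open>G\<close>, hence so is
        its complement, on which \<open>push f\<close> vanishes.\<close>
      have "\<phi> (inv\<^bsub>G\<^esub> g) x \<notin> j ` carrier M"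
      proof
        assume "\<phi> (inv\<^bsub>G\<^esub> g) x \<in> j ` carrier M"
        then obtain w where w: "w \<in> carrier M" "\<phi> (inv\<^bsub>G\<^esub> g) x = j w" by auto
        then have "x = j (\<phi>' g w)" using g x equivariant[of g w] L.\<phi>_inv(2)[of g x] by simp
        then show False using False w g by auto
      qed
      then show ?thesis using False x g by (simp add: push_other)
    qed
  qed (use fK g in auto)
  then show ?thesis using fK by (simp add: L.carrier_A)
qed

lemma pull_invariant:
  assumes f: "f \<in> carrier B" shows "pull f \<in> carrier A"
proof -
  have fK: "f \<in> carrier KL" using f by (simp add: L.carrier_A)
  have "M.act g (pull f) = pull f" if g: "g \<in> carrier G" for g
  proof (rule M.KL_ext)
    fix z assume z: "z \<in> carrier M"
    have "L.act g f (j z) = f (j z)" using f g by (simp add: L.carrier_A)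
    then show "M.act g (pull f) z = pull f z" using z g by (simp add: equivariant)
  qed (use fK g in auto)
  then show ?thesis using fK by (simp add: M.carrier_A)
qed

sublocale reynolds A B push pull
proof (intro reynolds.intro reynolds_axioms.intro ring_hom_cring.intro ring_hom_cring_axioms.intro
    M.A_cring L.A_cring)
  show "push \<in> ring_hom A B"
    by (rule ring_hom_memI) (auto simp: push_invariant, auto simp: M.carrier_A)
  show "pull \<one>\<^bsub>B\<^esub> = \<one>\<^bsub>A\<^esub>" using pull_push[of "\<one>\<^bsub>KM\<^esub>"] by simp
  show "pull (push a \<otimes>\<^bsub>B\<^esub> b) = a \<otimes>\<^bsub>A\<^esub> pull b" if "a \<in> carrier A" "b \<in> carrier B" for a b
    using that pull_push_mult by (simp add: M.carrier_A L.carrier_A)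
qed (auto simp: pull_invariant pull_add)

text \<open>Monomials need not be invariant, so integrality over \<open>A\<close> is shown in the
  whole group ring \<open>KL\<close>, which they generate additively. The result is read back in
  \<open>B\<close>, since the relation for \<open>b\<close> involves only scalars from
  \<open>A\<close> and powers of \<open>b\<close>.\<close>

lemma all_integral:
  assumes noeth: "noetherian_ring A" and b: "b \<in> carrier B"
  shows "integral_element b"
proof -
  have AKL: "ring_hom_cring A KL push"
    using M.A_cring KL_cring push.homh
    by (intro ring_hom_cring.intro ring_hom_cring_axioms.intro ring_hom_memI) (auto simp: M.carrier_A)
  interpret c: ring_hom_cring A KL push by (rule AKL)
  have mon1: "c.integral_element (mon \<one> x)" if x: "x \<in> carrier L" for x
  proof -
    \<comment> \<open>A power of \<open>x\<close> comes from some \<open>z\<close> under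
      \<open>j\<close>; the monomial at \<open>z\<close> is integral over \<open>A\<close> by the
      orbit argument, and a root of an integral element is integral.\<close>
    obtain N :: nat where N: "N > 0" "x [^]\<^bsub>L\<^esub> N \<in> j ` carrier M" using torsion[OF x] by auto
    then obtain z where z: "z \<in> carrier M" "x [^]\<^bsub>L\<^esub> N = j z" by auto
    have "ring_hom_cring.integral_element A KL (push \<circ> (\<lambda>f. f)) (push (M.mon \<one> z))"
      using ring_hom_cring.integral_hom_image[OF M.incl_hom push.ring_hom_cring_axioms M.mon_integral[OF fin z(1)]] .
    then have "c.integral_element (mon \<one> x [^]\<^bsub>KL\<^esub> N)"
      using z x by (simp add: push_mon mon_pow comp_def)
    then show ?thesis using c.integral_root[OF _ N(1)] by simp
  qed
  have mon: "c.integral_element (mon r x)" if r: "r \<in> carrier K" and x: "x \<in> carrier L" for r x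
  proof -
    \<comment> \<open>Constants sit at the neutral element, which every automorphism fixes; so they
      belong to \<open>A\<close>.\<close>
    have "M.mon r \<one>\<^bsub>M\<^esub> \<in> carrier A"
    proof -
      have "M.act g (M.mon r \<one>\<^bsub>M\<^esub>) = M.mon r \<one>\<^bsub>M\<^esub>" if g: "g \<in> carrier G" for g
      proof -
        interpret g: group_hom M M "\<phi>' g" using M.\<phi>_hom[OF g] by unfold_locales
        show ?thesis using g r by (simp add: M.act_mon)
      qed
      then show ?thesis using r by (simp add: M.carrier_A)
    qed
    then have "c.integral_element (push (M.mon r \<one>\<^bsub>M\<^esub>))" by (rule c.integral_hom)
    then have "c.integral_element (mon r \<one>\<^bsub>L\<^esub>)" using r by (simp add: push_mon)
    from c.integral_add_mult(2)[OF noeth this mon1[OF x]] show ?thesis using r x by (simp add: mon_mult)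
  qed
  have bK: "b \<in> carrier KL" using b by (simp add: L.carrier_A)
  have int: "c.integral_element b"
  proof (rule KL_induct[OF bK])
    show "c.integral_element \<zero>\<^bsub>KL\<^esub>" using c.integral_hom[OF ring.ring_simprules(2)[OF cring.axioms(1)[OF M.A_cring]]] by simp
  qed (use mon c.integral_add_mult(1)[OF noeth] in blast)
  then obtain k :: nat where k: "b [^]\<^bsub>KL\<^esub> k \<in> c.hspan ((\<lambda>i. b [^]\<^bsub>KL\<^esub> i) ` {..<k})"
    by (auto simp: c.integral_element_def)
  have "m \<in> hspan V" if "m \<in> c.hspan V" for m V
    using that
  proof induction
    case zero
    show ?case using hspan.zero[of V] by simp
  next
    case (step a x m)
    then show ?case using hspan.step[of a x V m] by simp
  qed
  from this[OF k] show ?thesis using b by (auto simp: integral_element_def L.A_pow)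
qed

lemma cohen_macaulay_A: "cohen_macaulay B \<Longrightarrow> cohen_macaulay A"
  using hochster_eagon all_integral noetherian_source by (auto simp: cohen_macaulay_def)

end

subsection \<open>Rational tensor products\<close>

context comm_group
begin

abbreviation tensor_free where "tensor_free \<equiv> free_Abelian_group (carrier G \<times> (UNIV :: rat set))"

definition pure_tensor :: "'a \<Rightarrow> rat \<Rightarrow> (('a \<times> rat) \<Rightarrow>\<^sub>0 int) set" where
  "pure_tensor x q = tensor_rels G #>\<^bsub>tensor_free\<^esub> frag_of (x, q)"

lemma tensor_gens_carrier:
  "{frag_of (x \<otimes> y, q) - frag_of (x, q) - frag_of (y, q) | x y q. x \<in> carrier G \<and> y \<in> carrier G} \<union>
   {frag_of (x, q + r) - frag_of (x, q) - frag_of (x, r) | x q r. x \<in> carrier G} \<subseteq> carrier tensor_free"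
proof -
  have *: "a - b - c \<in> carrier tensor_free"
    if "a \<in> carrier tensor_free" "b \<in> carrier tensor_free" "c \<in> carrier tensor_free" for a b c
    using that keys_diff[of a b] keys_diff[of "a - b" c] by (simp, blast)
  show ?thesis by (auto intro!: * simp del: carrier_free_Abelian_group_iff)
qed

lemma tensor_rels_normal: "tensor_rels G \<lhd> tensor_free"
proof -
  have "subgroup (tensor_rels G) tensor_free"
    unfolding tensor_rels_def
    by (rule group.generate_is_subgroup[OF group_free_Abelian_group tensor_gens_carrier])
  then show ?thesis
    using comm_group.subgroup_imp_normal[OF abelian_free_Abelian_group] by blast
qed

lemma tensor_rels_sub: "tensor_rels G \<subseteq> carrier tensor_free"
  using normal_imp_subgroup[OF tensor_rels_normal] by (rule subgroup.subset)

lemma rat_tensor_group: "group (rat_tensor G)"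
  unfolding rat_tensor_def by (rule normal.factorgroup_is_group[OF tensor_rels_normal])

definition tensor_class :: "(('a \<times> rat) \<Rightarrow>\<^sub>0 int) \<Rightarrow> (('a \<times> rat) \<Rightarrow>\<^sub>0 int) set" where
  "tensor_class u = tensor_rels G #>\<^bsub>tensor_free\<^esub> u"

lemma tensor_class_hom: "group_hom tensor_free (rat_tensor G) tensor_class"
proof -
  have "(\<lambda>a. tensor_rels G #>\<^bsub>tensor_free\<^esub> a) \<in> hom tensor_free (tensor_free Mod tensor_rels G)"
    by (rule normal.r_coset_hom_Mod[OF tensor_rels_normal])
  then have "tensor_class \<in> hom tensor_free (rat_tensor G)"
    unfolding tensor_class_def rat_tensor_def by simp
  then show ?thesis
    by (intro group_hom.intro group_hom_axioms.intro rat_tensor_group) simp_all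
qed

lemma rat_tensor_carrier: "carrier (rat_tensor G) = tensor_class ` carrier tensor_free"
  by (auto simp: rat_tensor_def FactGroup_def RCOSETS_def tensor_class_def)

lemma pure_tensor_class: "pure_tensor x q = tensor_class (frag_of (x, q))"
  by (simp add: pure_tensor_def tensor_class_def)

lemma tensor_class_one:
  assumes "u \<in> tensor_rels G" shows "tensor_class u = \<one>\<^bsub>rat_tensor G\<^esub>"
proof -
  have "tensor_class u = tensor_rels G"
    unfolding tensor_class_def
    by (rule group.coset_join2[OF group_free_Abelian_group subsetD[OF tensor_rels_sub assms]
        normal_imp_subgroup[OF tensor_rels_normal] assms])
  then show ?thesis by (simp add: rat_tensor_def FactGroup_def)
qed

lemma tensor_class_one_imp:
  assumes "u \<in> carrier tensor_free" "tensor_class u = \<one>\<^bsub>rat_tensor G\<^esub>"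
  shows "u \<in> tensor_rels G"
proof -
  have "tensor_rels G #>\<^bsub>tensor_free\<^esub> u = tensor_rels G"
    using assms(2) by (simp add: tensor_class_def rat_tensor_def FactGroup_def)
  then show ?thesis
    using group.coset_join1[OF group_free_Abelian_group _ assms(1) normal_imp_subgroup[OF tensor_rels_normal]] by simp
qed

lemma pure_tensor_closed [simp]: "x \<in> carrier G \<Longrightarrow> pure_tensor x q \<in> carrier (rat_tensor G)"
  unfolding rat_tensor_carrier pure_tensor_class by (rule imageI) simp

lemma tensor_class_relation:
  assumes "a - b - c \<in> tensor_rels G"
    "a \<in> carrier tensor_free" "b \<in> carrier tensor_free" "c \<in> carrier tensor_free"
  shows "tensor_class a = tensor_class b \<otimes>\<^bsub>rat_tensor G\<^esub> tensor_class c"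
proof -
  interpret q: group_hom tensor_free "rat_tensor G" tensor_class by (rule tensor_class_hom)
  have r: "a - b - c \<in> carrier tensor_free" using assms(1) tensor_rels_sub by blast
  have bc: "b + c \<in> carrier tensor_free" using q.G.m_closed[OF assms(3,4)] by simp
  have "tensor_class a = tensor_class ((a - b - c) \<otimes>\<^bsub>tensor_free\<^esub> (b \<otimes>\<^bsub>tensor_free\<^esub> c))" by simp
  also have "\<dots> = tensor_class (a - b - c) \<otimes>\<^bsub>rat_tensor G\<^esub> (tensor_class b \<otimes>\<^bsub>rat_tensor G\<^esub> tensor_class c)"
    using q.hom_mult[OF r q.G.m_closed[OF assms(3,4)]] q.hom_mult[OF assms(3,4)] by simp
  also have "\<dots> = tensor_class b \<otimes>\<^bsub>rat_tensor G\<^esub> tensor_class c"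
    using tensor_class_one[OF assms(1)] q.hom_closed[OF assms(3)] q.hom_closed[OF assms(4)] by simp
  finally show ?thesis .
qed

lemma pure_tensor_mult:
  assumes "x \<in> carrier G" "y \<in> carrier G"
  shows "pure_tensor (x \<otimes> y) q = pure_tensor x q \<otimes>\<^bsub>rat_tensor G\<^esub> pure_tensor y q"
proof -
  have "frag_of (x \<otimes> y, q) - frag_of (x, q) - frag_of (y, q) \<in> tensor_rels G"
    unfolding tensor_rels_def by (rule generate.incl) (use assms in blast)
  then show ?thesis unfolding pure_tensor_class using assms by (intro tensor_class_relation) auto
qed

lemma pure_tensor_add:
  assumes "x \<in> carrier G"
  shows "pure_tensor x (q + r) = pure_tensor x q \<otimes>\<^bsub>rat_tensor G\<^esub> pure_tensor x r"
proof -
  have "frag_of (x, q + r) - frag_of (x, q) - frag_of (x, r) \<in> tensor_rels G"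
    unfolding tensor_rels_def by (rule generate.incl) (use assms in blast)
  then show ?thesis unfolding pure_tensor_class using assms by (intro tensor_class_relation) auto
qed

lemma pure_tensor_hom: "group_hom G (rat_tensor G) (\<lambda>x. pure_tensor x q)"
  by (intro group_hom.intro group_hom_axioms.intro rat_tensor_group homI)
    (auto simp: pure_tensor_mult)

lemma pure_tensor_zero:
  assumes "x \<in> carrier G" shows "pure_tensor x 0 = \<one>\<^bsub>rat_tensor G\<^esub>"
proof -
  interpret T: group "rat_tensor G" by (rule rat_tensor_group)
  have "pure_tensor x 0 \<otimes>\<^bsub>rat_tensor G\<^esub> pure_tensor x 0 = pure_tensor x 0"
    using pure_tensor_add[OF assms, of 0 0] by simp
  then show ?thesis using assms T.l_cancel_one'[of "pure_tensor x 0" "pure_tensor x 0"] by simp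
qed

lemma pure_tensor_pow:
  assumes "x \<in> carrier G"
  shows "pure_tensor (x [^] (n::nat)) q = pure_tensor x (of_nat n * q)"
proof (induction n)
  case 0
  interpret p: group_hom G "rat_tensor G" "\<lambda>x. pure_tensor x q" by (rule pure_tensor_hom)
  show ?case using pure_tensor_zero[OF assms] p.hom_one by simp
next
  case (Suc n)
  have "pure_tensor (x [^] Suc n) q = pure_tensor x (of_nat n * q) \<otimes>\<^bsub>rat_tensor G\<^esub> pure_tensor x q"
    using Suc assms by (simp add: pure_tensor_mult)
  also have "\<dots> = pure_tensor x (of_nat n * q + q)"
    by (rule pure_tensor_add[OF assms, symmetric])
  also have "of_nat n * q + q = of_nat (Suc n) * q" by (simp add: algebra_simps)
  finally show ?case .
qed

lemma pure_tensor_inv: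
  assumes "x \<in> carrier G" shows "pure_tensor (inv x) q = pure_tensor x (- q)"
proof -
  interpret p: group_hom G "rat_tensor G" "\<lambda>x. pure_tensor x q" by (rule pure_tensor_hom)
  have "pure_tensor x (- q) \<otimes>\<^bsub>rat_tensor G\<^esub> pure_tensor x q = \<one>\<^bsub>rat_tensor G\<^esub>"
    using pure_tensor_add[OF assms, of "- q" q] pure_tensor_zero[OF assms] by simp
  then have "inv\<^bsub>rat_tensor G\<^esub> (pure_tensor x q) = pure_tensor x (- q)"
    using assms by (intro p.H.inv_equality) auto
  then show ?thesis using assms by simp
qed

text \<open>Common denominators: in additive notation the difference of
  \<open>x \<otimes> 1/m\<close> and \<open>y \<otimes> 1/n\<close> is
  \<open>(n x - m y) \<otimes> 1/(m n)\<close>. Differences suffice because the free abelian group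
  arises from its basis by subtraction.\<close>

lemma tensor_is_pure:
  assumes "A \<in> carrier (rat_tensor G)"
  shows "\<exists>x\<in>carrier G. \<exists>n>0. A = pure_tensor x (1 / of_nat n)"
proof -
  interpret q: group_hom tensor_free "rat_tensor G" tensor_class by (rule tensor_class_hom)
  obtain u where u: "u \<in> carrier tensor_free" "A = tensor_class u" using assms by (auto simp: rat_tensor_carrier)
  have "\<exists>x\<in>carrier G. \<exists>n>0. tensor_class u = pure_tensor x (1 / of_nat n)"
  proof (rule free_Abelian_group_induct[of u "carrier G \<times> UNIV"])
    show "Poly_Mapping.keys u \<subseteq> carrier G \<times> UNIV" using u by simp
    interpret p: group_hom G "rat_tensor G" "\<lambda>x. pure_tensor x (1 / of_nat 1)" by (rule pure_tensor_hom)
    have "tensor_class 0 = pure_tensor \<one> (1 / of_nat 1)" using q.hom_one p.hom_one by simp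
    then show "\<exists>x\<in>carrier G. \<exists>n>0. tensor_class 0 = pure_tensor x (1 / of_nat n)"
      using one_closed zero_less_one by blast
  next
    fix v w assume v: "Poly_Mapping.keys v \<subseteq> carrier G \<times> (UNIV :: rat set)"
      and w: "Poly_Mapping.keys w \<subseteq> carrier G \<times> (UNIV :: rat set)"
      and "\<exists>x\<in>carrier G. \<exists>n>0. tensor_class v = pure_tensor x (1 / of_nat n)"
        "\<exists>x\<in>carrier G. \<exists>n>0. tensor_class w = pure_tensor x (1 / of_nat n)"
    then obtain x y m n where x: "x \<in> carrier G" "m > 0" "tensor_class v = pure_tensor x (1 / of_nat m)"
      and y: "y \<in> carrier G" "n > 0" "tensor_class w = pure_tensor y (1 / of_nat n)" by blast
    have vc: "v \<in> carrier tensor_free" and wc: "w \<in> carrier tensor_free" using v w by simp_all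
    have "tensor_class (v - w) = tensor_class (v \<otimes>\<^bsub>tensor_free\<^esub> inv\<^bsub>tensor_free\<^esub> w)" using w by simp
    also have "\<dots> = tensor_class v \<otimes>\<^bsub>rat_tensor G\<^esub> inv\<^bsub>rat_tensor G\<^esub> tensor_class w"
      by (simp only: q.hom_mult[OF vc q.G.inv_closed[OF wc]] q.hom_inv[OF wc])
    also have "tensor_class v = pure_tensor (x [^] n) (1 / of_nat (m * n))"
      unfolding x(3) using x(1,2) y(2) by (simp add: pure_tensor_pow)
    also have "inv\<^bsub>rat_tensor G\<^esub> tensor_class w = pure_tensor (inv (y [^] m)) (1 / of_nat (m * n))"
    proof -
      interpret p: group_hom G "rat_tensor G" "\<lambda>x. pure_tensor x (1 / of_nat (m * n))" by (rule pure_tensor_hom)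
      have "tensor_class w = pure_tensor (y [^] m) (1 / of_nat (m * n))"
        unfolding y(3) using y(1,2) x(2) by (simp add: pure_tensor_pow)
      then show ?thesis using y(1) p.hom_inv[of "y [^] m"] by simp
    qed
    also have "pure_tensor (x [^] n) (1 / of_nat (m * n)) \<otimes>\<^bsub>rat_tensor G\<^esub> pure_tensor (inv (y [^] m)) (1 / of_nat (m * n))
        = pure_tensor (x [^] n \<otimes> inv (y [^] m)) (1 / of_nat (m * n))"
      using x y by (simp add: pure_tensor_mult)
    finally show "\<exists>x\<in>carrier G. \<exists>n>0. tensor_class (v - w) = pure_tensor x (1 / of_nat n)"
      using x y by (intro bexI[of _ "x [^] n \<otimes> inv (y [^] m)"] exI[of _ "m * n"]) auto
  next
    fix a :: "'a \<times> rat" assume "a \<in> carrier G \<times> UNIV"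
    then obtain x r where a: "a = (x, r)" "x \<in> carrier G" by auto
    obtain k n where "quotient_of r = (k, n)" by (cases "quotient_of r")
    then have kn: "r = of_int k / of_int n" "n > 0"
      using quotient_of_div quotient_of_denom_pos by blast+
    \<comment> \<open>Exponents are natural numbers, so the sign of the numerator is moved to
      \<open>x\<close>.\<close>
    define y where "y = (if k \<ge> 0 then x else inv x)"
    have y: "y \<in> carrier G" using a by (simp add: y_def)
    have "pure_tensor (y [^] nat \<bar>k\<bar>) (1 / of_nat (nat n)) = pure_tensor x r"
    proof -
      have "pure_tensor (y [^] nat \<bar>k\<bar>) (1 / of_nat (nat n)) = pure_tensor y (of_nat (nat \<bar>k\<bar>) * (1 / of_nat (nat n)))"
        by (rule pure_tensor_pow[OF y])
      also have "of_nat (nat \<bar>k\<bar>) * (1 / of_nat (nat n)) = (of_int \<bar>k\<bar> / of_int n :: rat)"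
        using kn by (simp add: of_nat_nat)
      also have "pure_tensor y (of_int \<bar>k\<bar> / of_int n) = pure_tensor x r"
        using kn a by (cases "k \<ge> 0") (simp_all add: y_def pure_tensor_inv)
      finally show ?thesis .
    qed
    then show "\<exists>x\<in>carrier G. \<exists>n>0. tensor_class (frag_of a) = pure_tensor x (1 / of_nat n)"
      using kn y a by (intro bexI[of _ "y [^] nat \<bar>k\<bar>"] exI[of _ "nat n"]) (auto simp: pure_tensor_class)
  qed
  then show ?thesis using u by simp
qed

lemma rat_tensor_comm: "comm_group (rat_tensor G)"
  unfolding rat_tensor_def
  by (rule comm_group.abelian_FactGroup[OF abelian_free_Abelian_group normal_imp_subgroup[OF tensor_rels_normal]])

text \<open>The universal property of the tensor product in the form of a kernel; additivity of
  \<open>c\<close> in each argument need only be known on basis elements.\<close>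

lemma tensor_rels_kernel:
  assumes H: "comm_group H" and c: "group_hom tensor_free H c"
    and mult: "\<And>x y q. \<lbrakk>x \<in> carrier G; y \<in> carrier G\<rbrakk> \<Longrightarrow>
      c (frag_of (x \<otimes> y, q)) = c (frag_of (x, q)) \<otimes>\<^bsub>H\<^esub> c (frag_of (y, q))"
    and add: "\<And>x q r. x \<in> carrier G \<Longrightarrow>
      c (frag_of (x, q + r)) = c (frag_of (x, q)) \<otimes>\<^bsub>H\<^esub> c (frag_of (x, r))"
    and n: "n \<in> tensor_rels G"
  shows "c n = \<one>\<^bsub>H\<^esub>"
proof -
  interpret H: comm_group H by (rule H)
  interpret c: group_hom tensor_free H c by (rule c)
  have diff: "u - v - w \<in> kernel tensor_free H c"
    if uvw: "u \<in> carrier tensor_free" "v \<in> carrier tensor_free" "w \<in> carrier tensor_free"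
      "c u = c v \<otimes>\<^bsub>H\<^esub> c w" for u v w
  proof -
    have eq: "u - v - w = u \<otimes>\<^bsub>tensor_free\<^esub> inv\<^bsub>tensor_free\<^esub> v \<otimes>\<^bsub>tensor_free\<^esub> inv\<^bsub>tensor_free\<^esub> w"
      using uvw by simp
    have "c (u - v - w) = c u \<otimes>\<^bsub>H\<^esub> inv\<^bsub>H\<^esub> c v \<otimes>\<^bsub>H\<^esub> inv\<^bsub>H\<^esub> c w"
      unfolding eq using uvw(1-3) by (simp del: inv_free_Abelian_group mult_free_Abelian_group carrier_free_Abelian_group_iff)
    also have "\<dots> = \<one>\<^bsub>H\<^esub>"
      unfolding uvw(4) using c.hom_closed[OF uvw(2)] c.hom_closed[OF uvw(3)]
      by (simp add: H.m_comm[of "c v"] H.m_assoc)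
    finally have "c (u - v - w) = \<one>\<^bsub>H\<^esub>" .
    moreover have "u - v - w \<in> carrier tensor_free"
      unfolding eq using uvw(1-3) by (intro c.G.m_closed c.G.inv_closed)
    ultimately show ?thesis by (simp add: kernel_def)
  qed
  have "tensor_rels G \<subseteq> kernel tensor_free H c"
    unfolding tensor_rels_def
  proof (rule c.G.generate_subgroup_incl[OF Un_least c.subgroup_kernel])
    show "{frag_of (x \<otimes> y, q) - frag_of (x, q) - frag_of (y, q) |x y q. x \<in> carrier G \<and> y \<in> carrier G}
        \<subseteq> kernel tensor_free H c"
      using mult by (auto intro!: diff)
    show "{frag_of (x, q + r) - frag_of (x, q) - frag_of (x, r) |x q r. x \<in> carrier G} \<subseteq> kernel tensor_free H c"
      using add by (auto intro!: diff)
  qed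
  then show ?thesis using n by (auto simp: kernel_def)
qed

text \<open>The extension of \<open>\<sigma>\<close> carries relations to relations, so a coset is
  mapped into a single coset; the relations added in \<open>tensor_lift\<close> fill that coset
  up.\<close>

lemma tensor_lift_pure:
  assumes \<sigma>: "\<sigma> \<in> hom G G" and x: "x \<in> carrier G"
  shows "tensor_lift G (\<lambda>(x, r). (\<sigma> x, r)) (pure_tensor x q) = pure_tensor (\<sigma> x) q"
proof -
  let ?E = "frag_extend (\<lambda>z. frag_of ((\<lambda>(x, r). (\<sigma> x, r :: rat)) z))"
  note sub = normal_imp_subgroup[OF tensor_rels_normal]
  interpret N: subgroup "tensor_rels G" tensor_free by (rule sub)
  have \<sigma>c: "\<sigma> y \<in> carrier G" if "y \<in> carrier G" for y using \<sigma> that by (auto simp: hom_def)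
  have Ec: "?E u \<in> carrier tensor_free" if "u \<in> carrier tensor_free" for u
  proof -
    have "Poly_Mapping.keys (?E u) \<subseteq> (\<Union>z\<in>Poly_Mapping.keys u. Poly_Mapping.keys (frag_of ((\<lambda>(x, r). (\<sigma> x, r :: rat)) z)))"
      by (rule keys_frag_extend)
    also have "\<dots> \<subseteq> carrier G \<times> UNIV" using that \<sigma>c by auto
    finally show ?thesis by simp
  qed
  interpret q: group_hom tensor_free "rat_tensor G" tensor_class by (rule tensor_class_hom)
  have c: "group_hom tensor_free (rat_tensor G) (\<lambda>u. tensor_class (?E u))"
  proof (intro group_hom.intro group_hom_axioms.intro rat_tensor_group homI)
    show "group tensor_free" by simp
    fix u assume u: "u \<in> carrier tensor_free"
    show "tensor_class (?E u) \<in> carrier (rat_tensor G)" using Ec[OF u] by (rule q.hom_closed)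
    fix v assume v: "v \<in> carrier tensor_free"
    show "tensor_class (?E (u \<otimes>\<^bsub>tensor_free\<^esub> v)) = tensor_class (?E u) \<otimes>\<^bsub>rat_tensor G\<^esub> tensor_class (?E v)"
      using q.hom_mult[OF Ec[OF u] Ec[OF v]] by (simp add: frag_extend_add)
  qed
  have EN: "?E n \<in> tensor_rels G" if "n \<in> tensor_rels G" for n
  proof (rule tensor_class_one_imp)
    show "?E n \<in> carrier tensor_free" by (rule Ec[OF subsetD[OF tensor_rels_sub that]])
    show "tensor_class (?E n) = \<one>\<^bsub>rat_tensor G\<^esub>"
    proof (rule tensor_rels_kernel[OF rat_tensor_comm c _ _ that])
      show "tensor_class (?E (frag_of (x \<otimes> y, q))) =
          tensor_class (?E (frag_of (x, q))) \<otimes>\<^bsub>rat_tensor G\<^esub> tensor_class (?E (frag_of (y, q)))"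
        if "x \<in> carrier G" "y \<in> carrier G" for x y q
        using that \<sigma>c pure_tensor_mult[of "\<sigma> x" "\<sigma> y" q] hom_mult[OF \<sigma>] by (simp add: pure_tensor_class)
      show "tensor_class (?E (frag_of (x, q + r))) =
          tensor_class (?E (frag_of (x, q))) \<otimes>\<^bsub>rat_tensor G\<^esub> tensor_class (?E (frag_of (x, r)))"
        if "x \<in> carrier G" for x q r
        using that \<sigma>c pure_tensor_add[of "\<sigma> x" q r] by (simp add: pure_tensor_class)
    qed
  qed
  have "tensor_lift G (\<lambda>(x, r). (\<sigma> x, r)) (pure_tensor x q)
      = {m + ?E (n + frag_of (x, q)) | m n. m \<in> tensor_rels G \<and> n \<in> tensor_rels G}"
    by (auto simp: tensor_lift_def pure_tensor_def set_mult_def r_coset_def)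
  also have "\<dots> = {m + frag_of (\<sigma> x, q) | m. m \<in> tensor_rels G}"
  proof (intro equalityI subsetI)
    fix w assume "w \<in> {m + ?E (n + frag_of (x, q)) | m n. m \<in> tensor_rels G \<and> n \<in> tensor_rels G}"
    then obtain m n where w: "m \<in> tensor_rels G" "n \<in> tensor_rels G" "w = m + ?E (n + frag_of (x, q))" by blast
    have "m + ?E n \<in> tensor_rels G" using N.m_closed[OF w(1) EN[OF w(2)]] by simp
    moreover have "w = (m + ?E n) + frag_of (\<sigma> x, q)" using w(3) by (simp add: frag_extend_add add.assoc)
    ultimately show "w \<in> {m + frag_of (\<sigma> x, q) | m. m \<in> tensor_rels G}" by blast
  next
    fix w assume "w \<in> {m + frag_of (\<sigma> x, q) | m. m \<in> tensor_rels G}"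
    then obtain m where w: "m \<in> tensor_rels G" "w = m + frag_of (\<sigma> x, q)" by blast
    have "w = m + ?E (0 + frag_of (x, q))" using w(2) by simp
    moreover have "0 \<in> tensor_rels G" using N.one_closed by simp
    ultimately show "w \<in> {m + ?E (n + frag_of (x, q)) | m n. m \<in> tensor_rels G \<and> n \<in> tensor_rels G}"
      using w(1) by blast
  qed
  also have "\<dots> = pure_tensor (\<sigma> x) q" by (auto simp: pure_tensor_def r_coset_def)
  finally show ?thesis .
qed

text \<open>\<open>f\<close> induces a map from the tensor product to the rationals that takes
  \<open>x \<otimes> r\<close> to \<open>r f(x)\<close>; at \<open>r = 1\<close> it recovers
  \<open>f\<close>.\<close>

lemma additive_rat_eq_0:
  assumes f: "\<And>x y. \<lbrakk>x \<in> carrier G; y \<in> carrier G\<rbrakk> \<Longrightarrow> f (x \<otimes> y) = f x + (f y :: int)"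
    and x: "x \<in> carrier G" "pure_tensor x 1 = \<one>\<^bsub>rat_tensor G\<^esub>"
  shows "f x = 0"
proof -
  define Q :: "rat monoid" where "Q = \<lparr>carrier = (UNIV :: rat set), monoid.mult = (+), one = 0\<rparr>"
  have Q: "comm_group Q"
    by (rule comm_groupI) (auto simp: Q_def intro: exI[of _ "- x" for x])
  interpret Q: comm_group Q by (rule Q)
  obtain c where c: "c \<in> hom tensor_free Q"
    "\<And>z. z \<in> carrier G \<times> UNIV \<Longrightarrow> c (frag_of z) = (\<lambda>(x, r). of_int (f x) * r) z"
    using Q.free_Abelian_group_universal[of "\<lambda>(x, r). of_int (f x) * r" "carrier G \<times> UNIV"]
    by (auto simp: Q_def)
  have "frag_of (x, 1) \<in> tensor_rels G"
    using x by (intro tensor_class_one_imp) (auto simp: pure_tensor_class)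
  then have "c (frag_of (x, 1)) = \<one>\<^bsub>Q\<^esub>"
  proof (rule tensor_rels_kernel[OF Q, rotated -1])
    show "group_hom tensor_free Q c"
      using c(1) by (intro group_hom.intro group_hom_axioms.intro Q.is_group) simp_all
  qed (use f in \<open>auto simp: c(2) Q_def algebra_simps\<close>)
  then show ?thesis using x(1) by (simp add: c(2) Q_def)
qed

text \<open>Coordinates in a basis are additive integer-valued maps, so by
  \<open>additive_rat_eq_0\<close> each of them vanishes on the quotient of \<open>x\<close> by
  \<open>y\<close>. Freeness enters here, as torsion would be lost in the tensor product.\<close>

lemma pure_tensor_inj:
  assumes free: "G \<cong> free_Abelian_group I" and x: "x \<in> carrier G" and y: "y \<in> carrier G"
    and eq: "pure_tensor x 1 = pure_tensor y 1"
  shows "x = y"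
proof -
  interpret p: group_hom G "rat_tensor G" "\<lambda>x. pure_tensor x 1" by (rule pure_tensor_hom)
  obtain \<theta> where \<theta>: "\<theta> \<in> Group.iso G (free_Abelian_group I)" using free by (auto simp: is_iso_def)
  let ?z = "x \<otimes> inv y"
  have z: "?z \<in> carrier G" "pure_tensor ?z 1 = \<one>\<^bsub>rat_tensor G\<^esub>"
    using x y eq by (simp_all add: pure_tensor_mult)
  have "Poly_Mapping.lookup (\<theta> ?z) i = 0" for i
    by (rule additive_rat_eq_0[OF _ z])
      (use \<theta> in \<open>auto simp: iso_def hom_mult Poly_Mapping.lookup_add\<close>)
  then have "\<theta> ?z = 0" by (intro poly_mapping_eqI) simp
  moreover have "\<theta> \<one> = 0"
    using hom_one[of \<theta> G "free_Abelian_group I"] \<theta> by (simp add: iso_def)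
  moreover have "inj_on \<theta> (carrier G)" using \<theta> by (auto simp: iso_def bij_betw_def)
  ultimately have "?z = \<one>" using z by (metis inj_onD one_closed)
  then show ?thesis using x y by (metis inv_closed inv_equality inv_inv)
qed

end

text \<open>In additive notation \<open>j y\<close> is the unique \<open>x\<close> with
  \<open>h (x \<otimes> 1) = N y \<otimes> 1\<close>: this inverts \<open>h\<close> on
  \<open>L'\<close> after multiplication by a number \<open>N\<close> that clears the denominators
  of a basis. Uniqueness, from injectivity of \<open>h\<close> and of
  \<open>x \<mapsto> x \<otimes> 1\<close>, gives additivity and equivariance; the cokernel is
  torsion because \<open>h (x \<otimes> 1)\<close> has a denominator of its own.\<close>

lemma rational_iso_equivariant_embedding:
  assumes L: "G_lattice G L \<phi>" and L': "G_lattice G L' \<phi>'"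
    and rat: "rationally_isomorphic G L \<phi> L' \<phi>'"
  obtains j where "j \<in> hom L' L" "inj_on j (carrier L')"
    "\<And>g z. \<lbrakk>g \<in> carrier G; z \<in> carrier L'\<rbrakk> \<Longrightarrow> j (\<phi>' g z) = \<phi> g (j z)"
    "\<And>x. x \<in> carrier L \<Longrightarrow> \<exists>N>0::nat. x [^]\<^bsub>L\<^esub> N \<in> j ` carrier L'"
proof -
  interpret L: comm_group L using L by (rule G_lattice.axioms)
  interpret L': comm_group L' using L' by (rule G_lattice.axioms)
  have act: "\<phi> g \<in> hom L L" "\<phi>' g \<in> hom L' L'" if "g \<in> carrier G" for g
    using hom_in_carrier[OF G_lattice.action[OF L] that] hom_in_carrier[OF G_lattice.action[OF L'] that]
    by (simp_all add: AutoGroup_def auto_def)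
  have act_closed: "g \<in> carrier G \<Longrightarrow> x \<in> carrier L \<Longrightarrow> \<phi> g x \<in> carrier L"
    "g \<in> carrier G \<Longrightarrow> z \<in> carrier L' \<Longrightarrow> \<phi>' g z \<in> carrier L'" for g x z
    using act[of g] by (auto simp: hom_def)
  obtain n n' :: nat where free: "L \<cong> free_Abelian_group {..<n}" "L' \<cong> free_Abelian_group {..<n'}"
    using G_lattice.free_of_finite_rank[OF L] G_lattice.free_of_finite_rank[OF L'] by blast
  let ?T = "rat_tensor L" and ?T' = "rat_tensor L'"
  obtain h where h: "h \<in> Group.iso ?T ?T'"
    and h_act: "\<And>g A. g \<in> carrier G \<Longrightarrow> A \<in> carrier ?T \<Longrightarrow> h (tensor_act L \<phi> g A) = tensor_act L' \<phi>' g (h A)"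
    using rat unfolding rationally_isomorphic_def by blast
  interpret h: group_hom ?T ?T' h
    using h by (intro group_hom.intro group_hom_axioms.intro L.rat_tensor_group L'.rat_tensor_group) (simp add: iso_def)
  have h_inj: "inj_on h (carrier ?T)" and h_surj: "h ` carrier ?T = carrier ?T'"
    using h by (auto simp: iso_def bij_betw_def)
  interpret p: group_hom L ?T "\<lambda>x. L.pure_tensor x 1" by (rule L.pure_tensor_hom)
  interpret p': group_hom L' ?T' "\<lambda>x. L'.pure_tensor x 1" by (rule L'.pure_tensor_hom)
  have inj: "x = y" if "x \<in> carrier L" "y \<in> carrier L" "h (L.pure_tensor x 1) = h (L.pure_tensor y 1)" for x y
  proof -
    have "L.pure_tensor x 1 = L.pure_tensor y 1"
      by (rule inj_onD[OF h_inj that(3)]) (use that in simp_all)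
    then show ?thesis by (rule L.pure_tensor_inj[OF free(1) that(1,2)])
  qed
  define S where "S N = {y \<in> carrier L'. \<exists>x\<in>carrier L. h (L.pure_tensor x 1) = L'.pure_tensor (y [^]\<^bsub>L'\<^esub> N) 1}" for N :: nat
  have S_ex: "\<exists>N>0. y \<in> S N" if y: "y \<in> carrier L'" for y
  proof -
    have "L'.pure_tensor y 1 \<in> h ` carrier ?T" using y h_surj by simp
    then obtain A where A: "A \<in> carrier ?T" "h A = L'.pure_tensor y 1" by auto
    obtain x N where x: "x \<in> carrier L" "N > 0" "A = L.pure_tensor x (1 / of_nat N)"
      using L.tensor_is_pure[OF A(1)] by blast
    have "L.pure_tensor x 1 = L.pure_tensor (x [^]\<^bsub>L\<^esub> N) (1 / of_nat N)"
      using x by (simp add: L.pure_tensor_pow)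
    also have "\<dots> = A [^]\<^bsub>?T\<^esub> N"
    proof -
      interpret p2: group_hom L ?T "\<lambda>x. L.pure_tensor x (1 / of_nat N)" by (rule L.pure_tensor_hom)
      show ?thesis using x p2.hom_nat_pow[of x N] by simp
    qed
    finally have "h (L.pure_tensor x 1) = L'.pure_tensor y 1 [^]\<^bsub>?T'\<^esub> N"
      using A h.hom_nat_pow[of A N] by simp
    also have "\<dots> = L'.pure_tensor (y [^]\<^bsub>L'\<^esub> N) 1" using p'.hom_nat_pow[OF y, of N] by simp
    finally show ?thesis using x y unfolding S_def by blast
  qed
  have S_mult: "y \<in> S (M * N)" if y: "y \<in> S M" for y M N
  proof -
    obtain x where x: "y \<in> carrier L'" "x \<in> carrier L" "h (L.pure_tensor x 1) = L'.pure_tensor (y [^]\<^bsub>L'\<^esub> M) 1"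
      using y by (auto simp: S_def)
    have "h (L.pure_tensor (x [^]\<^bsub>L\<^esub> N) 1) = h (L.pure_tensor x 1) [^]\<^bsub>?T'\<^esub> N"
      using x p.hom_nat_pow[OF x(2), of N] h.hom_nat_pow[of "L.pure_tensor x 1" N] by simp
    also have "\<dots> = L'.pure_tensor ((y [^]\<^bsub>L'\<^esub> M) [^]\<^bsub>L'\<^esub> N) 1"
      unfolding x(3) using x(1) p'.hom_nat_pow[of "y [^]\<^bsub>L'\<^esub> M" N] by simp
    finally have "h (L.pure_tensor (x [^]\<^bsub>L\<^esub> N) 1) = L'.pure_tensor (y [^]\<^bsub>L'\<^esub> (M * N)) 1"
      using x(1) by (simp add: L'.nat_pow_pow)
    then show ?thesis using x by (auto simp: S_def)
  qed
  obtain \<theta> where \<theta>: "\<theta> \<in> Group.iso (free_Abelian_group {..<n'}) L'"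
    using free(2) L'.iso_sym by (metis is_iso_def ex_in_conv)
  have \<theta>_hom: "group_hom (free_Abelian_group {..<n'}) L' \<theta>"
    using \<theta> by (intro group_hom.intro group_hom_axioms.intro L'.is_group) (simp_all add: iso_def)
  interpret \<theta>: group_hom "free_Abelian_group {..<n'}" L' \<theta> by (rule \<theta>_hom)
  \<comment> \<open>For \<open>i \<ge> n'\<close> any positive value serves; requiring one for every
    \<open>i\<close> lets a function \<open>M\<close> be chosen.\<close>
  have "\<forall>i. \<exists>M>0. i < n' \<longrightarrow> \<theta> (frag_of i) \<in> S M"
    using S_ex \<theta>.hom_closed by (metis frag_of_in_free_Abelian_group lessThan_iff zero_less_one)
  then obtain M where M: "\<And>i. M i > 0" "\<And>i. i < n' \<Longrightarrow> \<theta> (frag_of i) \<in> S (M i)" by metis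
  \<comment> \<open>The product of the denominators serves for the whole basis, and then, since
    \<open>S N\<close> is closed under differences, for all of \<open>L'\<close>.\<close>
  define N where "N = (\<Prod>i<n'. M i)"
  have N: "N > 0" using M(1) by (simp add: N_def prod_pos)
  have gens: "\<theta> (frag_of i) \<in> S N" if i: "i < n'" for i
  proof -
    have "N = M i * (\<Prod>k\<in>{..<n'} - {i}. M k)" unfolding N_def using i by (intro prod.remove) auto
    then show ?thesis using S_mult[OF M(2)[OF i]] by simp
  qed
  have S_all: "y \<in> S N" if y: "y \<in> carrier L'" for y
  proof -
    have "\<theta> u \<in> S N" if "Poly_Mapping.keys u \<subseteq> {..<n'}" for u
      using that
    proof (rule free_Abelian_group_induct)
      have "h (L.pure_tensor \<one>\<^bsub>L\<^esub> 1) = L'.pure_tensor (\<one>\<^bsub>L'\<^esub> [^]\<^bsub>L'\<^esub> N) 1"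
        using p.hom_one p'.hom_one h.hom_one by simp
      moreover have "\<theta> 0 = \<one>\<^bsub>L'\<^esub>" using \<theta>.hom_one by simp
      ultimately show "\<theta> 0 \<in> S N" unfolding S_def using L.one_closed L'.one_closed by (metis (mono_tags, lifting) mem_Collect_eq)
      show "\<theta> (frag_of i) \<in> S N" if "i \<in> {..<n'}" for i using gens that by simp
    next
      fix u v assume uv: "Poly_Mapping.keys u \<subseteq> {..<n'}" "Poly_Mapping.keys v \<subseteq> {..<n'}"
        and "\<theta> u \<in> S N" "\<theta> v \<in> S N"
      then obtain a b where a: "a \<in> carrier L" "h (L.pure_tensor a 1) = L'.pure_tensor (\<theta> u [^]\<^bsub>L'\<^esub> N) 1"
        and b: "b \<in> carrier L" "h (L.pure_tensor b 1) = L'.pure_tensor (\<theta> v [^]\<^bsub>L'\<^esub> N) 1"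
        and c: "\<theta> u \<in> carrier L'" "\<theta> v \<in> carrier L'" by (auto simp: S_def)
      have vc: "v \<in> carrier (free_Abelian_group {..<n'})" "u \<in> carrier (free_Abelian_group {..<n'})" using uv by simp_all
      have "\<theta> (u - v) = \<theta> (u \<otimes>\<^bsub>free_Abelian_group {..<n'}\<^esub> inv\<^bsub>free_Abelian_group {..<n'}\<^esub> v)" using uv by simp
      also have "\<dots> = \<theta> u \<otimes>\<^bsub>L'\<^esub> inv\<^bsub>L'\<^esub> \<theta> v"
        by (simp only: \<theta>.hom_mult[OF vc(2) \<theta>.G.inv_closed[OF vc(1)]] \<theta>.hom_inv[OF vc(1)])
      finally have eq: "\<theta> (u - v) = \<theta> u \<otimes>\<^bsub>L'\<^esub> inv\<^bsub>L'\<^esub> \<theta> v" .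
      have "(\<theta> u \<otimes>\<^bsub>L'\<^esub> inv\<^bsub>L'\<^esub> \<theta> v) [^]\<^bsub>L'\<^esub> N = \<theta> u [^]\<^bsub>L'\<^esub> N \<otimes>\<^bsub>L'\<^esub> inv\<^bsub>L'\<^esub> (\<theta> v [^]\<^bsub>L'\<^esub> N)"
        using c by (simp add: L'.nat_pow_distrib L'.nat_pow_inv)
      then have "h (L.pure_tensor (a \<otimes>\<^bsub>L\<^esub> inv\<^bsub>L\<^esub> b) 1) = L'.pure_tensor (\<theta> (u - v) [^]\<^bsub>L'\<^esub> N) 1"
        unfolding eq using a b c p.hom_mult p.hom_inv p'.hom_mult p'.hom_inv by simp
      then show "\<theta> (u - v) \<in> S N" unfolding S_def eq using a b c by (auto intro!: bexI[of _ "a \<otimes>\<^bsub>L\<^esub> inv\<^bsub>L\<^esub> b"])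
    qed
    moreover have "y \<in> \<theta> ` carrier (free_Abelian_group {..<n'})" using \<theta> y by (auto simp: iso_def bij_betw_def)
    ultimately show ?thesis by auto
  qed
  then have "\<forall>y\<in>carrier L'. \<exists>x. x \<in> carrier L \<and> h (L.pure_tensor x 1) = L'.pure_tensor (y [^]\<^bsub>L'\<^esub> N) 1"
    by (auto simp: S_def)
  then obtain j where j: "\<And>y. y \<in> carrier L' \<Longrightarrow> j y \<in> carrier L"
    "\<And>y. y \<in> carrier L' \<Longrightarrow> h (L.pure_tensor (j y) 1) = L'.pure_tensor (y [^]\<^bsub>L'\<^esub> N) 1" by metis
  show ?thesis
  proof (rule that[of j])
    show "j \<in> hom L' L"
    proof (rule homI)
      fix y z assume yz: "y \<in> carrier L'" "z \<in> carrier L'"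
      show "j (y \<otimes>\<^bsub>L'\<^esub> z) = j y \<otimes>\<^bsub>L\<^esub> j z"
      proof (rule inj)
        have "h (L.pure_tensor (j y \<otimes>\<^bsub>L\<^esub> j z) 1) = h (L.pure_tensor (j y) 1) \<otimes>\<^bsub>?T'\<^esub> h (L.pure_tensor (j z) 1)"
          using j(1) yz by simp
        also have "\<dots> = L'.pure_tensor ((y \<otimes>\<^bsub>L'\<^esub> z) [^]\<^bsub>L'\<^esub> N) 1"
          using yz by (simp add: j(2) L'.nat_pow_distrib)
        finally show "h (L.pure_tensor (j (y \<otimes>\<^bsub>L'\<^esub> z)) 1) = h (L.pure_tensor (j y \<otimes>\<^bsub>L\<^esub> j z) 1)"
          using yz by (simp add: j(2))
      qed (use j(1) yz in auto)
    qed (rule j(1))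
    show "inj_on j (carrier L')"
    proof (rule inj_onI)
      fix y z assume yz: "y \<in> carrier L'" "z \<in> carrier L'" "j y = j z"
      have eq: "L'.pure_tensor (y [^]\<^bsub>L'\<^esub> N) 1 = L'.pure_tensor (z [^]\<^bsub>L'\<^esub> N) 1"
        using j(2)[OF yz(1)] j(2)[OF yz(2)] unfolding yz(3) by (rule trans[OF sym])
      have "y [^]\<^bsub>L'\<^esub> N = z [^]\<^bsub>L'\<^esub> N"
        by (rule L'.pure_tensor_inj[OF free(2) _ _ eq]) (use yz in simp_all)
      \<comment> \<open>Equality of the \<open>N\<close>-th powers is divided by \<open>N\<close>
        inside the tensor product.\<close>
      moreover have "L'.pure_tensor w 1 = L'.pure_tensor (w [^]\<^bsub>L'\<^esub> N) (1 / of_nat N)" if "w \<in> carrier L'" for w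
        using that N by (simp add: L'.pure_tensor_pow)
      ultimately have "L'.pure_tensor y 1 = L'.pure_tensor z 1" using yz by simp
      then show "y = z" by (rule L'.pure_tensor_inj[OF free(2) yz(1,2)])
    qed
    show "j (\<phi>' g z) = \<phi> g (j z)" if gz: "g \<in> carrier G" "z \<in> carrier L'" for g z
    proof (rule inj)
      interpret a: group_hom L' L' "\<phi>' g" by unfold_locales (rule act(2)[OF gz(1)])
      have "h (L.pure_tensor (\<phi> g (j z)) 1) = h (tensor_act L \<phi> g (L.pure_tensor (j z) 1))"
        using L.tensor_lift_pure[OF act(1)[OF gz(1)] j(1)[OF gz(2)]] by (simp add: tensor_act_def)
      also have "\<dots> = tensor_act L' \<phi>' g (L'.pure_tensor (z [^]\<^bsub>L'\<^esub> N) 1)"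
        using h_act gz j by simp
      also have "\<dots> = L'.pure_tensor (\<phi>' g (z [^]\<^bsub>L'\<^esub> N)) 1"
        using L'.tensor_lift_pure[OF act(2)[OF gz(1)], of "z [^]\<^bsub>L'\<^esub> N"] gz by (simp add: tensor_act_def)
      also have "\<dots> = L'.pure_tensor ((\<phi>' g z) [^]\<^bsub>L'\<^esub> N) 1" using a.hom_nat_pow[OF gz(2)] by simp
      finally show "h (L.pure_tensor (j (\<phi>' g z)) 1) = h (L.pure_tensor (\<phi> g (j z)) 1)"
        using gz by (simp add: j(2))
    qed (use j(1) gz act_closed in auto)
    show "\<exists>N>0::nat. x [^]\<^bsub>L\<^esub> N \<in> j ` carrier L'" if x: "x \<in> carrier L" for x
    proof -
      have hx: "h (L.pure_tensor x 1) \<in> carrier ?T'" using x by simp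
      obtain y k where y: "y \<in> carrier L'" "k > 0" "h (L.pure_tensor x 1) = L'.pure_tensor y (1 / of_nat k)"
        using L'.tensor_is_pure[OF hx] by blast
      \<comment> \<open>The exponent combines the denominator \<open>k\<close> of the image of
        \<open>x\<close> with the factor \<open>N\<close> built into \<open>j\<close>.\<close>
      have "h (L.pure_tensor (x [^]\<^bsub>L\<^esub> (k * N)) 1) = h (L.pure_tensor x 1) [^]\<^bsub>?T'\<^esub> (k * N)"
        using x p.hom_nat_pow[OF x, of "k * N"] h.hom_nat_pow[of "L.pure_tensor x 1" "k * N"] by simp
      also have "\<dots> = L'.pure_tensor (y [^]\<^bsub>L'\<^esub> (k * N)) (1 / of_nat k)"
      proof -
        interpret p2: group_hom L' ?T' "\<lambda>x. L'.pure_tensor x (1 / of_nat k)" by (rule L'.pure_tensor_hom)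
        show ?thesis unfolding y(3) using p2.hom_nat_pow[OF y(1)] by simp
      qed
      also have "\<dots> = L'.pure_tensor (y [^]\<^bsub>L'\<^esub> N) 1" using y by (simp add: L'.pure_tensor_pow)
      finally have "h (L.pure_tensor (x [^]\<^bsub>L\<^esub> (k * N)) 1) = h (L.pure_tensor (j y) 1)" using j(2)[OF y(1)] by simp
      then have "x [^]\<^bsub>L\<^esub> (k * N) = j y" using x j(1)[OF y(1)] by (intro inj) auto
      then show ?thesis using y N by (intro exI[of _ "k * N"]) auto
    qed
  qed
qed

theorem proposition3p4:
  fixes G :: "('g, 'n) monoid_scheme"
    and K :: "('k, 'r) ring_scheme"
    and L :: "('l, 'm) monoid_scheme"
    and L' :: "('l2, 'm2) monoid_scheme"
    and \<phi> :: "'g \<Rightarrow> 'l \<Rightarrow> 'l"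
    and \<phi>' :: "'g \<Rightarrow> 'l2 \<Rightarrow> 'l2"
  assumes "group G" and "finite (carrier G)"
    and "cring K"
    and "G_lattice G L \<phi>"
    and "cohen_macaulay (invariant_algebra K G L \<phi>)"
    and "G_lattice G L' \<phi>'"
    and "rationally_isomorphic G L \<phi> L' \<phi>'"
  shows "cohen_macaulay (invariant_algebra K G L' \<phi>')"
proof -
  obtain j where j: "j \<in> hom L' L" "inj_on j (carrier L')"
    "\<And>g z. \<lbrakk>g \<in> carrier G; z \<in> carrier L'\<rbrakk> \<Longrightarrow> j (\<phi>' g z) = \<phi> g (j z)"
    "\<And>x. x \<in> carrier L \<Longrightarrow> \<exists>N>0::nat. x [^]\<^bsub>L\<^esub> N \<in> j ` carrier L'"
    by (rule rational_iso_equivariant_embedding[OF assms(4,6,7)]) blast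
  \<comment> \<open>\<open>L'\<close> is embedded in \<open>L\<close>, so it takes the place of
    \<open>M\<close>, and its invariants form the ring \<open>A\<close> to which the property
    descends.\<close>
  interpret isogeny K L L' j G \<phi> \<phi>'
    by (intro isogeny.intro group_ring_embedding.intro group_ring.intro group_ring_embedding_axioms.intro
        acted_group_ring.intro acted_group_ring_axioms.intro isogeny_axioms.intro
        assms(1,2,3) G_lattice.axioms(2)[OF assms(4)] G_lattice.axioms(2)[OF assms(6)]
        G_lattice.action[OF assms(4)] G_lattice.action[OF assms(6)] j)
  show ?thesis using assms(5) by (rule cohen_macaulay_A)
qed

end
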